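(* Let $g\geq 2$. The spaces $M_g^{\rm trop}[3]$ and ${\rm Sch}_g^{\rm trop}$ have pure dimension $3g-3$ and are connected through codimension one. The same holds for $M_g^{\rm pure}[3]$ and ${\rm Sch}_g^{\rm pure}$.
   Context: A weighted graph is a pair $(\Gamma,w)$, $\Gamma$ a finite connected graph (no legs), $w:V(\Gamma)\to\mathbb{Z}_{\geq0}$; genus $g=b_1(\Gamma)+\sum_v w(v)$; stable if every weight-0 vertex has valency $\geq 3$. Weighted contraction of $S\subset E(\Gamma)$: contract the edges of $S$, giving each new vertex the weight $b_1$ of its preimage plus the sum of the weights in the preimage. $M(\Gamma,w)=(\mathbb{R}_{>0})^{E(\Gamma)}/\mathrm{Aut}(\Gamma,w)$ is a connected orbifold of dimension $|E(\Gamma)|$; $M_g^{\rm trop}=\coprod M(\Gamma,w)$ over stable genus-$g$ weighted graphs, topologized so that each stratum embeds homeomorphically and $M(\Gamma',w')\subset\overline{M(\Gamma,w)}$ iff $(\Gamma',w')$ is a weighted contraction of $(\Gamma,w)$. $M_g^{\rm pure}$ is the union of strata with $w\equiv 0$. A graph is 3-edge-connected if it has a vertex and stays connected after deleting any fewer than 3 edges; $M_g^{\rm trop}[3]$ (resp. $M_g^{\rm pure}[3]$) is the union of the strata $M(\Gamma,w)$ of $M_g^{\rm trop}$ (resp. $M_g^{\rm pure}$) with $\Gamma$ 3-edge-connected. The tropical Torelli map $t_g^{\rm trop}:M_g^{\rm trop}\to A_g^{\rm trop}$ sends a tropical curve to its tropical Jacobian; ${\rm Sch}_g^{\rm trop}$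 is its image, identified with the quotient topological space $M_g^{\rm trop}/\!\equiv$ where two curves are equivalent iff they have the same image (similarly ${\rm Sch}_g^{\rm pure}$ from $M_g^{\rm pure}$). Known background facts: $t_g^{\rm trop}(M_g^{\rm trop}[3])={\rm Sch}_g^{\rm trop}$, the restriction of $t_g^{\rm trop}$ to $M_g^{\rm trop}[3]$ has finite fibers and is injective (a homeomorphism onto its image) on each stratum $M(\Gamma,w)$, and ${\rm Sch}_g^{\rm trop}$ is decomposed into the images of these strata; analogously for the pure versions. A space $X$ of pure dimension $d$ with a decomposition into connected orbifolds $X_i$ is connected through codimension one if $\coprod_{\dim X_i\geq d-1}X_i$ is connected. *)

theory Defs
  imports "HOL-Analysis.Analysis"
begin

section \<open>Finite multigraphs with vertex weights\<close>

text \<open>A (weighted) graph: finite vertex set, finite edge set, each edge has two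
  endpoints (loops allowed, multiple edges allowed; the orientation src/tgt is an
  auxiliary choice used only to define integral cycles), and a weight function.\<close>

record wgraph =
  verts :: "nat set"
  edges :: "nat set"
  src   :: "nat \<Rightarrow> nat"
  tgt   :: "nat \<Rightarrow> nat"
  wt    :: "nat \<Rightarrow> nat"

definition ends :: "wgraph \<Rightarrow> nat \<Rightarrow> nat set" where
  "ends G e = {src G e, tgt G e}"

definition wf_graph :: "wgraph \<Rightarrow> bool" where
  "wf_graph G \<longleftrightarrow> finite (verts G) \<and> finite (edges G) \<and>
     (\<forall>e\<in>edges G. src G e \<in> verts G \<and> tgt G e \<in> verts G)"

text \<open>Adjacency relation (symmetric) using only the edges in A.\<close>
definition adj_on :: "wgraph \<Rightarrow> nat set \<Rightarrow> (nat \<times> nat) set" where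
  "adj_on G A = {(src G e, tgt G e) | e. e \<in> A} \<union> {(tgt G e, src G e) | e. e \<in> A}"

text \<open>The graph with edge set restricted to A has a vertex and is connected.\<close>
definition conn_with :: "wgraph \<Rightarrow> nat set \<Rightarrow> bool" where
  "conn_with G A \<longleftrightarrow> verts G \<noteq> {} \<and>
     (\<forall>a\<in>verts G. \<forall>b\<in>verts G. (a, b) \<in> (adj_on G A)\<^sup>*)"

definition connected_graph :: "wgraph \<Rightarrow> bool" where
  "connected_graph G \<longleftrightarrow> conn_with G (edges G)"

text \<open>3-edge-connected: has a vertex and stays connected after deleting fewer than 3 edges.\<close>
definition three_edge_connected :: "wgraph \<Rightarrow> bool" where
  "three_edge_connected G \<longleftrightarrow> verts G \<noteq> {} \<and>
     (\<forall>F \<subseteq> edges G. card F < 3 \<longrightarrow> conn_with G (edges G - F))"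

text \<open>First Betti number of a connected graph.\<close>
definition b1 :: "wgraph \<Rightarrow> nat" where
  "b1 G = card (edges G) + 1 - card (verts G)"

definition genus :: "wgraph \<Rightarrow> nat" where
  "genus G = b1 G + (\<Sum>v\<in>verts G. wt G v)"

text \<open>Valency; a loop counts twice.\<close>
definition valence :: "wgraph \<Rightarrow> nat \<Rightarrow> nat" where
  "valence G v = card {e \<in> edges G. src G e = v} + card {e \<in> edges G. tgt G e = v}"

definition stable_graph :: "wgraph \<Rightarrow> bool" where
  "stable_graph G \<longleftrightarrow> (\<forall>v\<in>verts G. wt G v = 0 \<longrightarrow> valence G v \<ge> 3)"

definition pure_graph :: "wgraph \<Rightarrow> bool" where
  "pure_graph G \<longleftrightarrow> (\<forall>v\<in>verts G. wt G v = 0)"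

text \<open>Stable weighted graphs of genus g.\<close>
definition SG :: "nat \<Rightarrow> wgraph set" where
  "SG g = {G. wf_graph G \<and> connected_graph G \<and> stable_graph G \<and> genus G = g}"

section \<open>Tropical curves and their isomorphism classes\<close>

type_synonym tcurve = "wgraph \<times> (nat \<Rightarrow> real)"

definition curve_iso :: "tcurve \<Rightarrow> tcurve \<Rightarrow> bool" where
  "curve_iso c c' \<longleftrightarrow> (case c of (G, l) \<Rightarrow> case c' of (H, m) \<Rightarrow>
     (\<exists>\<phi> \<psi>. bij_betw \<phi> (verts G) (verts H) \<and> bij_betw \<psi> (edges G) (edges H) \<and>
        (\<forall>e\<in>edges G. ends H (\<psi> e) = \<phi> ` ends G e \<and> m (\<psi> e) = l e) \<and>
        (\<forall>v\<in>verts G. wt H (\<phi> v) = wt G v)))"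

definition cls :: "tcurve \<Rightarrow> tcurve set" where
  "cls c = {c'. curve_iso c c'}"

text \<open>Closed orthant of edge lengths (lengths vanish off the edge set) and its interior.\<close>
definition orth :: "wgraph \<Rightarrow> (nat \<Rightarrow> real) set" where
  "orth G = {l. (\<forall>e\<in>edges G. 0 \<le> l e) \<and> (\<forall>e. e \<notin> edges G \<longrightarrow> l e = 0)}"

definition pos_orth :: "wgraph \<Rightarrow> (nat \<Rightarrow> real) set" where
  "pos_orth G = {l. (\<forall>e\<in>edges G. 0 < l e) \<and> (\<forall>e. e \<notin> edges G \<longrightarrow> l e = 0)}"

text \<open>(H,m) is the weighted contraction of (G,l) along the set of zero-length edges,
  with the remaining lengths transported.\<close>
definition ccontr :: "tcurve \<Rightarrow> tcurve \<Rightarrow> bool" where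
  "ccontr c c' \<longleftrightarrow> (case c of (G, l) \<Rightarrow> case c' of (H, m) \<Rightarrow>
     wf_graph H \<and>
     (let S = {e \<in> edges G. l e = 0} in
      \<exists>\<phi> \<psi>. \<phi> ` verts G = verts H \<and> bij_betw \<psi> (edges G - S) (edges H) \<and>
        (\<forall>e\<in>edges G - S. ends H (\<psi> e) = \<phi> ` ends G e \<and> m (\<psi> e) = l e) \<and>
        (\<forall>e. e \<notin> edges H \<longrightarrow> m e = 0) \<and>
        (\<forall>e\<in>S. \<phi> (src G e) = \<phi> (tgt G e)) \<and>
        (\<forall>v\<in>verts H.
           let F = {u \<in> verts G. \<phi> u = v}; SF = {e \<in> S. \<phi> (src G e) = v} in
           (\<forall>a\<in>F. \<forall>b\<in>F. (a, b) \<in> (adj_on G SF)\<^sup>*) \<and>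
           wt H v = (card SF + 1 - card F) + (\<Sum>u\<in>F. wt G u))))"

text \<open>The point of the moduli space determined by a graph G and a length vector in the
  closed orthant (zero-length edges contracted).\<close>
definition pt :: "wgraph \<Rightarrow> (nat \<Rightarrow> real) \<Rightarrow> tcurve set" where
  "pt G l = cls (SOME c. ccontr (G, l) c)"

section \<open>Final (quotient) topologies\<close>

definition final_topology ::
  "'i set \<Rightarrow> ('i \<Rightarrow> 'a topology) \<Rightarrow> ('i \<Rightarrow> 'a \<Rightarrow> 'b) \<Rightarrow> 'b set \<Rightarrow> 'b topology" where
  "final_topology I X f S = topology (\<lambda>U. U \<subseteq> S \<and>
      (\<forall>i\<in>I. openin (X i) {x \<in> topspace (X i). f i x \<in> U}))"

lemma istopology_final:
  "istopology (\<lambda>U. U \<subseteq> S \<and> (\<forall>i\<in>I. openin (X i) {x \<in> topspace (X i). f i x \<in> U}))"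
proof -
  have int: "{x \<in> topspace (X i). f i x \<in> U \<inter> V} =
      {x \<in> topspace (X i). f i x \<in> U} \<inter> {x \<in> topspace (X i). f i x \<in> V}" for i U V
    by auto
  have un: "{x \<in> topspace (X i). f i x \<in> \<Union>K} =
      \<Union>((\<lambda>U. {x \<in> topspace (X i). f i x \<in> U}) ` K)" for i K
    by auto
  have h1: "U \<inter> V \<subseteq> S \<and> (\<forall>i\<in>I. openin (X i) {x \<in> topspace (X i). f i x \<in> U \<inter> V})"
    if U: "U \<subseteq> S \<and> (\<forall>i\<in>I. openin (X i) {x \<in> topspace (X i). f i x \<in> U})"
      and V: "V \<subseteq> S \<and> (\<forall>i\<in>I. openin (X i) {x \<in> topspace (X i). f i x \<in> V})" for U V
  proof (intro conjI ballI)
    show "U \<inter> V \<subseteq> S" using U V by blast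
    fix i assume i: "i \<in> I"
    have "openin (X i) ({x \<in> topspace (X i). f i x \<in> U} \<inter> {x \<in> topspace (X i). f i x \<in> V})"
      by (rule openin_Int) (use U V i in blast)+
    then show "openin (X i) {x \<in> topspace (X i). f i x \<in> U \<inter> V}" by (simp only: int)
  qed
  have h2: "\<Union>K \<subseteq> S \<and> (\<forall>i\<in>I. openin (X i) {x \<in> topspace (X i). f i x \<in> \<Union>K})"
    if K: "\<forall>U\<in>K. U \<subseteq> S \<and> (\<forall>i\<in>I. openin (X i) {x \<in> topspace (X i). f i x \<in> U})" for K
  proof (intro conjI ballI)
    show "\<Union>K \<subseteq> S" using K by blast
    fix i assume i: "i \<in> I"
    have "openin (X i) (\<Union>((\<lambda>U. {x \<in> topspace (X i). f i x \<in> U}) ` K))"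
      by (rule openin_Union) (use K i in blast)
    then show "openin (X i) {x \<in> topspace (X i). f i x \<in> \<Union>K}" by (simp only: un)
  qed
  show ?thesis
    unfolding istopology_def using h1 h2 by blast
qed

lemma openin_final_topology:
  "openin (final_topology I X f S) U \<longleftrightarrow>
     U \<subseteq> S \<and> (\<forall>i\<in>I. openin (X i) {x \<in> topspace (X i). f i x \<in> U})"
  unfolding final_topology_def using istopology_final[of S I X f] by simp

section \<open>The tropical moduli space and its strata\<close>

definition Mtrop_pts :: "nat \<Rightarrow> tcurve set set" where
  "Mtrop_pts g = {cls (G, l) | G l. G \<in> SG g \<and> l \<in> pos_orth G}"

text \<open>M_g^trop: quotient of the disjoint union of closed orthants over all stable
  genus-g weighted graphs.\<close>
definition Mtrop :: "nat \<Rightarrow> tcurve set topology" where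
  "Mtrop g = final_topology (SG g) (\<lambda>G. top_of_set (orth G)) pt (Mtrop_pts g)"

text \<open>The stratum M(Gamma,w).\<close>
definition stratum :: "wgraph \<Rightarrow> tcurve set set" where
  "stratum G = {cls (G, l) | l. l \<in> pos_orth G}"

definition Mpure_pts :: "nat \<Rightarrow> tcurve set set" where
  "Mpure_pts g = \<Union>{stratum G | G. G \<in> SG g \<and> pure_graph G}"

definition Mpure :: "nat \<Rightarrow> tcurve set topology" where
  "Mpure g = subtopology (Mtrop g) (Mpure_pts g)"

definition M3 :: "nat \<Rightarrow> tcurve set topology" where
  "M3 g = subtopology (Mtrop g) (\<Union>{stratum G | G. G \<in> SG g \<and> three_edge_connected G})"

definition Mpure3 :: "nat \<Rightarrow> tcurve set topology" where
  "Mpure3 g = subtopology (Mtrop g)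
     (\<Union>{stratum G | G. G \<in> SG g \<and> pure_graph G \<and> three_edge_connected G})"

section \<open>Tropical Jacobians and the Schottky locus\<close>

text \<open>Integral cycles H_1(Gamma, Z).\<close>
definition cycles :: "wgraph \<Rightarrow> (nat \<Rightarrow> int) set" where
  "cycles G = {x. (\<forall>e. e \<notin> edges G \<longrightarrow> x e = 0) \<and>
     (\<forall>v\<in>verts G. (\<Sum>e\<in>{e \<in> edges G. tgt G e = v}. x e) =
                   (\<Sum>e\<in>{e \<in> edges G. src G e = v}. x e))}"

text \<open>The lattice Z^g = H_1(Gamma,Z) (+) Z^{|w|} carrying the tropical Jacobian form
  (positive definite on H_1, zero on the weight part).\<close>
definition jlat :: "wgraph \<Rightarrow> (nat + nat \<Rightarrow> int) set" where
  "jlat G = {x. (\<lambda>e. x (Inl e)) \<in> cycles G \<and>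
      (\<forall>i. i \<ge> (\<Sum>v\<in>verts G. wt G v) \<longrightarrow> x (Inr i) = 0)}"

definition jform :: "tcurve \<Rightarrow> (nat + nat \<Rightarrow> int) \<Rightarrow> real" where
  "jform c x = (case c of (G, l) \<Rightarrow> (\<Sum>e\<in>edges G. l e * (real_of_int (x (Inl e)))\<^sup>2))"

text \<open>Two tropical curves have the same tropical Jacobian iff their lattices with
  quadratic forms are isometric (i.e. the forms are GL_g(Z)-equivalent).\<close>
definition jac_equiv :: "tcurve \<Rightarrow> tcurve \<Rightarrow> bool" where
  "jac_equiv c c' \<longleftrightarrow> (\<exists>f. bij_betw f (jlat (fst c)) (jlat (fst c')) \<and>
      (\<forall>x\<in>jlat (fst c). \<forall>y\<in>jlat (fst c). f (\<lambda>j. x j + y j) = (\<lambda>j. f x j + f y j)) \<and>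
      (\<forall>x\<in>jlat (fst c). jform c' (f x) = jform c x))"

definition jequiv :: "tcurve set \<Rightarrow> tcurve set \<Rightarrow> bool" where
  "jequiv p q \<longleftrightarrow> (\<exists>c\<in>p. \<exists>c'\<in>q. jac_equiv c c')"

definition schcls :: "tcurve set set \<Rightarrow> tcurve set \<Rightarrow> tcurve set set" where
  "schcls P p = {q \<in> P. jequiv p q}"

definition Sch :: "nat \<Rightarrow> tcurve set set topology" where
  "Sch g = final_topology {()} (\<lambda>_. Mtrop g) (\<lambda>_. schcls (Mtrop_pts g))
             (schcls (Mtrop_pts g) ` Mtrop_pts g)"

definition Sch_pure :: "nat \<Rightarrow> tcurve set set topology" where
  "Sch_pure g = final_topology {()} (\<lambda>_. Mpure g) (\<lambda>_. schcls (Mpure_pts g))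
             (schcls (Mpure_pts g) ` Mpure_pts g)"

section \<open>Decompositions into cells (set, dimension)\<close>

definition cellsM3 :: "nat \<Rightarrow> (tcurve set set \<times> nat) set" where
  "cellsM3 g = {(stratum G, card (edges G)) | G. G \<in> SG g \<and> three_edge_connected G}"

definition cellsMpure3 :: "nat \<Rightarrow> (tcurve set set \<times> nat) set" where
  "cellsMpure3 g = {(stratum G, card (edges G)) | G.
      G \<in> SG g \<and> pure_graph G \<and> three_edge_connected G}"

definition cellsSch :: "nat \<Rightarrow> (tcurve set set set \<times> nat) set" where
  "cellsSch g = {(schcls (Mtrop_pts g) ` stratum G, card (edges G)) | G.
      G \<in> SG g \<and> three_edge_connected G}"

definition cellsSch_pure :: "nat \<Rightarrow> (tcurve set set set \<times> nat) set" where
  "cellsSch_pure g = {(schcls (Mpure_pts g) ` stratum G, card (edges G)) | G.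
      G \<in> SG g \<and> pure_graph G \<and> three_edge_connected G}"

text \<open>Pure dimension d: every cell has dimension at most d, and the union of the
  d-dimensional cells is dense.\<close>
definition pure_dim :: "'a topology \<Rightarrow> ('a set \<times> nat) set \<Rightarrow> nat \<Rightarrow> bool" where
  "pure_dim X C d \<longleftrightarrow> (\<forall>(S, k)\<in>C. k \<le> d) \<and>
     topspace X \<subseteq> X closure_of (\<Union>{S. (S, d) \<in> C})"

text \<open>Connected through codimension one: the union of the cells of dimension
  at least d-1 is connected.\<close>
definition conn_codim1 :: "'a topology \<Rightarrow> ('a set \<times> nat) set \<Rightarrow> nat \<Rightarrow> bool" where
  "conn_codim1 X C d \<longleftrightarrow> connectedin X (\<Union>{S. \<exists>k. (S, k) \<in> C \<and> k + 1 \<ge> d})"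

end

theory Submission
  imports Defs
begin

text \<open>
  A 3-edge-connected stable graph with fewer than \<open>3g - 3\<close> edges is a weighted contraction of one with
  one more edge: turn a unit of weight into a loop, or split a vertex of valence at least 4 of a pure
  graph without creating a small cut. Hence the strata of dimension \<open>3g - 3\<close> are dense, and by counting
  valences the strata of codimension at most one are pure. On the Schottky side, contracting a bridge
  or one edge of a 2-edge cut (and lengthening the other edge) keeps the Jacobian.

  For connectedness, a function on the trivalent 3-edge-connected graphs that is invariant under
  isomorphism and takes equal values on graphs sharing a facet is shown to be constant on the trivalent
  expansions of each pure 3-edge-connected graph \<open>K\<close>, by induction on the codimension of \<open>K\<close>: any two
  splittings of \<open>K\<close> are linked by splittings that pairwise have a common 3-edge-connected refinement.
  All trivalent graphs contract to the rose with \<open>g\<close> petals, so taking the rose for \<open>K\<close> finishes the proof.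
\<close>

section \<open>Cuts and vertex splittings\<close>

text \<open>Splitting a vertex may create small cuts, so the usual moves between trivalent graphs
  can leave the class, and the splittings lost must be controlled. A set of half-edges at a vertex
  is closed if splitting it off creates a bridge, and bad if it creates a cut of at most two edges.
  Closed sets form a ring of sets without singletons, and uncrossing shows that two bad pairs with a
  common half-edge have a closed union. So few pairs are bad that the good ones remain linked. Since
  \<open>E = V + g - 1\<close> for a pure graph, the valences exceed 3 by \<open>3g - 3 - E\<close>,
  the codimension, in total. In codimension one there is just one vertex of valence 4, whose
  splittings have no common refinement; that they agree is the facet hypothesis itself. From
  codimension two on there is a vertex of valence at least 5 or a second vertex of valence 4, and
  this room supplies the refinements. The invariant replaces explicit paths of graphs. If two open
  sets separate the union of the strata of codimension at most one, then every trivalent cell with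
  its open facets lies in one of them, and lying in the first is such an invariant; its constancy
  refutes the separation.\<close>

definition cut :: "wgraph \<Rightarrow> nat set \<Rightarrow> nat set" where
  "cut G X = {e \<in> edges G. (src G e \<in> X) \<noteq> (tgt G e \<in> X)}"

lemma adj_on_cut:
  assumes "(a, b) \<in> adj_on G A" "A \<subseteq> edges G" "a \<in> X" "b \<notin> X"
  shows "cut G X \<inter> A \<noteq> {}"
  using assms by (auto simp: adj_on_def cut_def)

lemma reach_cut:
  assumes "(a, b) \<in> (adj_on G A)\<^sup>*" "A \<subseteq> edges G" "cut G X \<inter> A = {}" "a \<in> X"
  shows "b \<in> X"
  using assms(1)
proof (induction rule: rtrancl_induct)
  case base show ?case by (fact assms(4))
next
  case (step y z) then show ?case using adj_on_cut assms(2,3) by blast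
qed

text \<open>If \<open>b\<close> is not reachable from \<open>a\<close>, then no edge of
  \<open>A\<close> leaves the set of vertices reachable from \<open>a\<close>.\<close>

lemma conn_with_iff:
  assumes wf: "wf_graph G" and A: "A \<subseteq> edges G"
  shows "conn_with G A \<longleftrightarrow> verts G \<noteq> {} \<and>
    (\<forall>X\<subseteq>verts G. X \<noteq> {} \<longrightarrow> X \<noteq> verts G \<longrightarrow> cut G X \<inter> A \<noteq> {})"
    (is "?L \<longleftrightarrow> ?R")
proof
  assume L: ?L
  show ?R
  proof (intro conjI allI impI)
    show "verts G \<noteq> {}" using L by (simp add: conn_with_def)
    fix X assume X: "X \<subseteq> verts G" "X \<noteq> {}" "X \<noteq> verts G"
    then obtain a b where "a \<in> X" "b \<in> verts G - X" by blast
    moreover from this have "(a, b) \<in> (adj_on G A)\<^sup>*" using L X by (auto simp: conn_with_def)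
    ultimately show "cut G X \<inter> A \<noteq> {}" using reach_cut[of a b G A X] A by blast
  qed
next
  assume R: ?R
  have "(a, b) \<in> (adj_on G A)\<^sup>*" if ab: "a \<in> verts G" "b \<in> verts G" for a b
  proof (rule ccontr)
    assume n: "(a, b) \<notin> (adj_on G A)\<^sup>*"
    let ?X = "{c \<in> verts G. (a, c) \<in> (adj_on G A)\<^sup>*}"
    have "?X \<subseteq> verts G" "a \<in> ?X" "b \<notin> ?X" using ab n by auto
    then have "?X \<noteq> {}" "?X \<noteq> verts G" using ab by (blast, metis)
    then have "cut G ?X \<inter> A \<noteq> {}"
      using R[THEN conjunct2, rule_format, of ?X] \<open>?X \<subseteq> verts G\<close> by blast
    then obtain e where e: "e \<in> A" "e \<in> edges G" "(src G e \<in> ?X) \<noteq> (tgt G e \<in> ?X)"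
      by (auto simp: cut_def)
    have v: "src G e \<in> verts G" "tgt G e \<in> verts G" using wf e by (auto simp: wf_graph_def)
    have "(src G e, tgt G e) \<in> adj_on G A" "(tgt G e, src G e) \<in> adj_on G A"
      using e by (auto simp: adj_on_def)
    then have "src G e \<in> ?X \<longleftrightarrow> tgt G e \<in> ?X"
      using v rtrancl_into_rtrancl[of a _ "adj_on G A"] by blast
    then show False using e(3) by blast
  qed
  moreover have "verts G \<noteq> {}" using R by blast
  ultimately show ?L unfolding conn_with_def by blast
qed

lemma connected_iff_cut:
  assumes "wf_graph G"
  shows "connected_graph G \<longleftrightarrow> verts G \<noteq> {} \<and>
    (\<forall>X\<subseteq>verts G. X \<noteq> {} \<longrightarrow> X \<noteq> verts G \<longrightarrow> cut G X \<noteq> {})"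
proof -
  have "cut G X \<inter> edges G = cut G X" for X by (auto simp: cut_def)
  then show ?thesis using conn_with_iff[OF assms, of "edges G"] by (simp add: connected_graph_def)
qed

lemma finite_cut: "wf_graph G \<Longrightarrow> finite (cut G X)"
  by (auto simp: cut_def wf_graph_def)

text \<open>A disconnecting set of edges contains a whole cut, and every cut disconnects. Sizes of
  cuts are easier to follow through splittings and contractions than deletions.\<close>

lemma tec_iff_cut:
  assumes wf: "wf_graph G"
  shows "three_edge_connected G \<longleftrightarrow> verts G \<noteq> {} \<and>
    (\<forall>X\<subseteq>verts G. X \<noteq> {} \<longrightarrow> X \<noteq> verts G \<longrightarrow> 3 \<le> card (cut G X))"
    (is "?L \<longleftrightarrow> ?R")
proof
  assume L: ?L
  show ?R
  proof (intro conjI allI impI)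
    show "verts G \<noteq> {}" using L by (simp add: three_edge_connected_def)
    fix X assume X: "X \<subseteq> verts G" "X \<noteq> {}" "X \<noteq> verts G"
    show "3 \<le> card (cut G X)"
    proof (rule ccontr)
      assume "\<not> 3 \<le> card (cut G X)"
      moreover have "cut G X \<subseteq> edges G" by (auto simp: cut_def)
      ultimately have "conn_with G (edges G - cut G X)"
        using L by (simp add: three_edge_connected_def)
      then show False using X conn_with_iff[OF wf, of "edges G - cut G X"] by auto
    qed
  qed
next
  assume R: ?R
  have "conn_with G (edges G - F)" if F: "F \<subseteq> edges G" "card F < 3" for F
  proof -
    have "cut G X \<inter> (edges G - F) \<noteq> {}" if "X \<subseteq> verts G" "X \<noteq> {}" "X \<noteq> verts G" for X
    proof
      assume "cut G X \<inter> (edges G - F) = {}"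
      then have "cut G X \<subseteq> F" by (auto simp: cut_def)
      moreover have "finite F" using F wf by (auto simp: wf_graph_def dest: finite_subset)
      ultimately have "card (cut G X) \<le> card F" by (rule card_mono[rotated])
      moreover have "3 \<le> card (cut G X)" using R that by blast
      ultimately show False using F by linarith
    qed
    moreover have "verts G \<noteq> {}" using R by blast
    ultimately show ?thesis using conn_with_iff[OF wf, of "edges G - F"] by blast
  qed
  moreover have "verts G \<noteq> {}" using R by blast
  ultimately show ?L unfolding three_edge_connected_def by blast
qed

lemma tec_imp_connected: "wf_graph G \<Longrightarrow> three_edge_connected G \<Longrightarrow> connected_graph G"
  by (metis card.empty connected_iff_cut not_numeral_le_zero tec_iff_cut)

text \<open>The half-edge \<open>(e, True)\<close> is the source end of \<open>e\<close>, and \<open>(e, False)\<close> is its target end.\<close>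

definition hend :: "wgraph \<Rightarrow> nat \<times> bool \<Rightarrow> nat" where
  "hend G h = (if snd h then src G (fst h) else tgt G (fst h))"

definition halves :: "wgraph \<Rightarrow> nat \<Rightarrow> (nat \<times> bool) set" where
  "halves G v = {h. fst h \<in> edges G \<and> hend G h = v}"

lemma hend_simps [simp]: "hend G (e, True) = src G e" "hend G (e, False) = tgt G e"
  by (auto simp: hend_def)

lemma finite_halves: "wf_graph G \<Longrightarrow> finite (halves G v)"
  by (rule finite_subset[of _ "edges G \<times> UNIV"]) (auto simp: halves_def wf_graph_def)

lemma card_halves:
  assumes "wf_graph G" shows "card (halves G v) = valence G v"
proof -
  have "halves G v = (\<lambda>e. (e, True)) ` {e \<in> edges G. src G e = v} \<union>
      (\<lambda>e. (e, False)) ` {e \<in> edges G. tgt G e = v}" (is "_ = ?A \<union> ?B")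
    by (force simp: halves_def hend_def image_iff)
  moreover have "card (?A \<union> ?B) = card ?A + card ?B"
    using assms by (intro card_Un_disjoint) (auto simp: wf_graph_def)
  ultimately show ?thesis by (simp add: valence_def card_image inj_on_def)
qed

text \<open>Half-edges are distributed instead of edges, so that a loop at \<open>v\<close> may
  become an edge from \<open>v\<close> to \<open>n\<close>. Weight 0 at \<open>n\<close> keeps pure
  graphs pure.\<close>

definition vsplit :: "wgraph \<Rightarrow> nat \<Rightarrow> (nat \<times> bool) set \<Rightarrow> nat \<Rightarrow> nat \<Rightarrow> wgraph" where
  "vsplit G v P n e = \<lparr>verts = insert n (verts G), edges = insert e (edges G),
     src = (\<lambda>x. if x = e then v else if (x, True) \<in> P then n else src G x),
     tgt = (\<lambda>x. if x = e then n else if (x, False) \<in> P then n else tgt G x),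
     wt = (wt G)(n := 0)\<rparr>"

lemma vsplit_simps [simp]:
  "verts (vsplit G v P n e) = insert n (verts G)"
  "edges (vsplit G v P n e) = insert e (edges G)"
  "src (vsplit G v P n e) x = (if x = e then v else if (x, True) \<in> P then n else src G x)"
  "tgt (vsplit G v P n e) x = (if x = e then n else if (x, False) \<in> P then n else tgt G x)"
  "wt (vsplit G v P n e) = (wt G)(n := 0)"
  by (simp_all add: vsplit_def)

text \<open>Edges and vertices keep their names, so the two orders of splitting give equal records
  and not merely isomorphic graphs; common refinements need no isomorphism.\<close>

lemma vsplit_commute:
  assumes "n \<noteq> m" "e \<noteq> f" "P \<inter> Q = {}" "\<And>s. (f, s) \<notin> P" "\<And>s. (e, s) \<notin> Q"
  shows "vsplit (vsplit G v P n e) w Q m f = vsplit (vsplit G w Q m f) v P n e"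
  using assms by (auto simp: vsplit_def fun_eq_iff)

text \<open>A set \<open>A\<close> of vertices other than \<open>v\<close> and a set \<open>P\<close> of half-edges at \<open>v\<close> form one side of a cut of the
  graph in which \<open>v\<close> is split along \<open>P\<close>; besides the new edge it consists of the edges \<open>crs G A P\<close>. So
  \<open>P\<close> is bad if splitting it off creates a cut of at most two edges.\<close>

definition col :: "wgraph \<Rightarrow> nat set \<Rightarrow> (nat \<times> bool) set \<Rightarrow> nat \<times> bool \<Rightarrow> bool" where
  "col G A P h \<longleftrightarrow> hend G h \<in> A \<or> h \<in> P"

definition crs :: "wgraph \<Rightarrow> nat set \<Rightarrow> (nat \<times> bool) set \<Rightarrow> nat set" where
  "crs G A P = {e \<in> edges G. col G A P (e, True) \<noteq> col G A P (e, False)}"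

definition closedh :: "wgraph \<Rightarrow> nat \<Rightarrow> (nat \<times> bool) set \<Rightarrow> bool" where
  "closedh G v P \<longleftrightarrow> (\<exists>A \<subseteq> verts G - {v}. crs G A P = {})"

definition badh :: "wgraph \<Rightarrow> nat \<Rightarrow> (nat \<times> bool) set \<Rightarrow> bool" where
  "badh G v P \<longleftrightarrow> (\<exists>A \<subseteq> verts G - {v}. card (crs G A P) \<le> 1)"

lemma closed_imp_bad: "closedh G v P \<Longrightarrow> badh G v P"
  unfolding closedh_def badh_def by (metis card.empty zero_le)

lemma finite_crs: "wf_graph G \<Longrightarrow> finite (crs G A P)"
  by (auto simp: crs_def wf_graph_def)

lemma vsplit_wf:
  assumes "wf_graph G" "v \<in> verts G"
  shows "wf_graph (vsplit G v P n e)"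
  using assms by (auto simp: wf_graph_def)

lemma cut_compl:
  assumes "wf_graph G" shows "cut G (verts G - X) = cut G X"
  using assms by (auto simp: cut_def wf_graph_def)

lemma cut_vsplit_same:
  assumes wf: "wf_graph G" and v: "v \<in> verts G" and P: "P \<subseteq> halves G v"
    and n: "n \<notin> verts G" and e: "e \<notin> edges G" and X: "v \<in> X \<longleftrightarrow> n \<in> X"
  shows "cut (vsplit G v P n e) X = cut G (X - {n})"
proof -
  have 1: "src G x \<noteq> n" "tgt G x \<noteq> n" if "x \<in> edges G" for x
    using wf n that by (auto simp: wf_graph_def)
  have 2: "src G x = v" if "(x, True) \<in> P" for x using P that by (auto simp: halves_def)
  have 3: "tgt G x = v" if "(x, False) \<in> P" for x using P that by (auto simp: halves_def)
  have "x \<in> cut (vsplit G v P n e) X \<longleftrightarrow> x \<in> cut G (X - {n})" for x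
  proof (cases "x \<in> edges G")
    case True
    then have "x \<noteq> e" using e by auto
    then show ?thesis using True 1[OF True] 2[of x] 3[of x] X
      by (cases "(x, True) \<in> P"; cases "(x, False) \<in> P") (simp_all add: cut_def)
  next
    case False
    then show ?thesis using X by (simp add: cut_def)
  qed
  then show ?thesis by blast
qed

lemma cut_vsplit_diff:
  assumes wf: "wf_graph G" and v: "v \<in> verts G" and P: "P \<subseteq> halves G v"
    and n: "n \<notin> verts G" and e: "e \<notin> edges G" and X: "v \<notin> X" "n \<in> X"
  shows "cut (vsplit G v P n e) X = insert e (crs G (X - {n}) P)"
proof -
  have 1: "src G x \<noteq> n" "tgt G x \<noteq> n" if "x \<in> edges G" for x
    using wf n that by (auto simp: wf_graph_def)
  have "x \<in> cut (vsplit G v P n e) X \<longleftrightarrow> x \<in> insert e (crs G (X - {n}) P)" for x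
  proof (cases "x \<in> edges G")
    case True
    then have "x \<noteq> e" using e by auto
    then show ?thesis using True 1[OF True] X by (simp add: cut_def crs_def col_def)
  next
    case False
    then show ?thesis using X by (simp add: cut_def crs_def)
  qed
  then show ?thesis by blast
qed

text \<open>A cut that keeps \<open>v\<close> and \<open>n\<close> together is a cut of
  \<open>G\<close>. A cut that separates them consists of the new edge and the edges in
  \<open>crs\<close>, hence the bound 1 instead of 2 in \<open>badh\<close>.\<close>

lemma tec_vsplit:
  assumes wf: "wf_graph G" and t: "three_edge_connected G"
    and v: "v \<in> verts G" and P: "P \<subseteq> halves G v"
    and n: "n \<notin> verts G" and e: "e \<notin> edges G"
  shows "three_edge_connected (vsplit G v P n e) \<longleftrightarrow> \<not> badh G v P"
proof -
  let ?H = "vsplit G v P n e"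
  have wfH: "wf_graph ?H" using wf v by (rule vsplit_wf)
  have cd: "card (cut ?H X) = Suc (card (crs G (X - {n}) P))" if "v \<notin> X" "n \<in> X" for X
  proof -
    have "e \<notin> crs G (X - {n}) P" using e by (auto simp: crs_def)
    then show ?thesis using cut_vsplit_diff[OF wf v P n e that] finite_crs[OF wf] by simp
  qed
  have vn: "v \<noteq> n" using v n by auto
  show ?thesis
  proof
    assume "three_edge_connected ?H"
    then have T: "3 \<le> card (cut ?H X)" if "X \<subseteq> insert n (verts G)" "X \<noteq> {}" "X \<noteq> insert n (verts G)" for X
      using tec_iff_cut[OF wfH] that by simp
    show "\<not> badh G v P"
    proof
      assume "badh G v P"
      then obtain A where A: "A \<subseteq> verts G - {v}" "card (crs G A P) \<le> 1" by (auto simp: badh_def)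
      have "3 \<le> card (cut ?H (insert n A))" using A v vn by (intro T) auto
      moreover have "insert n A - {n} = A" using A n by auto
      ultimately show False using cd[of "insert n A"] A vn by auto
    qed
  next
    assume nb: "\<not> badh G v P"
    have d: "3 \<le> card (cut ?H X)" if "X \<subseteq> insert n (verts G)" "v \<notin> X" "n \<in> X" for X
    proof -
      have "X - {n} \<subseteq> verts G - {v}" using that by auto
      then have "\<not> card (crs G (X - {n}) P) \<le> 1" using nb unfolding badh_def by blast
      then show ?thesis using cd[OF that(2,3)] by simp
    qed
    have "3 \<le> card (cut ?H X)" if X: "X \<subseteq> verts ?H" "X \<noteq> {}" "X \<noteq> verts ?H" for X
    proof (cases "v \<in> X \<longleftrightarrow> n \<in> X")
      case True
      have "X - {n} \<subseteq> verts G" "X - {n} \<noteq> {}" "X - {n} \<noteq> verts G" using X True vn v n by auto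
      then have "3 \<le> card (cut G (X - {n}))" using t tec_iff_cut[OF wf] by auto
      then show ?thesis using cut_vsplit_same[OF wf v P n e True] by simp
    next
      case False
      show ?thesis
      proof (cases "v \<in> X")
        case True
        \<comment> \<open>A cut equals that of the complementary side, so the side may be taken to
          contain \<open>n\<close> and not \<open>v\<close>.\<close>
        have "3 \<le> card (cut ?H (verts ?H - X))" using True False v by (intro d) auto
        then show ?thesis by (simp only: cut_compl[OF wfH])
      next
        case f: False
        then show ?thesis using d[of X] X False by auto
      qed
    qed
    then show "three_edge_connected ?H" using tec_iff_cut[OF wfH] by auto
  qed
qed

lemma card_le1D: "finite S \<Longrightarrow> card S \<le> 1 \<Longrightarrow> x \<in> S \<Longrightarrow> y \<in> S \<Longrightarrow> x = y"
  by (metis card_le_Suc0_iff_eq One_nat_def)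

text \<open>Two 2-colourings of the half-edges, each with at most one bichromatic edge, divide the graph into
  four corners. If three of the corners meet a bichromatic edge, then the fourth one does not.\<close>

lemma corner_edges:
  fixes a b :: "'e \<Rightarrow> bool \<Rightarrow> bool"
  assumes uA: "\<And>e e'. e \<in> E \<Longrightarrow> e' \<in> E \<Longrightarrow> a e True \<noteq> a e False \<Longrightarrow> a e' True \<noteq> a e' False \<Longrightarrow> e = e'"
    and uB: "\<And>e e'. e \<in> E \<Longrightarrow> e' \<in> E \<Longrightarrow> b e True \<noteq> b e False \<Longrightarrow> b e' True \<noteq> b e' False \<Longrightarrow> e = e'"
    and e1: "e1 \<in> E" "(a e1 True \<and> b e1 True) \<noteq> (a e1 False \<and> b e1 False)"
    and e2: "e2 \<in> E" "(a e2 True \<and> \<not> b e2 True) \<noteq> (a e2 False \<and> \<not> b e2 False)"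
    and e3: "e3 \<in> E" "(b e3 True \<and> \<not> a e3 True) \<noteq> (b e3 False \<and> \<not> a e3 False)"
    and e4: "e4 \<in> E"
  shows "(a e4 True \<or> b e4 True) = (a e4 False \<or> b e4 False)"
proof (rule ccontr)
  assume e4': "\<not> ?thesis"
  have x: "a e1 True \<noteq> a e1 False \<or> b e1 True \<noteq> b e1 False"
    "a e2 True \<noteq> a e2 False \<or> b e2 True \<noteq> b e2 False"
    "a e3 True \<noteq> a e3 False \<or> b e3 True \<noteq> b e3 False"
    "a e4 True \<noteq> a e4 False \<or> b e4 True \<noteq> b e4 False"
    using e1(2) e2(2) e3(2) e4' by blast+
  \<comment> \<open>An edge bichromatic for both colourings would be the only bichromatic edge at
    all. It joins two opposite corners and cannot account for three.\<close>
  have nab: False if e: "e \<in> E" "a e True \<noteq> a e False" "b e True \<noteq> b e False" for e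
  proof -
    have "e1 = e" using x(1) uA[OF e1(1) e(1)] uB[OF e1(1) e(1)] e(2,3) by argo
    moreover have "e2 = e" using x(2) uA[OF e2(1) e(1)] uB[OF e2(1) e(1)] e(2,3) by argo
    moreover have "e3 = e" using x(3) uA[OF e3(1) e(1)] uB[OF e3(1) e(1)] e(2,3) by argo
    ultimately have "(a e True \<and> b e True) \<noteq> (a e False \<and> b e False)"
      "(a e True \<and> \<not> b e True) \<noteq> (a e False \<and> \<not> b e False)"
      "(b e True \<and> \<not> a e True) \<noteq> (b e False \<and> \<not> a e False)"
      using e1(2) e2(2) e3(2) by blast+
    then show False by blast
  qed
  note n1 = nab[OF e1(1)] and n2 = nab[OF e2(1)] and n3 = nab[OF e3(1)] and n4 = nab[OF e4]
  \<comment> \<open>Edges that are bichromatic for the same colouring coincide, so there is at most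
    one edge of each kind. Each joins two neighbouring corners, and two edges of different kinds
    always share a corner; together they meet only three corners.\<close>
  have c12: "(a e1 True \<noteq> a e1 False) \<noteq> (a e2 True \<noteq> a e2 False) \<or> e1 = e2"
    using x(1,2) uA[OF e1(1) e2(1)] uB[OF e1(1) e2(1)] by argo
  have c13: "(a e1 True \<noteq> a e1 False) \<noteq> (a e3 True \<noteq> a e3 False) \<or> e1 = e3"
    using x(1,3) uA[OF e1(1) e3(1)] uB[OF e1(1) e3(1)] by argo
  have c23: "(a e2 True \<noteq> a e2 False) \<noteq> (a e3 True \<noteq> a e3 False) \<or> e2 = e3"
    using x(2,3) uA[OF e2(1) e3(1)] uB[OF e2(1) e3(1)] by argo
  have c14: "(a e1 True \<noteq> a e1 False) \<noteq> (a e4 True \<noteq> a e4 False) \<or> e1 = e4"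
    using x(1,4) uA[OF e1(1) e4] uB[OF e1(1) e4] by argo
  have c24: "(a e2 True \<noteq> a e2 False) \<noteq> (a e4 True \<noteq> a e4 False) \<or> e2 = e4"
    using x(2,4) uA[OF e2(1) e4] uB[OF e2(1) e4] by argo
  have c34: "(a e3 True \<noteq> a e3 False) \<noteq> (a e4 True \<noteq> a e4 False) \<or> e3 = e4"
    using x(3,4) uA[OF e3(1) e4] uB[OF e3(1) e4] by argo
  have d12: "e1 \<noteq> e2 \<or> e1 \<noteq> e3" using n1 e1(2) e2(2) e3(2) by auto
  have "e1 = e2 \<or> e1 = e3 \<or> e2 = e3" using c12 c13 c23 by argo
  moreover have "e1 = e4 \<or> e2 = e4 \<or> e3 = e4" using d12 c12 c13 c14 c24 c34 by satx
  ultimately consider "e1 = e2" "e4 = e1 \<or> e4 = e3" | "e1 = e3" "e4 = e1 \<or> e4 = e2" | "e2 = e3" "e4 = e1 \<or> e4 = e2"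
    by metis
  then show False
  proof cases
    case 1 then show False using n1 n2 n3 e1(2) e2(2) e3(2) e4' c13 d12 by auto
  next
    case 2 then show False using n1 n2 n3 e1(2) e2(2) e3(2) e4' c12 d12 by auto
  next
    case 3 then show False using n1 n2 n3 e1(2) e2(2) e3(2) e4' c12 d12 by auto
  qed
qed

section \<open>Closed and bad sets of half-edges at one vertex\<close>

locale tec_vertex =
  fixes G :: wgraph and v :: nat
  assumes wf: "wf_graph G" and tec: "three_edge_connected G" and v: "v \<in> verts G"
begin

abbreviation "L \<equiv> halves G v"

text \<open>The sides \<open>A\<close> and \<open>B\<close> avoid \<open>v\<close>, while
  \<open>P\<close> and \<open>Q\<close> sit at \<open>v\<close>. So the two ways of being coloured
  never mix, and colours follow Boolean operations on the sides.\<close>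

lemma col_bool:
  assumes "A \<subseteq> verts G - {v}" "B \<subseteq> verts G - {v}" "P \<subseteq> L" "Q \<subseteq> L"
  shows "col G (A \<inter> B) (P \<inter> Q) h \<longleftrightarrow> col G A P h \<and> col G B Q h"
    "col G (A \<union> B) (P \<union> Q) h \<longleftrightarrow> col G A P h \<or> col G B Q h"
    "col G (A - B) (P - Q) h \<longleftrightarrow> col G A P h \<and> \<not> col G B Q h"
  using assms by (auto simp: col_def halves_def)

lemma closed_inter:
  assumes "closedh G v P" "closedh G v Q" "P \<subseteq> L" "Q \<subseteq> L"
  shows "closedh G v (P \<inter> Q)"
proof -
  obtain A B where A: "A \<subseteq> verts G - {v}" "crs G A P = {}" and B: "B \<subseteq> verts G - {v}" "crs G B Q = {}"
    using assms by (auto simp: closedh_def)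
  have "crs G (A \<inter> B) (P \<inter> Q) = {}"
    using A B by (auto simp: crs_def col_bool(1)[OF A(1) B(1) assms(3,4)])
  then show ?thesis unfolding closedh_def using A(1) by (intro exI[of _ "A \<inter> B"]) auto
qed

lemma closed_diff:
  assumes "closedh G v P" "closedh G v Q" "P \<subseteq> L" "Q \<subseteq> L"
  shows "closedh G v (P - Q)"
proof -
  obtain A B where A: "A \<subseteq> verts G - {v}" "crs G A P = {}" and B: "B \<subseteq> verts G - {v}" "crs G B Q = {}"
    using assms by (auto simp: closedh_def)
  have "crs G (A - B) (P - Q) = {}"
    using A B by (auto simp: crs_def col_bool(3)[OF A(1) B(1) assms(3,4)])
  then show ?thesis unfolding closedh_def using A(1) by (intro exI[of _ "A - B"]) auto
qed

lemma col_all: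
  assumes "fst h \<in> edges G" shows "col G (verts G - {v}) L h"
proof -
  have "hend G h \<in> verts G" using wf assms by (auto simp: hend_def wf_graph_def)
  then show ?thesis using assms by (auto simp: col_def halves_def)
qed

lemma closed_all: "closedh G v L"
  unfolding closedh_def by (rule exI[of _ "verts G - {v}"]) (auto simp: crs_def col_all)

text \<open>Complementing the side inverts all colours and leaves the crossing edges
  unchanged.\<close>

lemma bad_compl:
  assumes "badh G v P" "P \<subseteq> L" shows "badh G v (L - P)"
proof -
  obtain A where A: "A \<subseteq> verts G - {v}" "card (crs G A P) \<le> 1"
    using assms by (auto simp: badh_def)
  have "crs G (verts G - {v} - A) (L - P) = crs G A P"
    using col_all by (auto simp: crs_def col_bool(3)[OF order_refl A(1) order_refl assms(2)])
  then show ?thesis unfolding badh_def using A by (intro exI[of _ "verts G - {v} - A"]) auto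
qed

text \<open>For \<open>A = {}\<close> the edge of \<open>h\<close> itself crosses. Otherwise at
  least three edges leave \<open>A\<close>, and recolouring the single half-edge \<open>h\<close>
  can repair only one of them. This is where 3-edge-connectedness enters.\<close>

lemma crs_single:
  assumes h: "h \<in> L" and A: "A \<subseteq> verts G - {v}"
  shows "crs G A {h} \<noteq> {}"
proof (cases "A = {}")
  case True
  have "fst h \<in> crs G {} {h}" using h by (cases h, cases "snd h") (auto simp: crs_def col_def halves_def)
  then show ?thesis using True by blast
next
  case False
  have "3 \<le> card (cut G A)" using tec tec_iff_cut[OF wf] False A v by auto
  moreover have "cut G A \<subseteq> {fst h}" if "crs G A {h} = {}"
  proof
    fix x assume x: "x \<in> cut G A"
    then have "(x, True) \<in> {h} \<or> (x, False) \<in> {h}" using that by (auto simp: cut_def crs_def col_def)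
    then show "x \<in> {fst h}" by auto
  qed
  then have "card (cut G A) \<le> 1" if "crs G A {h} = {}" using that card_mono[of "{fst h}" "cut G A"] by auto
  ultimately show ?thesis by linarith
qed

lemma not_closed_single: "h \<in> L \<Longrightarrow> \<not> closedh G v {h}"
  using crs_single by (auto simp: closedh_def)

text \<open>Uncrossing: at \<open>v\<close>, three of the four corners cut out by the two bad sides
  contain just \<open>h\<close>, \<open>x\<close> and \<open>y\<close>. By \<open>crs_single\<close>
  a crossing edge meets each of them, so by \<open>corner_edges\<close> none is left for the fourth
  corner, the complement of the side that carries \<open>{h, x, y}\<close>.\<close>

lemma bad_bad_closed:
  assumes "h \<in> L" "x \<in> L" "y \<in> L" and d: "h \<noteq> x" "h \<noteq> y" "x \<noteq> y"
    and "badh G v {h, x}" "badh G v {h, y}"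
  shows "closedh G v {h, x, y}"
proof -
  obtain A B where A: "A \<subseteq> verts G - {v}" "card (crs G A {h, x}) \<le> 1"
    and B: "B \<subseteq> verts G - {v}" "card (crs G B {h, y}) \<le> 1"
    using assms by (auto simp: badh_def)
  have PQ: "{h, x} \<subseteq> L" "{h, y} \<subseteq> L" using assms by auto
  have s: "{h} = {h,x} \<inter> {h,y}" "{x} = {h,x} - {h,y}" "{y} = {h,y} - {h,x}" "{h,x,y} = {h,x} \<union> {h,y}"
    using d by auto
  note cb = col_bool[OF A(1) B(1) PQ, folded s(1,2,4)] and cb' = col_bool(3)[OF B(1) A(1) PQ(2,1), folded s(3)]
  have "crs G (A \<inter> B) {h} \<noteq> {}" "crs G (A - B) {x} \<noteq> {}" "crs G (B - A) {y} \<noteq> {}"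
    by (rule crs_single; use A(1) B(1) assms(1-3) in blast)+
  then have ex: "\<exists>e\<in>edges G. col G (A \<inter> B) {h} (e, True) \<noteq> col G (A \<inter> B) {h} (e, False)"
    "\<exists>e\<in>edges G. col G (A - B) {x} (e, True) \<noteq> col G (A - B) {x} (e, False)"
    "\<exists>e\<in>edges G. col G (B - A) {y} (e, True) \<noteq> col G (B - A) {y} (e, False)"
    unfolding crs_def by blast+
  obtain e1 where e1: "e1 \<in> edges G"
    "(col G A {h,x} (e1, True) \<and> col G B {h,y} (e1, True)) \<noteq> (col G A {h,x} (e1, False) \<and> col G B {h,y} (e1, False))"
    using ex(1)[unfolded cb cb'] by (elim bexE)
  obtain e2 where e2: "e2 \<in> edges G"
    "(col G A {h,x} (e2, True) \<and> \<not> col G B {h,y} (e2, True)) \<noteq> (col G A {h,x} (e2, False) \<and> \<not> col G B {h,y} (e2, False))"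
    using ex(2)[unfolded cb cb'] by (elim bexE)
  obtain e3 where e3: "e3 \<in> edges G"
    "(col G B {h,y} (e3, True) \<and> \<not> col G A {h,x} (e3, True)) \<noteq> (col G B {h,y} (e3, False) \<and> \<not> col G A {h,x} (e3, False))"
    using ex(3)[unfolded cb cb'] by (elim bexE)
  have uA: "e = e'" if "e \<in> edges G" "e' \<in> edges G" "col G A {h,x} (e, True) \<noteq> col G A {h,x} (e, False)"
     "col G A {h,x} (e', True) \<noteq> col G A {h,x} (e', False)" for e e'
    using card_le1D[OF finite_crs[OF wf] A(2), of e e'] that by (simp add: crs_def)
  have uB: "e = e'" if "e \<in> edges G" "e' \<in> edges G" "col G B {h,y} (e, True) \<noteq> col G B {h,y} (e, False)"
     "col G B {h,y} (e', True) \<noteq> col G B {h,y} (e', False)" for e e'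
    using card_le1D[OF finite_crs[OF wf] B(2), of e e'] that by (simp add: crs_def)
  have "crs G (A \<union> B) {h,x,y} = {}"
  proof (rule ccontr)
    assume "crs G (A \<union> B) {h,x,y} \<noteq> {}"
    then obtain e4 where e4: "e4 \<in> edges G"
      "(col G A {h,x} (e4, True) \<or> col G B {h,y} (e4, True)) \<noteq> (col G A {h,x} (e4, False) \<or> col G B {h,y} (e4, False))"
      unfolding crs_def cb by blast
    then show False
      using corner_edges[of "edges G" "\<lambda>e s. col G A {h,x} (e, s)" "\<lambda>e s. col G B {h,y} (e, s)",
          OF uA uB e1 e2 e3 e4(1)] e4(2) by blast
  qed
  then show ?thesis unfolding closedh_def using A(1) B(1) by (intro exI[of _ "A \<union> B"]) auto
qed

text \<open>The parts \<open>{x}\<close> and \<open>{y}\<close> into which \<open>C\<close> cuts the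
  pair each need a crossing edge. No edge crosses \<open>C\<close>, so these two edges differ, but a
  bad pair admits only one.\<close>

lemma closed_bad_cross:
  assumes C: "closedh G v C" "C \<subseteq> L" and b: "badh G v {x, y}" and xy: "x \<in> L" "y \<in> L" "x \<in> C" "y \<notin> C"
  shows False
proof -
  obtain A B where A: "A \<subseteq> verts G - {v}" "crs G A C = {}"
    and B: "B \<subseteq> verts G - {v}" "card (crs G B {x, y}) \<le> 1"
    using assms by (auto simp: badh_def closedh_def)
  have PQ: "{x, y} \<subseteq> L" using xy by auto
  have s: "{x} = {x,y} \<inter> C" "{y} = {x,y} - C" using xy by auto
  note cb = col_bool[OF B(1) A(1) PQ C(2), folded s]
  have "crs G (B \<inter> A) {x} \<noteq> {}" "crs G (B - A) {y} \<noteq> {}"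
    by (rule crs_single; use A(1) B(1) xy in blast)+
  then have ex: "\<exists>e\<in>edges G. col G (B \<inter> A) {x} (e, True) \<noteq> col G (B \<inter> A) {x} (e, False)"
    "\<exists>e\<in>edges G. col G (B - A) {y} (e, True) \<noteq> col G (B - A) {y} (e, False)"
    unfolding crs_def by blast+
  obtain e1 where e1: "e1 \<in> edges G"
    "(col G B {x,y} (e1, True) \<and> col G A C (e1, True)) \<noteq> (col G B {x,y} (e1, False) \<and> col G A C (e1, False))"
    using ex(1)[unfolded cb] by (elim bexE)
  obtain e2 where e2: "e2 \<in> edges G"
    "(col G B {x,y} (e2, True) \<and> \<not> col G A C (e2, True)) \<noteq> (col G B {x,y} (e2, False) \<and> \<not> col G A C (e2, False))"
    using ex(2)[unfolded cb] by (elim bexE)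
  have uA: "col G A C (e, True) = col G A C (e, False)" if "e \<in> edges G" for e using that A(2) by (auto simp: crs_def)
  have uB: "e = e'" if "e \<in> edges G" "e' \<in> edges G" "col G B {x,y} (e, True) \<noteq> col G B {x,y} (e, False)"
     "col G B {x,y} (e', True) \<noteq> col G B {x,y} (e', False)" for e e'
    using card_le1D[OF finite_crs[OF wf] B(2), of e e'] that by (simp add: crs_def)
  show False using e1 e2 uA[OF e1(1)] uA[OF e2(1)] uB[OF e1(1) e2(1)] by auto
qed

text \<open>Removing one half-edge from a closed set recolours an end of only one edge.\<close>

lemma closed_triple_bad:
  assumes "closedh G v {a, b, c}"
  shows "badh G v {a, b}"
proof -
  obtain A where A: "A \<subseteq> verts G - {v}" "crs G A {a,b,c} = {}"
    using assms by (auto simp: closedh_def)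
  have "crs G A {a,b} \<subseteq> {fst c}"
  proof
    fix e assume "e \<in> crs G A {a,b}"
    moreover have "e \<notin> crs G A {a,b,c}" using A by simp
    ultimately have "(e, True) = c \<or> (e, False) = c" by (auto simp: crs_def col_def)
    then show "e \<in> {fst c}" by auto
  qed
  then have "card (crs G A {a,b}) \<le> 1" using card_mono[of "{fst c}"] by fastforce
  then show ?thesis unfolding badh_def using A(1) by (intro exI[of _ A]) auto
qed

text \<open>Otherwise two bad partners \<open>y\<close>, \<open>z\<close> of \<open>x\<close> give a
  closed triple, and either a second triple \<open>{x, y, w}\<close> or the complement of the first
  leaves a closed singleton. The excluded \<open>u\<close> later serves to avoid the half-edge of a
  newly created edge.\<close>

lemma exists_good_partner:
  assumes d: "4 \<le> card L" and x: "x \<in> L" and u: "u \<in> L" "x \<noteq> u"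
  shows "\<exists>y\<in>L. y \<noteq> x \<and> y \<noteq> u \<and> \<not> badh G v {x, y}"
proof (rule ccontr)
  assume "\<not> ?thesis"
  then have b: "badh G v {x, y}" if "y \<in> L" "y \<noteq> x" "y \<noteq> u" for y using that by blast
  have fin: "finite L" by (rule finite_halves[OF wf])
  have "card (L - {x,u}) \<ge> 2" using d x u fin by (simp add: card_Diff_subset)
  then obtain T where "T \<subseteq> L - {x, u}" "card T = 2" by (meson obtain_subset_with_card_n)
  then obtain y z where yz: "y \<in> L" "z \<in> L" "y \<noteq> z" "y \<noteq> x" "y \<noteq> u" "z \<noteq> x" "z \<noteq> u"
    by (auto simp: card_2_iff)
  have c1: "closedh G v {x, y, z}" using b yz x by (intro bad_bad_closed) auto
  show False
  proof (cases "\<exists>w\<in>L. w \<notin> {x,u,y,z}")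
    case True
    then obtain w where w: "w \<in> L" "w \<notin> {x,u,y,z}" by blast
    have c2: "closedh G v {x, y, w}" using b yz x w by (intro bad_bad_closed) auto
    have "closedh G v ({x,y,z} - {x,y,w})" using c1 c2 x yz w by (intro closed_diff) auto
    moreover have "{x,y,z} - {x,y,w} = {z}" using yz w by auto
    ultimately show False using not_closed_single yz by simp
  next
    case False
    have "closedh G v (L - {x,y,z})" using c1 x yz by (intro closed_diff closed_all) auto
    moreover have "L - {x,y,z} = {u}" using yz False u by auto
    ultimately show False using not_closed_single u by simp
  qed
qed

text \<open>For the side \<open>A = {}\<close> only edges with a half in \<open>P\<close> can
  cross.\<close>

lemma good_card:
  assumes P: "P \<subseteq> L" "\<not> badh G v P" shows "2 \<le> card P" "2 \<le> card (L - P)"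
proof -
  have *: "2 \<le> card P" if P: "P \<subseteq> L" "\<not> badh G v P" for P
  proof -
    have "\<not> card (crs G {} P) \<le> 1" using P(2) unfolding badh_def by blast
    moreover have "crs G {} P \<subseteq> fst ` P" by (force simp: crs_def col_def)
    moreover have "finite P" using P finite_halves[OF wf] finite_subset by blast
    ultimately show ?thesis
      by (metis One_nat_def Suc_1 card_image_le card_mono finite_imageI le_trans not_less_eq_eq)
  qed
  show "2 \<le> card P" using * P by blast
  have "\<not> badh G v (L - P)" using bad_compl[of "L - P"] P by (auto simp: double_diff)
  then show "2 \<le> card (L - P)" using * by blast
qed

end

lemma halves_vsplit_other:
  assumes wf: "wf_graph G" and v: "v \<in> verts G" and P: "P \<subseteq> halves G v" and w: "w \<in> verts G" "w \<noteq> v"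
    and n: "n \<notin> verts G" and e: "e \<notin> edges G"
  shows "halves (vsplit G v P n e) w = halves G w"
proof (intro set_eqI)
  fix h
  have "w \<noteq> n" using w n by auto
  moreover have "hend G h = v" if "h \<in> P" using P that by (auto simp: halves_def)
  ultimately show "h \<in> halves (vsplit G v P n e) w \<longleftrightarrow> h \<in> halves G w"
    using w e by (cases h, cases "snd h") (auto simp: halves_def)
qed

lemma halves_vsplit_same:
  assumes wf: "wf_graph G" and v: "v \<in> verts G" and P: "P \<subseteq> halves G v"
    and n: "n \<notin> verts G" and e: "e \<notin> edges G"
  shows "halves (vsplit G v P n e) v = insert (e, True) (halves G v - P)"
proof -
  have vn: "v \<noteq> n" using v n by auto
  show ?thesis
  proof (intro set_eqI)
    fix h show "h \<in> halves (vsplit G v P n e) v \<longleftrightarrow> h \<in> insert (e, True) (halves G v - P)"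
      using vn P e n by (cases h, cases "snd h") (auto simp: halves_def)
  qed
qed

text \<open>Cutting both new edges of the doubly split graph separates the middle part of the vertex;
  this cut has a third edge exactly when \<open>P \<union> Q\<close> is not closed.\<close>

lemma good_vsplit_disjoint:
  assumes wf: "wf_graph G" and v: "v \<in> verts G" and P: "P \<subseteq> halves G v" and Q: "Q \<subseteq> halves G v"
    and n: "n \<notin> verts G" and e: "e \<notin> edges G"
    and PQ: "P \<inter> Q = {}" and bQ: "\<not> badh G v Q" and nc: "\<not> closedh G v (P \<union> Q)"
  shows "\<not> badh (vsplit G v P n e) v Q"
proof
  let ?H = "vsplit G v P n e"
  assume "badh ?H v Q"
  then obtain A where A: "A \<subseteq> insert n (verts G) - {v}" "card (crs ?H A Q) \<le> 1"
    by (auto simp: badh_def)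
  have vn: "v \<noteq> n" using v n by auto
  have 1: "src G x \<noteq> n" "tgt G x \<noteq> n" if "x \<in> edges G" for x
    using wf n that by (auto simp: wf_graph_def)
  have 2: "src G x = v" if "(x, True) \<in> P" for x using P that by (auto simp: halves_def)
  have 3: "tgt G x = v" if "(x, False) \<in> P" for x using P that by (auto simp: halves_def)
  have eQ: "(e, s) \<notin> Q" for s using Q e by (auto simp: halves_def)
  show False
  proof (cases "n \<in> A")
    case True
    \<comment> \<open>With \<open>n\<close> on the same side as \<open>Q\<close>, the first new edge
      crosses, and all other crossing edges are those of \<open>P \<union> Q\<close> in
      \<open>G\<close>.\<close>
    have "x \<in> crs ?H A Q \<longleftrightarrow> x \<in> insert e (crs G (A - {n}) (P \<union> Q))" for x
    proof (cases "x = e")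
      case x: True
      then show ?thesis using True A eQ by (simp add: crs_def col_def) blast
    next
      case x: False
      then show ?thesis using True 1[of x] by (auto simp: crs_def col_def)
    qed
    then have "crs ?H A Q = insert e (crs G (A - {n}) (P \<union> Q))" by blast
    moreover have "e \<notin> crs G (A - {n}) (P \<union> Q)" using e by (auto simp: crs_def)
    moreover have "A - {n} \<subseteq> verts G - {v}" using A(1) by auto
    then have "crs G (A - {n}) (P \<union> Q) \<noteq> {}" using nc unfolding closedh_def by blast
    ultimately show False using A(2) finite_crs[OF wf, of "A - {n}" "P \<union> Q"] by simp
  next
    case False
    have "v \<notin> A" using A by auto
    \<comment> \<open>With \<open>n\<close> on the side of \<open>v\<close>, the first splitting is
      invisible and the side already existed in \<open>G\<close>.\<close>
    have "x \<in> crs ?H A Q \<longleftrightarrow> x \<in> crs G A Q" for x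
    proof (cases "x = e")
      case x: True
      then show ?thesis using False \<open>v \<notin> A\<close> eQ e by (simp add: crs_def col_def)
    next
      case x: False
      have "(x, s) \<in> P \<Longrightarrow> (x, s) \<notin> Q" for s using PQ by blast
      then show ?thesis using False x 2[of x] 3[of x] \<open>v \<notin> A\<close> by (simp add: crs_def col_def)
    qed
    then have "crs ?H A Q = crs G A Q" by blast
    moreover have "A \<subseteq> verts G - {v}" using A(1) False by auto
    ultimately show False using A(2) bQ unfolding badh_def by metis
  qed
qed

section \<open>Pure 3-edge-connected graphs\<close>

text \<open>The Euler relation is written additively to stay clear of truncated subtraction. For
  \<open>g \<ge> 2\<close> these graphs are automatically stable.\<close>

definition PT :: "nat \<Rightarrow> wgraph set" where
  "PT g = {G. wf_graph G \<and> three_edge_connected G \<and> pure_graph G \<and>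
     card (edges G) + 1 = card (verts G) + g}"

lemma PTD:
  assumes "G \<in> PT g"
  shows "wf_graph G" "three_edge_connected G" "pure_graph G"
    "card (edges G) + 1 = card (verts G) + g" "finite (verts G)" "finite (edges G)"
  using assms by (auto simp: PT_def wf_graph_def)

lemma handshake:
  assumes wf: "wf_graph G"
  shows "(\<Sum>v\<in>verts G. card (halves G v)) = 2 * card (edges G)"
proof -
  have "(\<Sum>v\<in>verts G. card (halves G v)) = card (\<Union>v\<in>verts G. halves G v)"
    using wf finite_halves[OF wf] by (subst card_UN_disjoint) (auto simp: wf_graph_def halves_def)
  also have "(\<Union>v\<in>verts G. halves G v) = edges G \<times> UNIV"
  proof -
    have "hend G h \<in> verts G" if "fst h \<in> edges G" for h
      using wf that by (auto simp: wf_graph_def hend_def)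
    then show ?thesis by (auto simp: halves_def)
  qed
  also have "card \<dots> = 2 * card (edges G)" by (simp add: card_cartesian_product)
  finally show ?thesis .
qed

text \<open>The edges of the cut around \<open>v\<close> have distinct halves at
  \<open>v\<close>.\<close>

lemma tec_valence:
  assumes wf: "wf_graph G" and t: "three_edge_connected G" and v: "v \<in> verts G" "verts G \<noteq> {v}"
  shows "3 \<le> card (halves G v)"
proof -
  have "3 \<le> card (cut G {v})" using t tec_iff_cut[OF wf] v by auto
  also have "cut G {v} \<subseteq> fst ` halves G v"
  proof
    fix e assume "e \<in> cut G {v}"
    then have "(e, True) \<in> halves G v \<or> (e, False) \<in> halves G v" by (auto simp: cut_def halves_def)
    then show "e \<in> fst ` halves G v" by force
  qed
  then have "card (cut G {v}) \<le> card (halves G v)"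
    using finite_halves[OF wf, of v] by (meson card_image_le card_mono finite_imageI le_trans)
  finally show ?thesis .
qed

lemma card_halves_single:
  assumes "wf_graph G" "verts G = {v}"
  shows "card (halves G v) = 2 * card (edges G)"
  using handshake[OF assms(1)] assms(2) by simp

lemma PT_valence:
  assumes G: "G \<in> PT g" and g: "g \<ge> 2" and v: "v \<in> verts G"
  shows "3 \<le> card (halves G v)"
proof (cases "verts G = {v}")
  case True
  then show ?thesis using card_halves_single[OF PTD(1)[OF G] True] PTD(4)[OF G] g by simp
next
  case False
  then show ?thesis using tec_valence[OF PTD(1,2)[OF G] v] by simp
qed

text \<open>Origin of \<open>3 * g - 3\<close>: all valences are at least 3, so
  \<open>3V \<le> 2E\<close>, and \<open>V = E + 1 - g\<close>.\<close>

lemma PT_edges_le: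
  assumes G: "G \<in> PT g" and g: "g \<ge> 2"
  shows "card (edges G) \<le> 3 * g - 3"
proof -
  have "(\<Sum>v\<in>verts G. 3) \<le> (\<Sum>v\<in>verts G. card (halves G v))"
    using PT_valence[OF G g] by (rule sum_mono)
  then show ?thesis using handshake[OF PTD(1)[OF G]] PTD(4)[OF G] by simp
qed

lemma PT_exists_valence4:
  assumes G: "G \<in> PT g" and g: "g \<ge> 2" and c: "card (edges G) < 3 * g - 3"
  obtains v where "v \<in> verts G" "4 \<le> card (halves G v)"
proof -
  have "\<exists>v\<in>verts G. 4 \<le> card (halves G v)"
  proof (rule ccontr)
    assume "\<not> ?thesis"
    then have "card (halves G v) \<le> 3" if "v \<in> verts G" for v using that by force
    then have "(\<Sum>v\<in>verts G. card (halves G v)) \<le> (\<Sum>v\<in>verts G. 3)" by (rule sum_mono)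
    then show False using handshake[OF PTD(1)[OF G]] PTD(4)[OF G] c by simp
  qed
  then show ?thesis using that by blast
qed

text \<open>The valences exceed 3 by \<open>3 * g - 3 - E\<close> in total, here at least 2, and
  \<open>v\<close> carries at most 1 of this excess.\<close>

lemma PT_codim_two:
  assumes G: "G \<in> PT g" and g: "g \<ge> 2" and c: "card (edges G) + 1 < 3 * g - 3"
    and v: "v \<in> verts G" "card (halves G v) \<le> 4"
  obtains w where "w \<in> verts G" "w \<noteq> v" "4 \<le> card (halves G w)"
proof -
  have "\<exists>w\<in>verts G. w \<noteq> v \<and> 4 \<le> card (halves G w)"
  proof (rule ccontr)
    assume "\<not> ?thesis"
    then have "card (halves G w) \<le> 3" if "w \<in> verts G - {v}" for w using that by force
    then have "(\<Sum>w\<in>verts G - {v}. card (halves G w)) \<le> (\<Sum>w\<in>verts G - {v}. 3)" by (rule sum_mono)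
    then have "(\<Sum>w\<in>verts G - {v}. card (halves G w)) \<le> 3 * card (verts G - {v})"
      by (simp only: sum_constant) (simp add: mult.commute)
    moreover have "(\<Sum>w\<in>verts G. card (halves G w)) = card (halves G v) + (\<Sum>w\<in>verts G - {v}. card (halves G w))"
      using PTD(5)[OF G] v by (simp add: sum.remove)
    moreover have "card (verts G) = Suc (card (verts G - {v}))"
      by (rule card.remove[OF PTD(5)[OF G] v(1)])
    ultimately show False using handshake[OF PTD(1)[OF G]] PTD(4)[OF G] c v(2) by linarith
  qed
  then show ?thesis using that by blast
qed

definition splits :: "wgraph \<Rightarrow> nat \<Rightarrow> (nat \<times> bool) set \<Rightarrow> nat \<Rightarrow> nat \<Rightarrow> bool" where
  "splits G v P n e \<longleftrightarrow> v \<in> verts G \<and> P \<subseteq> halves G v \<and> n \<notin> verts G \<and> e \<notin> edges G"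

lemma PT_vsplit:
  assumes G: "G \<in> PT g" and s: "splits G v P n e"
  shows "vsplit G v P n e \<in> PT g \<longleftrightarrow> \<not> badh G v P"
proof -
  have sv: "v \<in> verts G" "P \<subseteq> halves G v" "n \<notin> verts G" "e \<notin> edges G"
    using s by (auto simp: splits_def)
  have "wf_graph (vsplit G v P n e)" by (rule vsplit_wf[OF PTD(1)[OF G] sv(1)])
  moreover have "pure_graph (vsplit G v P n e)" using PTD(3)[OF G] by (simp add: pure_graph_def)
  moreover have "card (insert e (edges G)) + 1 = card (insert n (verts G)) + g"
    using PTD(4-6)[OF G] sv by simp
  ultimately show ?thesis
    using tec_vsplit[OF PTD(1,2)[OF G] sv] unfolding PT_def by simp
qed

text \<open>Every cut of \<open>G\<close> is also a cut of the split graph, with \<open>v\<close>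
  and \<open>n\<close> on the same side.\<close>

lemma tec_of_vsplit:
  assumes wf: "wf_graph G" and s: "splits G v P n e" and t: "three_edge_connected (vsplit G v P n e)"
  shows "three_edge_connected G"
proof -
  have sv: "v \<in> verts G" "P \<subseteq> halves G v" "n \<notin> verts G" "e \<notin> edges G"
    using s by (auto simp: splits_def)
  have wfH: "wf_graph (vsplit G v P n e)" by (rule vsplit_wf[OF wf sv(1)])
  have T: "3 \<le> card (cut (vsplit G v P n e) Y)"
    if "Y \<subseteq> insert n (verts G)" "Y \<noteq> {}" "Y \<noteq> insert n (verts G)" for Y
    using t tec_iff_cut[OF wfH] that by simp
  have "3 \<le> card (cut G X)" if X: "X \<subseteq> verts G" "X \<noteq> {}" "X \<noteq> verts G" for X
  proof -
    have n: "n \<notin> X" "v \<noteq> n" using X sv by auto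
    obtain Y where Y: "Y \<subseteq> insert n (verts G)" "v \<in> Y \<longleftrightarrow> n \<in> Y" "Y - {n} = X"
    proof (cases "v \<in> X")
      case True then show ?thesis using that[of "insert n X"] X(1) n by auto
    next
      case False then show ?thesis using that[of X] X(1) n by auto
    qed
    have "Y \<noteq> {}" "Y \<noteq> insert n (verts G)" using Y(3) X sv(3) by auto
    then have "3 \<le> card (cut (vsplit G v P n e) Y)" using T Y(1) by blast
    then show ?thesis using cut_vsplit_same[OF wf sv Y(2)] Y(3) by simp
  qed
  moreover have "verts G \<noteq> {}" using sv by auto
  ultimately show ?thesis using tec_iff_cut[OF wf] by simp
qed

subsection \<open>Isomorphisms\<close>

text \<open>The flag \<open>fl x\<close> says whether the edge \<open>x\<close> is reversed.
  Half-edges are tracked because a splitting can tell the two halves of a loop apart, while sets of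
  endpoints cannot.\<close>

definition giso :: "wgraph \<Rightarrow> wgraph \<Rightarrow> bool" where
  "giso G H \<longleftrightarrow> (\<exists>f k fl. bij_betw f (verts G) (verts H) \<and> bij_betw k (edges G) (edges H) \<and>
     (\<forall>x\<in>edges G. \<forall>s. hend H (k x, s) = f (hend G (x, s \<noteq> fl x))))"

lemma gisoI:
  assumes "bij_betw f (verts G) (verts H)" "bij_betw k (edges G) (edges H)"
    "\<And>x s. x \<in> edges G \<Longrightarrow> hend H (k x, s) = f (hend G (x, s \<noteq> fl x))"
  shows "giso G H"
  unfolding giso_def using assms by (intro exI[of _ f] exI[of _ k] exI[of _ fl]) simp

lemma giso_tec:
  assumes wf: "wf_graph G" "wf_graph H" and i: "giso G H" and t: "three_edge_connected G"
  shows "three_edge_connected H"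
proof -
  obtain f k fl where f: "bij_betw f (verts G) (verts H)" and k: "bij_betw k (edges G) (edges H)"
    and h: "\<And>x s. x \<in> edges G \<Longrightarrow> hend H (k x, s) = f (hend G (x, s \<noteq> fl x))"
    using i by (auto simp: giso_def)
  have "3 \<le> card (cut H Y)" if Y: "Y \<subseteq> verts H" "Y \<noteq> {}" "Y \<noteq> verts H" for Y
  proof -
    let ?X = "{v \<in> verts G. f v \<in> Y}"
    have Yi: "Y = f ` ?X" using Y f by (auto simp: bij_betw_def)
    then have "?X \<noteq> {}" "?X \<noteq> verts G" using Y f by (auto simp: bij_betw_def)
    then have "3 \<le> card (cut G ?X)" using t tec_iff_cut[OF wf(1)] by auto
    also have "\<dots> = card (k ` cut G ?X)"
    proof (rule card_image[symmetric])
      show "inj_on k (cut G ?X)"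
        by (rule inj_on_subset[OF bij_betw_imp_inj_on[OF k]]) (auto simp: cut_def)
    qed
    also have "\<dots> \<le> card (cut H Y)"
    proof (rule card_mono[OF finite_cut[OF wf(2)]], rule subsetI)
      fix y assume "y \<in> k ` cut G ?X"
      then obtain x where x: "y = k x" "x \<in> edges G" "(src G x \<in> ?X) \<noteq> (tgt G x \<in> ?X)"
        by (auto simp: cut_def)
      have "hend G (x, s) \<in> verts G" for s using wf(1) x by (auto simp: wf_graph_def hend_def)
      then have "hend G (x, s) \<in> ?X \<longleftrightarrow> f (hend G (x, s)) \<in> Y" for s by simp
      from this[of True] this[of False] have "(f (src G x) \<in> Y) \<noteq> (f (tgt G x) \<in> Y)" using x(3) by simp
      moreover have "k x \<in> edges H" using k x by (auto simp: bij_betw_def)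
      ultimately show "y \<in> cut H Y" using h[OF x(2), of True] h[OF x(2), of False] x(1)
        by (cases "fl x") (auto simp: cut_def)
    qed
    finally show ?thesis .
  qed
  moreover have "verts H \<noteq> {}" using t f by (auto simp: bij_betw_def three_edge_connected_def)
  ultimately show ?thesis using tec_iff_cut[OF wf(2)] by blast
qed

lemma giso_PT:
  assumes "G \<in> PT g" "giso G H" "wf_graph H" "pure_graph H"
  shows "H \<in> PT g"
proof -
  have "card (verts H) = card (verts G)" "card (edges H) = card (edges G)"
    using assms(2) by (auto simp: giso_def bij_betw_same_card)
  then show ?thesis using assms giso_tec[OF _ assms(3,2)] by (auto simp: PT_def)
qed

lemma giso_vsplit:
  assumes i: "giso G H" and wf: "wf_graph G" "wf_graph H" and s: "splits G v P n e"
  shows "\<exists>w Q. w \<in> verts H \<and> Q \<subseteq> halves H w \<and>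
    (\<forall>m f. m \<notin> verts H \<longrightarrow> f \<notin> edges H \<longrightarrow> giso (vsplit G v P n e) (vsplit H w Q m f))"
proof -
  obtain f k fl where f: "bij_betw f (verts G) (verts H)" and k: "bij_betw k (edges G) (edges H)"
    and h: "\<And>x s. x \<in> edges G \<Longrightarrow> hend H (k x, s) = f (hend G (x, s \<noteq> fl x))"
    using i by (auto simp: giso_def)
  have sv: "v \<in> verts G" "P \<subseteq> halves G v" "n \<notin> verts G" "e \<notin> edges G" using s by (auto simp: splits_def)
  \<comment> \<open>The image of \<open>P\<close> under the induced bijection of half-edges, which
    exchanges the halves of \<open>x\<close> exactly when \<open>fl x\<close> holds.\<close>
  let ?Q = "{(k x, s) | x s. (x, s \<noteq> fl x) \<in> P}"
  have Pe: "x \<in> edges G" if "(x, s) \<in> P" for x s using that sv(2) by (auto simp: halves_def)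
  have 1: "f v \<in> verts H" using f sv by (auto simp: bij_betw_def)
  have 2: "?Q \<subseteq> halves H (f v)"
  proof
    fix z assume "z \<in> ?Q"
    then obtain x s where z: "z = (k x, s)" "(x, s \<noteq> fl x) \<in> P" by blast
    have x: "x \<in> edges G" "hend G (x, s \<noteq> fl x) = v" using z sv(2) by (auto simp: halves_def)
    have "k x \<in> edges H" using k x by (auto simp: bij_betw_def)
    then show "z \<in> halves H (f v)" using z h[OF x(1), of s] x by (simp add: halves_def)
  qed
  have mem: "(k x, s) \<in> ?Q \<longleftrightarrow> (x, s \<noteq> fl x) \<in> P" if x: "x \<in> edges G" for x s
  proof
    assume "(k x, s) \<in> ?Q"
    then obtain y where y: "k y = k x" "(y, s \<noteq> fl y) \<in> P" by auto
    then have "y = x" using Pe[OF y(2)] x k by (auto simp: bij_betw_def inj_on_def)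
    then show "(x, s \<noteq> fl x) \<in> P" using y by simp
  qed blast
  have 3: "giso (vsplit G v P n e) (vsplit H (f v) ?Q m j)" if mf: "m \<notin> verts H" "j \<notin> edges H" for m j
  proof -
    let ?G = "vsplit G v P n e" and ?H = "vsplit H (f v) ?Q m j"
    let ?f = "f(n := m)" and ?k = "k(e := j)" and ?l = "fl(e := False)"
    have "bij_betw ?f (verts G) (verts H)"
      using f sv(3) by (subst bij_betw_cong[of _ _ f]) auto
    then have "bij_betw ?f (insert n (verts G)) (insert m (verts H))"
      using notIn_Un_bij_betw[of n "verts G" ?f "verts H"] sv(3) mf(1) by simp
    moreover have "bij_betw ?k (edges G) (edges H)"
      using k sv(4) by (subst bij_betw_cong[of _ _ k]) auto
    then have "bij_betw ?k (insert e (edges G)) (insert j (edges H))"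
      using notIn_Un_bij_betw[of e "edges G" ?k "edges H"] sv(4) mf(2) by simp
    moreover have "hend ?H (?k x, s) = ?f (hend ?G (x, s \<noteq> ?l x))" if x: "x \<in> insert e (edges G)" for x s
    proof (cases "x = e")
      case True
      then show ?thesis using sv mf by (cases s) auto
    next
      case False
      then have xE: "x \<in> edges G" using x by simp
      have kx: "k x \<noteq> j" using k xE mf by (auto simp: bij_betw_def)
      have nn: "hend G (x, b) \<noteq> n" for b using wf(1) xE sv(3) by (auto simp: hend_def wf_graph_def)
      have "hend ?H (k x, s) = (if (k x, s) \<in> ?Q then m else hend H (k x, s))"
        using kx by (cases s) (auto simp: vsplit_def)
      moreover have "hend ?G (x, b) = (if (x, b) \<in> P then n else hend G (x, b))" for b
        using False by (cases b) auto
      ultimately show ?thesis using False mem[OF xE, of s] h[OF xE, of s] nn by simp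
    qed
    ultimately show ?thesis by (intro gisoI[of ?f _ _ ?k ?l]) simp_all
  qed
  show ?thesis using 1 2 3 by (intro exI[of _ "f v"] exI[of _ ?Q]) simp
qed

text \<open>Exchanging \<open>v\<close> with \<open>n\<close> and reversing the new edge identifies
  the two graphs.\<close>

lemma giso_vsplit_swap:
  assumes wf: "wf_graph G" and s: "splits G v P n e"
  shows "giso (vsplit G v P n e) (vsplit G v (halves G v - P) n e)"
proof -
  let ?G = "vsplit G v P n e" and ?H = "vsplit G v (halves G v - P) n e"
  let ?f = "\<lambda>u. if u = v then n else if u = n then v else u"
  have sv: "v \<in> verts G" "P \<subseteq> halves G v" "n \<notin> verts G" "e \<notin> edges G" "v \<noteq> n" using s by (auto simp: splits_def)
  have "bij_betw ?f (insert n (verts G)) (insert n (verts G))"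
    using sv by (intro bij_betwI[of _ _ _ ?f]) auto
  moreover have "hend ?H (id x, b) = ?f (hend ?G (x, b \<noteq> (x = e)))" if x: "x \<in> insert e (edges G)" for x b
  proof (cases "x = e")
    case True
    then show ?thesis using sv by (cases b) auto
  next
    case False
    then have xE: "x \<in> edges G" using x by simp
    have "hend G (x, b) \<noteq> n" using wf xE sv(3) by (auto simp: hend_def wf_graph_def)
    moreover have "hend ?G (x, b) = (if (x, b) \<in> P then n else hend G (x, b))"
      "hend ?H (x, b) = (if (x, b) \<in> halves G v - P then n else hend G (x, b))"
      using False by (cases b; simp)+
    moreover have "(x, b) \<in> halves G v \<longleftrightarrow> hend G (x, b) = v" using xE by (simp add: halves_def)
    ultimately show ?thesis using False sv by auto
  qed
  ultimately show ?thesis by (intro gisoI[of ?f _ _ id "\<lambda>x. x = e"]) simp_all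
qed

text \<open>Both graphs are roses with \<open>g\<close> petals, so any bijection of the edges
  works.\<close>

lemma giso_single_vertex:
  assumes G: "G \<in> PT g" "verts G = {v}" and H: "H \<in> PT g" "verts H = {w}"
  shows "giso G H"
proof -
  have "card (edges G) = card (edges H)" using PTD(4)[OF G(1)] PTD(4)[OF H(1)] G H by simp
  from finite_same_card_bij[OF PTD(6)[OF G(1)] PTD(6)[OF H(1)] this]
  obtain k where k: "bij_betw k (edges G) (edges H)" ..
  have "hend G (x, s) = v" if "x \<in> edges G" for x s
    using PTD(1)[OF G(1)] G(2) that by (auto simp: wf_graph_def hend_def)
  moreover have "hend H (y, s) = w" if "y \<in> edges H" for y s
    using PTD(1)[OF H(1)] H(2) that by (auto simp: wf_graph_def hend_def)
  moreover have "k x \<in> edges H" if "x \<in> edges G" for x using k that by (auto simp: bij_betw_def)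
  ultimately show ?thesis using k G(2) H(2)
    by (intro gisoI[of "\<lambda>_. w" _ _ k "\<lambda>_. False"]) (simp_all add: bij_betw_def)
qed

subsection \<open>Expansions\<close>

inductive exps :: "nat \<Rightarrow> wgraph \<Rightarrow> wgraph \<Rightarrow> bool" for g where
  exps_refl: "G \<in> PT g \<Longrightarrow> exps g G G"
| exps_step: "K \<in> PT g \<Longrightarrow> splits K v P n e \<Longrightarrow> vsplit K v P n e \<in> PT g \<Longrightarrow>
    exps g (vsplit K v P n e) G \<Longrightarrow> exps g K G"

lemma exps_PT: "exps g K G \<Longrightarrow> K \<in> PT g \<and> G \<in> PT g"
  by (induction rule: exps.induct) auto

lemma exps_trans: "exps g K L \<Longrightarrow> exps g L G \<Longrightarrow> exps g K G"
  by (induction rule: exps.induct) (auto intro: exps_step)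

lemma fresh: "finite (A :: nat set) \<Longrightarrow> \<exists>n. n \<notin> A"
  using ex_new_if_finite[OF infinite_UNIV_nat] by blast

lemma exps_giso:
  assumes "exps g K G" "giso K K'" "K' \<in> PT g"
  shows "\<exists>G'. exps g K' G' \<and> giso G G'"
  using assms
proof (induction arbitrary: K' rule: exps.induct)
  case (exps_refl G)
  then show ?case using exps.exps_refl[OF exps_refl(3)] by blast
next
  case (exps_step K v P n e G)
  obtain w Q where wQ: "w \<in> verts K'" "Q \<subseteq> halves K' w"
    "\<And>m f. m \<notin> verts K' \<Longrightarrow> f \<notin> edges K' \<Longrightarrow> giso (vsplit K v P n e) (vsplit K' w Q m f)"
    using giso_vsplit[OF exps_step.prems(1) PTD(1)[OF exps_step.hyps(1)]
        PTD(1)[OF exps_step.prems(2)] exps_step.hyps(2)] by (elim exE conjE) simp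
  obtain m f where mf: "m \<notin> verts K'" "f \<notin> edges K'"
    using fresh[OF PTD(5)[OF exps_step.prems(2)]] fresh[OF PTD(6)[OF exps_step.prems(2)]] by blast
  have i: "giso (vsplit K v P n e) (vsplit K' w Q m f)" using wQ(3) mf by blast
  have s: "splits K' w Q m f" using wQ mf by (simp add: splits_def)
  have "wf_graph (vsplit K' w Q m f)" by (rule vsplit_wf[OF PTD(1)[OF exps_step.prems(2)] wQ(1)])
  moreover have "pure_graph (vsplit K' w Q m f)"
    using PTD(3)[OF exps_step.prems(2)] by (simp add: pure_graph_def)
  ultimately have pt: "vsplit K' w Q m f \<in> PT g" using giso_PT[OF exps_step.hyps(3) i] by blast
  obtain G' where "exps g (vsplit K' w Q m f) G'" "giso G G'" using exps_step.IH[OF i pt] by blast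
  then show ?case using exps.exps_step[OF exps_step.prems(2) s pt] by blast
qed

lemma PT_good_split:
  assumes K: "K \<in> PT g" and v: "v \<in> verts K" and d: "4 \<le> card (halves K v)"
  obtains P where "P \<subseteq> halves K v" "\<not> badh K v P"
proof -
  interpret tec_vertex K v using PTD[OF K] v by unfold_locales
  have "2 \<le> card L" using d by simp
  then obtain T where "T \<subseteq> L" "card T = 2" by (rule obtain_subset_with_card_n)
  then obtain x u where "x \<in> L" "u \<in> L" "x \<noteq> u" by (auto simp: card_2_iff)
  then obtain y where "y \<in> L" "\<not> badh K v {x, y}" using exists_good_partner[OF d] by blast
  then show ?thesis using that[of "{x, y}"] \<open>x \<in> L\<close> by blast
qed

lemma PT_expand:
  assumes K: "K \<in> PT g" and g: "g \<ge> 2" and c: "card (edges K) < 3 * g - 3"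
  obtains v P n e where "splits K v P n e" "vsplit K v P n e \<in> PT g"
proof -
  obtain v where v: "v \<in> verts K" "4 \<le> card (halves K v)" by (rule PT_exists_valence4[OF K g c])
  obtain P where P: "P \<subseteq> halves K v" "\<not> badh K v P" by (rule PT_good_split[OF K v])
  obtain n e where "n \<notin> verts K" "e \<notin> edges K"
    using fresh[OF PTD(5)[OF K]] fresh[OF PTD(6)[OF K]] by blast
  then have "splits K v P n e" using v P by (simp add: splits_def)
  then show ?thesis using that PT_vsplit[OF K] P(2) by metis
qed

lemma exps_top:
  assumes "K \<in> PT g" "g \<ge> 2"
  shows "\<exists>G. exps g K G \<and> card (edges G) = 3 * g - 3"
  using assms(1)
proof (induction "3 * g - 3 - card (edges K)" arbitrary: K rule: less_induct)
  case less
  show ?case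
  proof (cases "card (edges K) < 3 * g - 3")
    case True
    obtain v P n e where s: "splits K v P n e" "vsplit K v P n e \<in> PT g"
      by (rule PT_expand[OF less.prems assms(2) True])
    have "card (edges (vsplit K v P n e)) = Suc (card (edges K))"
      using s(1) PTD(6)[OF less.prems] by (simp add: splits_def)
    then have "\<exists>G. exps g (vsplit K v P n e) G \<and> card (edges G) = 3 * g - 3"
      using True by (intro less.hyps s(2)) simp
    then show ?thesis using exps_step[OF less.prems s] by blast
  next
    case False
    then show ?thesis using PT_edges_le[OF less.prems assms(2)] exps_refl[OF less.prems] by auto
  qed
qed

lemma nonloop_is_vsplit:
  assumes G: "G \<in> PT g" and e: "e \<in> edges G" "src G e \<noteq> tgt G e"
  obtains K v P n where "K \<in> PT g" "splits K v P n e" "G = vsplit K v P n e"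
proof -
  define a b where "a = src G e" and "b = tgt G e"
  have ab: "a \<in> verts G" "b \<in> verts G" "a \<noteq> b"
    using e PTD(1)[OF G] by (auto simp: a_def b_def wf_graph_def)
  \<comment> \<open>Contraction of \<open>e\<close> onto its source. The end maps are changed only
    on edges of \<open>G\<close>, so that splitting \<open>K\<close> again returns \<open>G\<close>
    as a record, including the irrelevant values off the edge set.\<close>
  define K where "K = \<lparr>verts = verts G - {b}, edges = edges G - {e},
    src = (\<lambda>x. if x \<in> edges G \<and> src G x = b then a else src G x),
    tgt = (\<lambda>x. if x \<in> edges G \<and> tgt G x = b then a else tgt G x), wt = wt G\<rparr>"
  define P where "P = {h. fst h \<in> edges G - {e} \<and> hend G h = b}"
  have "P \<subseteq> halves K a" by (auto simp: P_def K_def halves_def hend_def)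
  then have s: "splits K a P b e" using ab by (auto simp: splits_def K_def)
  \<comment> \<open>Splitting assigns weight 0 to the new vertex, which agrees with \<open>G\<close>
    because \<open>G\<close> is pure.\<close>
  have "wt G b = 0" using PTD(3)[OF G] ab by (simp add: pure_graph_def)
  then have eq: "G = vsplit K a P b e"
    using ab e by (auto simp: vsplit_def K_def P_def fun_eq_iff a_def b_def intro!: wgraph.equality)
  have wf: "wf_graph K" using PTD(1)[OF G] ab by (auto simp: wf_graph_def K_def)
  have "three_edge_connected K"
    using tec_of_vsplit[OF wf s] PTD(2)[OF G] eq by simp
  moreover have "pure_graph K" using PTD(3)[OF G] by (simp add: pure_graph_def K_def)
  moreover have "card (edges K) + 1 = card (verts K) + g"
  proof -
    have "card (edges G) = Suc (card (edges K))" "card (verts G) = Suc (card (verts K))"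
      using card.remove[OF PTD(6)[OF G] e(1)] card.remove[OF PTD(5)[OF G] ab(2)] by (simp_all add: K_def)
    then show ?thesis using PTD(4)[OF G] by simp
  qed
  ultimately have "K \<in> PT g" using wf by (simp add: PT_def)
  then show ?thesis using that s eq by blast
qed

text \<open>As long as there are two vertices, some cut is nonempty and yields an edge that is not a
  loop; contracting it removes a vertex.\<close>

lemma exps_single_vertex:
  assumes "G \<in> PT g"
  shows "\<exists>R v. exps g R G \<and> verts R = {v}"
  using assms
proof (induction "card (verts G)" arbitrary: G rule: less_induct)
  case less
  obtain v where v: "v \<in> verts G" using PTD(2)[OF less.prems] by (auto simp: three_edge_connected_def)
  show ?case
  proof (cases "verts G = {v}")
    case True
    then show ?thesis using exps_refl[OF less.prems] by blast
  next
    case False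
    then have "3 \<le> card (cut G {v})" using v PTD(1,2)[OF less.prems] tec_iff_cut by blast
    then have "cut G {v} \<noteq> {}" by auto
    then obtain e where "e \<in> edges G" "src G e \<noteq> tgt G e" by (auto simp: cut_def)
    then obtain K w P n where K: "K \<in> PT g" "splits K w P n e" "G = vsplit K w P n e"
      by (rule nonloop_is_vsplit[OF less.prems])
    have "card (verts K) < card (verts G)" using K PTD(5)[OF K(1)] by (simp add: splits_def)
    then obtain R u where "exps g R K" "verts R = {u}" using less.hyps K(1) by blast
    moreover have "exps g K G"
      using exps_step[OF K(1,2)] exps_refl[OF less.prems] less.prems K(3) by simp
    ultimately show ?thesis using exps_trans by metis
  qed
qed

section \<open>Connecting the splittings of one graph\<close>

context tec_vertex
begin

text \<open>The difference of the two closed sets would be a closed singleton.\<close>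

lemma closed_quad_share:
  assumes "closedh G v {a, b, s, t}" "closedh G v {a, b, s, u}" "{a, b, s, t, u} \<subseteq> L" "t \<notin> {a, b, s, u}"
  shows False
proof -
  have "closedh G v ({a, b, s, t} - {a, b, s, u})" using assms by (intro closed_diff) auto
  moreover have "{a, b, s, t} - {a, b, s, u} = {t}" using assms(4) by auto
  ultimately show False using not_closed_single assms(3) by simp
qed

text \<open>The intersection of the two closed sets would be \<open>{a, b}\<close>, and closed sets
  are bad.\<close>

lemma closed_quad_disjoint:
  assumes "closedh G v {a, b, s, t}" "closedh G v {a, b, u, w}" "{a, b, s, t, u, w} \<subseteq> L"
    "s \<noteq> u" "s \<noteq> w" "t \<noteq> u" "t \<noteq> w" "\<not> badh G v {a, b}"
  shows False
proof -
  have "closedh G v ({a, b, s, t} \<inter> {a, b, u, w})" using assms(1-3) by (intro closed_inter) auto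
  moreover have "{a, b, s, t} \<inter> {a, b, u, w} = {a, b}"
    using assms(4-7) by auto
  ultimately show False using closed_imp_bad assms(8) by simp
qed

lemma closed_complement:
  assumes "closedh G v P" "P \<subseteq> L" "L - P = Q" shows "closedh G v Q"
  using closed_diff[OF closed_all assms(1) order_refl assms(2)] assms(3) by simp

text \<open>The bad pairs form a matching together with disjoint closed triples, and at most one pair
  \<open>x, y\<close> has \<open>{a, b, x, y}\<close> closed, so three half-edges besides \<open>a, b, c\<close> leave an admissible pair.\<close>

lemma exists_compatible_pair:
  assumes d: "6 \<le> card L" and abc: "a \<in> L" "b \<in> L" "c \<in> L" "a \<noteq> b" "a \<noteq> c" "b \<noteq> c"
    and gab: "\<not> badh G v {a, b}" and gac: "\<not> badh G v {a, c}"
  shows "\<exists>x\<in>L - {a, b, c}. \<exists>y\<in>L - {a, b, c}. x \<noteq> y \<and> \<not> badh G v {x, y} \<and>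
    \<not> closedh G v {a, b, x, y} \<and> \<not> closedh G v {a, c, x, y}"
proof (rule ccontr)
  assume no: "\<not> ?thesis"
  let ?R = "L - {a, b, c}"
  \<comment> \<open>The three obstructions: the pair is bad (\<open>B\<close>), or it cannot be
    split off together with \<open>{a, b}\<close> (\<open>A\<close>) or with \<open>{a, c}\<close>
    (\<open>C\<close>).\<close>
  define B where "B s t \<longleftrightarrow> badh G v {s, t}" for s t
  define A where "A s t \<longleftrightarrow> closedh G v {a, b, s, t}" for s t
  define C where "C s t \<longleftrightarrow> closedh G v {a, c, s, t}" for s t
  have ob: "B s t \<or> A s t \<or> C s t" if "s \<in> ?R" "t \<in> ?R" "s \<noteq> t" for s t
    using no that unfolding A_def B_def C_def by blast
  have sym: "B s t = B t s" "A s t = A t s" "C s t = C t s" for s t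
    unfolding A_def B_def C_def by (simp_all add: insert_commute)
  have A1: False if "A s t" "A s u" "s \<in> ?R" "t \<in> ?R" "u \<in> ?R" "s \<noteq> t" "t \<noteq> u" for s t u
    using that abc by (intro closed_quad_share[of a b s t u]) (auto simp: A_def)
  have C1: False if "C s t" "C s u" "s \<in> ?R" "t \<in> ?R" "u \<in> ?R" "s \<noteq> t" "t \<noteq> u" for s t u
    using that abc by (intro closed_quad_share[of a c s t u]) (auto simp: C_def)
  have A2: False if "A s t" "A u w" "s \<in> ?R" "t \<in> ?R" "u \<in> ?R" "w \<in> ?R" "s \<noteq> u" "s \<noteq> w" "t \<noteq> u" "t \<noteq> w" for s t u w
    using that abc gab by (intro closed_quad_disjoint[of a b s t u w]) (auto simp: A_def)
  have C2: False if "C s t" "C u w" "s \<in> ?R" "t \<in> ?R" "u \<in> ?R" "w \<in> ?R" "s \<noteq> u" "s \<noteq> w" "t \<noteq> u" "t \<noteq> w" for s t u w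
    using that abc gac by (intro closed_quad_disjoint[of a c s t u w]) (auto simp: C_def)
  \<comment> \<open>Of three pairs at \<open>s\<close>, at most one has type \<open>A\<close> and at
    most one has type \<open>C\<close>.\<close>
  have star: "B s t \<or> B s u \<or> B s w"
    if "s \<in> ?R" "t \<in> ?R" "u \<in> ?R" "w \<in> ?R" "s \<noteq> t" "s \<noteq> u" "s \<noteq> w" "t \<noteq> u" "t \<noteq> w" "u \<noteq> w" for s t u w
    using ob[of s t] ob[of s u] ob[of s w] A1[of s t u] A1[of s t w] A1[of s u w]
      C1[of s t u] C1[of s t w] C1[of s u w] that by satx
  have tri: "closedh G v {s, t, u}" if "B s t" "B s u" "s \<in> ?R" "t \<in> ?R" "u \<in> ?R" "s \<noteq> t" "s \<noteq> u" "t \<noteq> u" for s t u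
    using that by (intro bad_bad_closed) (auto simp: B_def)
  have fin: "finite L" by (rule finite_halves[OF wf])
  have "3 \<le> card ?R" using d abc fin by (simp add: card_Diff_subset)
  then obtain T where T: "T \<subseteq> ?R" "card T = 3" by (rule obtain_subset_with_card_n)
  from T(2) obtain x y z where T': "T = {x, y, z}" and d3: "x \<noteq> y" "x \<noteq> z" "y \<noteq> z"
    unfolding card_3_iff by metis
  have "x \<in> ?R" "y \<in> ?R" "z \<in> ?R" using T(1) unfolding T' by blast+
  note xyz = this d3
  show False
  proof (cases "?R \<subseteq> {x, y, z}")
    case False
    then obtain w where w: "w \<in> ?R" "w \<noteq> x" "w \<noteq> y" "w \<noteq> z" by blast
    \<comment> \<open>The closed triple \<open>{s, t, u}\<close> is crossed by no bad pair, contrary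
      to \<open>star\<close> at \<open>r\<close>.\<close>
    have nb2: False if "B s t" "B s u" "s \<in> ?R" "t \<in> ?R" "u \<in> ?R" "r \<in> ?R"
      "s \<noteq> t" "s \<noteq> u" "t \<noteq> u" "r \<noteq> s" "r \<noteq> t" "r \<noteq> u" for s t u r
    proof -
      have c: "closedh G v {s, t, u}" by (rule tri[OF that(1-5,7-9)])
      have "\<not> B r k" if "k \<in> {s, t, u}" for k
        using closed_bad_cross[OF c, of k r] that \<open>r \<in> ?R\<close> \<open>s \<in> ?R\<close> \<open>t \<in> ?R\<close> \<open>u \<in> ?R\<close>
          \<open>r \<noteq> s\<close> \<open>r \<noteq> t\<close> \<open>r \<noteq> u\<close> by (auto simp: B_def insert_commute)
      then have "\<not> B r s" "\<not> B r t" "\<not> B r u" by simp_all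
      then show False using star[of r s t u] that by simp
    qed
    \<comment> \<open>A bad pair \<open>{s, t}\<close> forces \<open>{s, u}\<close>,
      \<open>{s, r}\<close> and \<open>{t, u}\<close> into the two types \<open>A\<close> and
      \<open>C\<close>; no two of these pairs can have the same type.\<close>
    have nobad: False if h: "B s t" "s \<in> ?R" "t \<in> ?R" "u \<in> ?R" "r \<in> ?R"
      "s \<noteq> t" "s \<noteq> u" "t \<noteq> u" "r \<noteq> s" "r \<noteq> t" "r \<noteq> u" for s t u r
    proof -
      have "\<not> B s u" "\<not> B s r" "\<not> B t u"
        using nb2[of s t u r] nb2[of s t r u] nb2[of t s u r] h sym(1)[of s t] by auto
      then have "A s u \<or> C s u" "A s r \<or> C s r" "A t u \<or> C t u" using ob[of s u] ob[of s r] ob[of t u] h by auto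
      moreover have "\<not> (A s u \<and> A s r)" "\<not> (C s u \<and> C s r)" using A1[of s u r] C1[of s u r] h by auto
      moreover have "\<not> (A s u \<and> A t u)" "\<not> (C s u \<and> C t u)"
        using A1[of u s t] C1[of u s t] h sym(2,3) by auto
      moreover have "\<not> (A s r \<and> A t u)" "\<not> (C s r \<and> C t u)" using A2[of s r t u] C2[of s r t u] h by auto
      ultimately show False by satx
    qed
    have "\<not> B x y" "\<not> B x z" "\<not> B x w"
      using nobad[of x y z w] nobad[of x z y w] nobad[of x w y z] xyz w by auto
    then show False using star[of x y z w] xyz w by simp
  next
    case True
    then have R: "?R = {x, y, z}" using xyz by blast
    \<comment> \<open>With exactly six half-edges complements decide. A closed
      \<open>{s, t, u}\<close> leaves the closed triple \<open>{a, b, c}\<close>, which makes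
      \<open>{a, b}\<close> bad; a closed quadruple leaves a closed pair that contains
      \<open>t\<close> but not \<open>s\<close>, and so separates the bad pair.\<close>
    have nob: False if h: "B s t" "{s, t, u} = ?R" "s \<noteq> t" "s \<noteq> u" "t \<noteq> u" for s t u
    proof -
      have R: "s \<in> ?R" "t \<in> ?R" "u \<in> ?R" using h(2) by blast+
      then have stu: "s \<in> L" "t \<in> L" "u \<in> L" "s \<notin> {a,b,c}" "t \<notin> {a,b,c}" "u \<notin> {a,b,c}" by blast+
      have Leq: "L = {a, b, c, s, t, u}" using h(2) abc by blast
      have "\<not> B s u"
      proof
        assume "B s u"
        then have "closedh G v {s, t, u}" using tri[OF h(1)] R h by blast
        moreover have "L - {s, t, u} = {a, b, c}" using Leq stu by auto
        ultimately have "closedh G v {a, b, c}" using closed_complement stu by blast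
        then show False using closed_triple_bad gab by blast
      qed
      moreover have "\<not> A u s"
      proof
        assume "A u s"
        moreover have "L - {a, b, u, s} = {c, t}" using Leq stu abc h by auto
        ultimately have "closedh G v {c, t}"
          using closed_complement[of "{a, b, u, s}"] stu abc by (simp add: A_def)
        then show False using closed_bad_cross[of "{c, t}" t s] h stu abc
          by (auto simp: B_def insert_commute)
      qed
      moreover have "\<not> C u s"
      proof
        assume "C u s"
        moreover have "L - {a, c, u, s} = {b, t}" using Leq stu abc h by auto
        ultimately have "closedh G v {b, t}"
          using closed_complement[of "{a, c, u, s}"] stu abc by (simp add: C_def)
        then show False using closed_bad_cross[of "{b, t}" t s] h stu abc
          by (auto simp: B_def insert_commute)
      qed
      ultimately show False using ob[of u s] R h sym(1)[of s u] by auto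
    qed
    have "\<not> B x y" "\<not> B x z" "\<not> B y z"
      using nob[of x y z] nob[of x z y] nob[of y z x] R xyz by (auto simp: insert_commute)
    \<comment> \<open>Three pairs remain for two types. Any two of them share a half-edge, so each
      type occurs at most once.\<close>
    then have "A x y \<or> C x y" "A x z \<or> C x z" "A y z \<or> C y z"
      using ob[of x y] ob[of x z] ob[of y z] xyz by auto
    moreover have "\<not> (A x y \<and> A x z)" "\<not> (C x y \<and> C x z)" using A1[of x y z] C1[of x y z] xyz by auto
    moreover have "\<not> (A x y \<and> A y z)" "\<not> (C x y \<and> C y z)" using A1[of y x z] C1[of y x z] xyz sym(2,3) by auto
    moreover have "\<not> (A x z \<and> A y z)" "\<not> (C x z \<and> C y z)" using A1[of z x y] C1[of z x y] xyz sym(2,3) by auto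
    ultimately show False by satx
  qed
qed

text \<open>The closed triple given by two bad partners would have a closed singleton as
  complement.\<close>

lemma bad_partner_unique_4:
  assumes d: "card L = 4" and h: "{h, x, y} \<subseteq> L" "h \<noteq> x" "h \<noteq> y" "x \<noteq> y"
    and b: "badh G v {h, x}" "badh G v {h, y}"
  shows False
proof -
  have c: "closedh G v {h, x, y}" using h b by (intro bad_bad_closed) auto
  have "card (L - {h, x, y}) = 1"
    using d h finite_halves[OF wf, of v] by (simp add: card_Diff_subset)
  then obtain z where z: "L - {h, x, y} = {z}" by (auto simp: card_1_singleton_iff)
  then show False using closed_complement[OF c h(1) z] not_closed_single[of z] by blast
qed

end

section \<open>Invariants of trivalent graphs that agree across facets\<close>

locale face_invariant =
  fixes g :: nat and \<tau> :: "wgraph \<Rightarrow> bool"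
  assumes g2: "g \<ge> 2"
    and inv_iso: "\<And>G H. G \<in> PT g \<Longrightarrow> H \<in> PT g \<Longrightarrow> card (edges G) = 3 * g - 3 \<Longrightarrow> giso G H \<Longrightarrow> \<tau> G = \<tau> H"
    and inv_face: "\<And>K v P n e w Q m f. K \<in> PT g \<Longrightarrow> card (edges K) + 1 = 3 * g - 3 \<Longrightarrow>
      splits K v P n e \<Longrightarrow> vsplit K v P n e \<in> PT g \<Longrightarrow>
      splits K w Q m f \<Longrightarrow> vsplit K w Q m f \<in> PT g \<Longrightarrow> \<tau> (vsplit K v P n e) = \<tau> (vsplit K w Q m f)"
begin

definition Val :: "wgraph \<Rightarrow> bool \<Rightarrow> bool" where
  "Val K b \<longleftrightarrow> (\<forall>G. exps g K G \<longrightarrow> card (edges G) = 3 * g - 3 \<longrightarrow> \<tau> G = b)"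

end

locale face_step = face_invariant +
  fixes K :: wgraph
  assumes K: "K \<in> PT g" and codim: "card (edges K) + 1 < 3 * g - 3"
    and IH: "\<And>L. L \<in> PT g \<Longrightarrow> card (edges K) < card (edges L) \<Longrightarrow> \<exists>b. Val L b"
begin

text \<open>Used only for graphs with more edges than \<open>K\<close>, where the induction
  hypothesis provides a value; it is unique since a trivalent expansion exists.\<close>

definition val :: "wgraph \<Rightarrow> bool" where
  "val L = (SOME b. Val L b)"

lemma val_top:
  assumes "card (edges K) < card (edges L)" "exps g L G" "card (edges G) = 3 * g - 3"
  shows "\<tau> G = val L"
proof -
  have "Val L (val L)" unfolding val_def using IH exps_PT assms by (metis someI_ex)
  then show ?thesis using assms by (simp add: Val_def)
qed

lemma exps_edges: "exps g L M \<Longrightarrow> card (edges L) \<le> card (edges M)"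
proof (induction rule: exps.induct)
  case (exps_step K v P n e G)
  then show ?case using PTD(6)[OF exps_step.hyps(1)] by (simp add: splits_def)
qed simp

text \<open>A trivalent expansion of \<open>M\<close> is also one of \<open>L\<close>.\<close>

lemma val_exps:
  assumes "card (edges K) < card (edges L)" "exps g L M"
  shows "val L = val M"
proof -
  obtain G where G: "exps g M G" "card (edges G) = 3 * g - 3"
    using exps_top[of M g] exps_PT[OF assms(2)] g2 by blast
  have "card (edges K) < card (edges M)" using exps_edges[OF assms(2)] assms(1) by simp
  then show ?thesis using val_top[OF _ G] val_top[OF assms(1) exps_trans[OF assms(2) G(1)] G(2)] by simp
qed

lemma val_iso:
  assumes L: "L \<in> PT g" "card (edges K) < card (edges L)" and M: "M \<in> PT g" and i: "giso L M"
  shows "val L = val M"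
proof -
  obtain G where G: "exps g L G" "card (edges G) = 3 * g - 3" using exps_top[OF L(1) g2] by blast
  obtain H where H: "exps g M H" "giso G H" using exps_giso[OF G(1) i M] by blast
  have "card (edges M) = card (edges L)" "card (edges H) = card (edges G)"
    using i H(2) by (auto simp: giso_def bij_betw_same_card)
  then have "\<tau> G = val L" "\<tau> H = val M" using val_top[OF L(2) G] val_top[OF _ H(1)] L G by auto
  moreover have "\<tau> G = \<tau> H" using inv_iso exps_PT G H by blast
  ultimately show ?thesis by simp
qed

text \<open>Fixed fresh names make a splitting a function of \<open>v\<close> and \<open>P\<close>
  alone. The second pair of names is for splitting twice.\<close>

definition n0 where "n0 = (SOME n. n \<notin> verts K)"
definition n1 where "n1 = (SOME n. n \<notin> insert n0 (verts K))"
definition e0 where "e0 = (SOME e. e \<notin> edges K)"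
definition e1 where "e1 = (SOME e. e \<notin> insert e0 (edges K))"

lemma fresh_names: "n0 \<notin> verts K" "e0 \<notin> edges K" "n1 \<notin> verts K" "e1 \<notin> edges K" "n0 \<noteq> n1" "e0 \<noteq> e1"
proof -
  show "n0 \<notin> verts K" unfolding n0_def by (rule someI_ex[OF fresh[OF PTD(5)[OF K]]])
  show "e0 \<notin> edges K" unfolding e0_def by (rule someI_ex[OF fresh[OF PTD(6)[OF K]]])
  have "n1 \<notin> insert n0 (verts K)" unfolding n1_def
    by (rule someI_ex[OF fresh]) (simp add: PTD(5)[OF K])
  then show "n1 \<notin> verts K" "n0 \<noteq> n1" by auto
  have "e1 \<notin> insert e0 (edges K)" unfolding e1_def
    by (rule someI_ex[OF fresh]) (simp add: PTD(6)[OF K])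
  then show "e1 \<notin> edges K" "e0 \<noteq> e1" by auto
qed

definition good :: "nat \<Rightarrow> (nat \<times> bool) set \<Rightarrow> bool" where
  "good v P \<longleftrightarrow> v \<in> verts K \<and> P \<subseteq> halves K v \<and> \<not> badh K v P"

definition q :: "nat \<Rightarrow> (nat \<times> bool) set \<Rightarrow> bool" where
  "q v P = val (vsplit K v P n0 e0)"

lemma card_edges_vsplit: "e \<notin> edges K \<Longrightarrow> card (edges K) < card (edges (vsplit K v P n e))"
  using PTD(6)[OF K] by simp

lemma good_PT:
  assumes "good v P" "n \<notin> verts K" "e \<notin> edges K"
  shows "vsplit K v P n e \<in> PT g" "splits K v P n e"
  using assms PT_vsplit[OF K, of v P n e] by (simp_all add: good_def splits_def)

lemma q_any:
  assumes "good v P" "n \<notin> verts K" "e \<notin> edges K"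
  shows "val (vsplit K v P n e) = q v P"
proof -
  let ?f = "id(n := n0)" and ?k = "id(e := e0)"
  have P: "P \<subseteq> halves K v" "v \<in> verts K" using assms(1) by (auto simp: good_def)
  have nn: "hend K (x, s) \<noteq> n" if "x \<in> edges K" for x s
    using PTD(1)[OF K] that assms(2) by (auto simp: wf_graph_def hend_def)
  have Pe: "(e, s) \<notin> P" "(e0, s) \<notin> P" for s using P assms(3) fresh_names(2) by (auto simp: halves_def)
  have "bij_betw ?f (verts K) (verts K)"
    using assms(2) by (subst bij_betw_cong[of _ _ id]) auto
  then have "bij_betw ?f (insert n (verts K)) (insert n0 (verts K))"
    using notIn_Un_bij_betw[of n "verts K" ?f "verts K"] assms(2) fresh_names(1) by simp
  moreover have "bij_betw ?k (edges K) (edges K)"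
    using assms(3) by (subst bij_betw_cong[of _ _ id]) auto
  then have "bij_betw ?k (insert e (edges K)) (insert e0 (edges K))"
    using notIn_Un_bij_betw[of e "edges K" ?k "edges K"] assms(3) fresh_names(2) by simp
  moreover have "hend (vsplit K v P n0 e0) (?k x, s) = ?f (hend (vsplit K v P n e) (x, s \<noteq> False))"
    if x: "x \<in> insert e (edges K)" for x s
  proof (cases "x = e")
    case True
    then show ?thesis using P assms(2) by (cases s) auto
  next
    case False
    then have "x \<in> edges K" "x \<noteq> e0" using x fresh_names(2) by auto
    then show ?thesis using False nn[of x True] nn[of x False] by (cases s) auto
  qed
  ultimately have "giso (vsplit K v P n e) (vsplit K v P n0 e0)"
    by (intro gisoI[of ?f _ _ ?k "\<lambda>_. False"]) simp_all
  then show ?thesis unfolding q_def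
    using val_iso good_PT assms fresh_names card_edges_vsplit by metis
qed

lemma q_swap:
  assumes "good v P" shows "q v P = q v (halves K v - P)" "good v (halves K v - P)"
proof -
  have P: "v \<in> verts K" "P \<subseteq> halves K v" "\<not> badh K v P" using assms by (auto simp: good_def)
  interpret tec_vertex K v using PTD[OF K] P(1) by unfold_locales
  have "L - (L - P) = P" using P(2) by blast
  then have "\<not> badh K v (L - P)" using bad_compl[of "L - P"] P(3) by auto
  then show g: "good v (halves K v - P)" using P(1) by (auto simp: good_def)
  have s: "splits K v P n0 e0" by (rule good_PT(2)[OF assms fresh_names(1,2)])
  show "q v P = q v (halves K v - P)" unfolding q_def
    using val_iso[OF good_PT(1)[OF assms fresh_names(1,2)] card_edges_vsplit[OF fresh_names(2)]
        good_PT(1)[OF g fresh_names(1,2)] giso_vsplit_swap[OF PTD(1)[OF K] s]] .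
qed

text \<open>Splitting off both sets gives a common refinement, and \<open>val\<close> does not
  change under expansion. Contracting the first new edge in this refinement shows that
  \<open>Q\<close> alone is good.\<close>

lemma q_compatible:
  assumes P: "good v P" and Q: "w \<in> verts K" "Q \<subseteq> halves K w" "P \<inter> Q = {}"
    and b: "\<not> badh (vsplit K v P n0 e0) w Q"
  shows "q v P = q w Q" "good w Q"
proof -
  note fn = fresh_names
  let ?H = "vsplit K v P n0 e0"
  have Pv: "v \<in> verts K" "P \<subseteq> halves K v" using P by (auto simp: good_def)
  have H: "?H \<in> PT g" by (rule good_PT(1)[OF P fn(1,2)])
  have "Q \<subseteq> halves ?H w"
  proof (cases "w = v")
    case True
    then show ?thesis using Q halves_vsplit_same[OF PTD(1)[OF K] Pv fn(1,2)] by auto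
  next
    case False
    then show ?thesis using Q(2) halves_vsplit_other[OF PTD(1)[OF K] Pv Q(1) False fn(1,2)] by simp
  qed
  then have s: "splits ?H w Q n1 e1" using Q fn by (simp add: splits_def)
  have L: "vsplit ?H w Q n1 e1 \<in> PT g" using PT_vsplit[OF H s] b by simp
  have PQ: "(e1, s) \<notin> P" "(e0, s) \<notin> Q" for s using Pv(2) Q(2) fn(2,4) by (auto simp: halves_def)
  have eq: "vsplit ?H w Q n1 e1 = vsplit (vsplit K w Q n1 e1) v P n0 e0"
    by (rule vsplit_commute) (use fn Q(3) PQ in auto)
  have s1: "splits K w Q n1 e1" using Q fn by (simp add: splits_def)
  let ?J = "vsplit K w Q n1 e1"
  have wfJ: "wf_graph ?J" by (rule vsplit_wf[OF PTD(1)[OF K] Q(1)])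
  have "P \<subseteq> halves ?J v"
  proof (cases "v = w")
    case True
    then show ?thesis using Pv Q halves_vsplit_same[OF PTD(1)[OF K] Q(1,2) fn(3,4)] by auto
  next
    case False
    then show ?thesis using Pv(2) halves_vsplit_other[OF PTD(1)[OF K] Q(1,2) Pv(1) False fn(3,4)] by simp
  qed
  then have s2: "splits ?J v P n0 e0" using Pv fn by (simp add: splits_def)
  have "three_edge_connected ?J"
    using tec_of_vsplit[OF wfJ s2] PTD(2)[OF L] eq by simp
  then have "\<not> badh K w Q" using tec_vsplit[OF PTD(1,2)[OF K] Q(1,2) fn(3,4)] by simp
  then show gQ: "good w Q" using Q by (simp add: good_def)
  have J: "?J \<in> PT g" by (rule good_PT(1)[OF gQ fn(3,4)])
  have "val ?H = val (vsplit ?H w Q n1 e1)"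
    by (rule val_exps[OF card_edges_vsplit[OF fn(2)] exps_step[OF H s L exps_refl[OF L]]])
  moreover have "val ?J = val (vsplit ?J v P n0 e0)"
    by (rule val_exps[OF card_edges_vsplit[OF fn(4)] exps_step[OF J s2 _ exps_refl]]) (use L eq in simp_all)
  ultimately show "q v P = q w Q" using eq q_any[OF gQ fn(3,4)] by (simp add: q_def)
qed

lemma q_disjoint:
  assumes "good v P" "good v Q" "P \<inter> Q = {}" "\<not> closedh K v (P \<union> Q)"
  shows "q v P = q v Q"
proof -
  have "\<not> badh (vsplit K v P n0 e0) v Q"
    using good_vsplit_disjoint[OF PTD(1)[OF K] _ _ _ fresh_names(1,2) assms(3) _ assms(4)] assms(1,2)
    by (simp add: good_def)
  then show ?thesis using q_compatible(1)[OF assms(1) _ _ assms(3)] assms(2) by (simp add: good_def)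
qed

text \<open>Both pairs are linked to a third pair that is disjoint from and compatible with each of
  them. From valence 6 on such a pair always exists; at valence 5 there is just one candidate, which
  may be bad.\<close>

lemma q_overlap:
  assumes v: "v \<in> verts K" and d: "5 \<le> card (halves K v)"
    and ab: "good v {a, b}" and ac: "good v {a, c}" and n: "a \<noteq> b" "a \<noteq> c" "b \<noteq> c"
  shows "q v {a, b} = q v {a, c}"
proof -
  interpret tec_vertex K v using PTD[OF K] v by unfold_locales
  have L: "a \<in> L" "b \<in> L" "c \<in> L" and g: "\<not> badh K v {a, b}" "\<not> badh K v {a, c}"
    using ab ac by (auto simp: good_def)
  have fin: "finite L" by (rule finite_halves[OF wf])
  have *: ?thesis if xy: "x \<in> L - {a, b, c}" "y \<in> L - {a, b, c}" "x \<noteq> y" "\<not> badh K v {x, y}"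
    "\<not> closedh K v {a, b, x, y}" "\<not> closedh K v {a, c, x, y}" for x y
  proof -
    have gxy: "good v {x, y}" using xy v by (simp add: good_def)
    have u: "{a, b} \<union> {x, y} = {a, b, x, y}" "{a, c} \<union> {x, y} = {a, c, x, y}" by auto
    have "q v {a, b} = q v {x, y}"
      by (rule q_disjoint[OF ab gxy, unfolded u(1), OF _ xy(5)]) (use xy in auto)
    moreover have "q v {a, c} = q v {x, y}"
      by (rule q_disjoint[OF ac gxy, unfolded u(2), OF _ xy(6)]) (use xy in auto)
    ultimately show ?thesis by simp
  qed
  show ?thesis
  proof (cases "6 \<le> card L")
    case True
    then obtain x y where "x \<in> L - {a, b, c}" "y \<in> L - {a, b, c}" "x \<noteq> y" "\<not> badh K v {x, y}"
      "\<not> closedh K v {a, b, x, y}" "\<not> closedh K v {a, c, x, y}"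
      using exists_compatible_pair[OF True L n g] by blast
    then show ?thesis by (rule *)
  next
    case False
    then have "card (L - {a, b, c}) = 2" using d L n fin by (simp add: card_Diff_subset)
    then obtain x y where xy: "L - {a, b, c} = {x, y}" "x \<noteq> y" by (auto simp: card_2_iff)
    have Leq: "L = {a, b, c, x, y}" using xy L by blast
    have m: "x \<in> L" "y \<in> L" "x \<notin> {a, b, c}" "y \<notin> {a, b, c}" using xy by blast+
    \<comment> \<open>At valence 5 the complement of a quadruple is a singleton, so quadruples are
      never closed and disjoint good pairs are always linked.\<close>
    have nc: "\<not> closedh K v P" if "P \<subseteq> L" "L - P = {z}" for P z
      using closed_complement[OF _ that] not_closed_single[of z] that by blast
    have nc1: "\<not> closedh K v {a, b, x, y}" by (rule nc[of _ c]) (use Leq m n xy in auto)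
    have nc2: "\<not> closedh K v {a, c, x, y}" by (rule nc[of _ b]) (use Leq m n xy in auto)
    show ?thesis
    proof (cases "badh K v {x, y}")
      case False
      then show ?thesis using *[of x y] nc1 nc2 m xy by blast
    next
      case True
      \<comment> \<open>The detour \<open>{a, b}\<close>, \<open>{c, x}\<close>,
        \<open>{b, y}\<close>, \<open>{a, c}\<close> is a path in the Petersen graph, whose vertices
        are the pairs in a 5-element set, joined when disjoint. If \<open>{c, x}\<close> or
        \<open>{b, y}\<close> were bad, then together with the bad pair \<open>{x, y}\<close> it
        would give a closed triple, whose complement \<open>{a, b}\<close> or \<open>{a, c}\<close>
        is good.\<close>
      have "\<not> badh K v {c, x}"
      proof
        assume "badh K v {c, x}"
        then have "closedh K v {x, y, c}" using True m L xy
          by (intro bad_bad_closed) (auto simp: insert_commute)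
        moreover have "L - {x, y, c} = {a, b}" using Leq m n xy by auto
        ultimately have "closedh K v {a, b}" using closed_complement m L by blast
        then show False using closed_imp_bad g by blast
      qed
      then have cx: "good v {c, x}" using v m L by (simp add: good_def)
      have "\<not> badh K v {b, y}"
      proof
        assume "badh K v {b, y}"
        then have "closedh K v {y, x, b}" using True m L xy
          by (intro bad_bad_closed) (auto simp: insert_commute)
        moreover have "L - {y, x, b} = {a, c}" using Leq m n xy by auto
        ultimately have "closedh K v {a, c}" using closed_complement m L by blast
        then show False using closed_imp_bad g by blast
      qed
      then have by': "good v {b, y}" using v m L by (simp add: good_def)
      have "\<not> closedh K v ({a, b} \<union> {c, x})" by (rule nc[of _ y]) (use Leq m n xy in auto)
      then have "q v {a, b} = q v {c, x}" by (intro q_disjoint[OF ab cx]) (use m n in auto)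
      moreover have "\<not> closedh K v ({c, x} \<union> {b, y})" by (rule nc[of _ a]) (use Leq m n xy in auto)
      then have "q v {c, x} = q v {b, y}" by (intro q_disjoint[OF cx by']) (use m n xy in auto)
      moreover have "\<not> closedh K v ({b, y} \<union> {a, c})" by (rule nc[of _ x]) (use Leq m n xy in auto)
      then have "q v {b, y} = q v {a, c}" by (intro q_disjoint[OF by' ac]) (use m n in auto)
      ultimately show ?thesis by simp
    qed
  qed
qed

text \<open>Disjoint pairs are joined through \<open>{a, c}\<close> or \<open>{a, d}\<close>: if
  both were bad, \<open>{a, c, d}\<close> would be closed and hence \<open>{c, d}\<close>
  bad.\<close>

lemma q_pairs:
  assumes v: "v \<in> verts K" and d: "5 \<le> card (halves K v)"
    and ab: "good v {a, b}" "a \<noteq> b" and cd: "good v {c, d}" "c \<noteq> d"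
  shows "q v {a, b} = q v {c, d}"
proof -
  interpret tec_vertex K v using PTD[OF K] v by unfold_locales
  have L: "a \<in> L" "b \<in> L" "c \<in> L" "d \<in> L" and g: "\<not> badh K v {a, b}" "\<not> badh K v {c, d}"
    using ab cd by (auto simp: good_def)
  note ov = q_overlap[OF v \<open>5 \<le> card (halves K v)\<close>]
  have ov': "q v {x, y} = q v {x, z}" if "good v {x, y}" "good v {x, z}" "x \<noteq> y" "x \<noteq> z" for x y z
    using ov[OF that] by (cases "y = z") auto
  have c: "{a, b} = {b, a}" "{c, d} = {d, c}" by auto
  consider "a = c" | "a = d" | "b = c" | "b = d" | "a \<noteq> c" "a \<noteq> d" "b \<noteq> c" "b \<noteq> d" by blast
  then show ?thesis
  proof cases
    case 1 then show ?thesis using ov'[of a b d] ab cd by simp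
  next
    case 2 then show ?thesis using ov'[of a b c] ab cd c by simp
  next
    case 3 then show ?thesis using ov'[of b a d] ab cd c by simp
  next
    case 4 then show ?thesis using ov'[of b a c] ab cd c by simp
  next
    case 5
    show ?thesis
    proof (cases "badh K v {a, c}")
      case False
      then have ac: "good v {a, c}" "{a, c} = {c, a}" using v L by (auto simp: good_def)
      then show ?thesis using ov'[of a b c] ov'[of c a d] ab cd 5 by simp
    next
      case True
      have "\<not> badh K v {a, d}"
      proof
        assume "badh K v {a, d}"
        then have "closedh K v {a, c, d}" using True L 5 cd by (intro bad_bad_closed) auto
        moreover have "{a, c, d} = {c, d, a}" by auto
        ultimately show False using closed_triple_bad[of c d a] g by simp
      qed
      then have ad: "good v {a, d}" "{a, d} = {d, a}" using v L by (auto simp: good_def)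
      then show ?thesis using ov'[of a b d] ov'[of d a c] ab cd c 5 by simp
    qed
  qed
qed

text \<open>If at least three half-edges stay at \<open>v\<close>, then \<open>v\<close> still has
  valence at least 4 after the splitting, because the new edge counts too. A second good splitting
  there, by a pair that avoids the new edge, is compatible with \<open>P\<close>.\<close>

lemma q_pair_of_good:
  assumes P: "good v P"
  obtains x y where "good v {x, y}" "x \<noteq> y" "q v P = q v {x, y}"
proof -
  have Pv: "v \<in> verts K" "P \<subseteq> halves K v" "\<not> badh K v P" using P by (auto simp: good_def)
  interpret tec_vertex K v using PTD[OF K] Pv(1) by unfold_locales
  have fin: "finite L" by (rule finite_halves[OF wf])
  have two: "2 \<le> card (L - P)" by (rule good_card(2)[OF Pv(2,3)])
  show ?thesis
  proof (cases "card (L - P) = 2")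
    case True
    then obtain x y where "L - P = {x, y}" "x \<noteq> y" by (auto simp: card_2_iff)
    then show ?thesis using that q_swap[OF P] by metis
  next
    case False
    let ?H = "vsplit K v P n0 e0"
    have H: "?H \<in> PT g" by (rule good_PT(1)[OF P fresh_names(1,2)])
    interpret H: tec_vertex ?H v using PTD[OF H] Pv(1) by unfold_locales auto
    have hs: "halves ?H v = insert (e0, True) (L - P)"
      by (rule halves_vsplit_same[OF wf Pv(1,2) fresh_names(1,2)])
    have e0: "(e0, True) \<notin> L" using fresh_names(2) by (auto simp: halves_def)
    have c4: "4 \<le> card (halves ?H v)" using False two e0 fin unfolding hs by simp
    have "L - P \<noteq> {}" using two by (metis card.empty not_numeral_le_zero)
    then obtain x where x: "x \<in> L - P" by blast
    have "x \<in> halves ?H v" "(e0, True) \<in> halves ?H v" "x \<noteq> (e0, True)"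
      using x e0 unfolding hs by auto
    from H.exists_good_partner[OF c4 this]
    obtain y where y: "y \<in> halves ?H v" "y \<noteq> x" "y \<noteq> (e0, True)" "\<not> badh ?H v {x, y}" by blast
    have "y \<in> L - P" using y(1,3) hs by blast
    then have "{x, y} \<subseteq> L" "P \<inter> {x, y} = {}" using x by blast+
    then have "q v P = q v {x, y}" "good v {x, y}"
      using q_compatible[OF P Pv(1) _ _ y(4)] by blast+
    then show ?thesis using that[of x y] y(2) by simp
  qed
qed

lemma q_valence5:
  assumes "5 \<le> card (halves K v)" "good v P" "good v Q"
  shows "q v P = q v Q"
proof -
  obtain a b where ab: "good v {a, b}" "a \<noteq> b" "q v P = q v {a, b}" by (rule q_pair_of_good[OF assms(2)])
  obtain c d where cd: "good v {c, d}" "c \<noteq> d" "q v Q = q v {c, d}" by (rule q_pair_of_good[OF assms(3)])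
  have "v \<in> verts K" using assms(2) by (simp add: good_def)
  then show ?thesis using q_pairs[OF _ assms(1) ab(1,2) cd(1,2)] ab(3) cd(3) by simp
qed

text \<open>At a vertex of valence 4 only one of the three splittings can be bad, so two good splittings
  at another vertex admit a common compatible splitting here.\<close>

lemma q_two_vertices:
  assumes P: "good v P" "good v P'" and w: "w \<in> verts K" "w \<noteq> v" "4 \<le> card (halves K w)"
  shows "q v P = q v P'" "\<exists>T. good w T \<and> q v P = q w T"
proof -
  have disj: "A \<inter> B = {}" if "A \<subseteq> halves K v" "B \<subseteq> halves K w" for A B
    using that w(2) by (auto simp: halves_def)
  have loc: "tec_vertex (vsplit K v A n0 e0) w" "halves (vsplit K v A n0 e0) w = halves K w" if "good v A" for A
  proof -
    have A: "v \<in> verts K" "A \<subseteq> halves K v" using that by (auto simp: good_def)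
    show "tec_vertex (vsplit K v A n0 e0) w"
      using PTD[OF good_PT(1)[OF that fresh_names(1,2)]] w(1) by unfold_locales auto
    show "halves (vsplit K v A n0 e0) w = halves K w"
      by (rule halves_vsplit_other[OF PTD(1)[OF K] A w(1,2) fresh_names(1,2)])
  qed
  have ex: "\<exists>T. good w T \<and> q v A = q w T" if A: "good v A" for A
  proof -
    have "w \<in> verts (vsplit K v A n0 e0)" "4 \<le> card (halves (vsplit K v A n0 e0) w)"
      using w loc(2)[OF A] by simp_all
    then obtain T where T: "T \<subseteq> halves (vsplit K v A n0 e0) w" "\<not> badh (vsplit K v A n0 e0) w T"
      by (rule PT_good_split[OF good_PT(1)[OF A fresh_names(1,2)]])
    have "T \<subseteq> halves K w" using T(1) loc(2)[OF A] by simp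
    then show ?thesis using q_compatible[OF A w(1) _ _ T(2)] disj[of A T] A by (auto simp: good_def)
  qed
  show "\<exists>T. good w T \<and> q v P = q w T" by (rule ex[OF P(1)])
  show "q v P = q v P'"
  proof (cases "5 \<le> card (halves K w)")
    case True
    then show ?thesis using ex[OF P(1)] ex[OF P(2)] q_valence5 by metis
  next
    case False
    then have c4: "card (halves K w) = 4" using w(3) by simp
    have fin: "finite (halves K w)" by (rule finite_halves[OF PTD(1)[OF K]])
    have "halves K w \<noteq> {}" using c4 by auto
    then obtain h where h: "h \<in> halves K w" by blast
    have "card (halves K w - {h}) = 3" using c4 h fin by simp
    then obtain x y z where xyz: "halves K w - {h} = {x, y, z}" "x \<noteq> y" "x \<noteq> z" "y \<noteq> z"
      unfolding card_3_iff by metis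
    have m: "x \<in> halves K w" "y \<in> halves K w" "z \<in> halves K w" "h \<noteq> x" "h \<noteq> y" "h \<noteq> z"
      using xyz(1) by blast+
    have un: "\<not> (badh (vsplit K v A n0 e0) w {h, s} \<and> badh (vsplit K v A n0 e0) w {h, t})"
      if "good v A" "s \<in> halves K w" "t \<in> halves K w" "h \<noteq> s" "h \<noteq> t" "s \<noteq> t" for A s t
      using tec_vertex.bad_partner_unique_4[OF loc(1)[OF that(1)], of h s t] loc(2)[OF that(1)] c4 h that
      by auto
    \<comment> \<open>The pairs of \<open>h\<close> with \<open>x\<close>, \<open>y\<close>,
      \<open>z\<close> represent the three splittings of a vertex of valence 4. After splitting
      along \<open>P\<close> or \<open>P'\<close> at most one of them is bad, so one is good in both
      cases.\<close>
    have "\<exists>s\<in>{x, y, z}. \<not> badh (vsplit K v P n0 e0) w {h, s} \<and> \<not> badh (vsplit K v P' n0 e0) w {h, s}"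
      using un[OF P(1), of x y] un[OF P(1), of x z] un[OF P(1), of y z]
        un[OF P(2), of x y] un[OF P(2), of x z] un[OF P(2), of y z] m xyz(2-4) by blast
    then obtain s where s: "s \<in> {x, y, z}" "\<not> badh (vsplit K v P n0 e0) w {h, s}"
      "\<not> badh (vsplit K v P' n0 e0) w {h, s}" by blast
    have hs: "{h, s} \<subseteq> halves K w" using s(1) m h by blast
    have Ps: "P \<subseteq> halves K v" "P' \<subseteq> halves K v" using P by (auto simp: good_def)
    have "q v P = q w {h, s}" by (rule q_compatible(1)[OF P(1) w(1) hs disj[OF Ps(1) hs] s(2)])
    moreover have "q v P' = q w {h, s}" by (rule q_compatible(1)[OF P(2) w(1) hs disj[OF Ps(2) hs] s(3)])
    ultimately show ?thesis by simp
  qed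
qed

lemma good_valence:
  assumes "good v P" shows "4 \<le> card (halves K v)" "v \<in> verts K"
proof -
  have P: "v \<in> verts K" "P \<subseteq> halves K v" "\<not> badh K v P" using assms by (auto simp: good_def)
  interpret tec_vertex K v using PTD[OF K] P(1) by unfold_locales
  have "card L = card P + card (L - P)"
    using card_Un_disjoint[of P "L - P"] P(2) finite_halves[OF wf, of v] finite_subset
    by (metis Diff_disjoint Un_Diff_cancel2 Un_absorb2 finite_Diff Un_commute)
  then show "4 \<le> card L" using good_card[OF P(2,3)] by linarith
  show "v \<in> verts K" by (rule P(1))
qed

text \<open>Codimension two is needed when \<open>v = w\<close> has valence 4: its own splittings
  are pairwise incompatible and must be linked through another vertex with spare valence.\<close>

lemma q_const:
  assumes P: "good v P" and Q: "good w Q"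
  shows "q v P = q w Q"
proof (cases "v = w")
  case True
  show ?thesis
  proof (cases "5 \<le> card (halves K v)")
    case d: True
    show ?thesis using q_valence5[OF d P] Q True by simp
  next
    case False
    then have c: "card (halves K v) \<le> 4" by simp
    obtain u where "u \<in> verts K" "u \<noteq> v" "4 \<le> card (halves K u)"
      by (rule PT_codim_two[OF K g2 codim good_valence(2)[OF P] c])
    then show ?thesis using q_two_vertices(1)[OF P, of Q u] Q True by simp
  qed
next
  case False
  then obtain T where "good w T" "q v P = q w T"
    using q_two_vertices(2)[OF P P good_valence(2)[OF Q] _ good_valence(1)[OF Q]] by blast
  moreover have "q w T = q w Q" if "good w T" for T
    by (rule q_two_vertices(1)[OF that Q good_valence(2)[OF P] False good_valence(1)[OF P]])
  ultimately show ?thesis by simp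
qed

lemma Val_K: "\<exists>b. Val K b"
proof -
  have "\<exists>b. \<forall>v P. good v P \<longrightarrow> q v P = b" using q_const by metis
  then obtain b where b: "\<And>v P. good v P \<Longrightarrow> q v P = b" by blast
  have "\<tau> G = b" if G: "exps g K G" "card (edges G) = 3 * g - 3" for G
    using G(1)
  proof cases
    case exps_refl
    then show ?thesis using G(2) codim by simp
  next
    case (exps_step v P n e)
    have s: "v \<in> verts K" "P \<subseteq> halves K v" "n \<notin> verts K" "e \<notin> edges K"
      using exps_step(2) by (auto simp: splits_def)
    have "\<not> badh K v P" using PT_vsplit[OF K exps_step(2)] exps_step(3) by simp
    then have g: "good v P" using s by (simp add: good_def)
    have "\<tau> G = val (vsplit K v P n e)"
      by (rule val_top[OF card_edges_vsplit[OF s(4)] exps_step(4) G(2)])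
    then show ?thesis using q_any[OF g s(3,4)] b[OF g] by simp
  qed
  then show ?thesis unfolding Val_def by blast
qed

end

context face_invariant
begin

text \<open>In codimension zero a graph has no proper expansion, and codimension one is the facet
  hypothesis; the actual induction starts at codimension two.\<close>

lemma Val_exists: "K \<in> PT g \<Longrightarrow> \<exists>b. Val K b"
proof (induction "3 * g - 3 - card (edges K)" arbitrary: K rule: less_induct)
  case less
  note K = less.prems
  consider "card (edges K) = 3 * g - 3" | "card (edges K) + 1 = 3 * g - 3" | "card (edges K) + 1 < 3 * g - 3"
    using PT_edges_le[OF K g2] by linarith
  then show ?case
  proof cases
    case 1
    have "G = K" if "exps g K G" for G using that
    proof cases
      case (exps_step v P n e)
      have "card (edges (vsplit K v P n e)) = Suc (card (edges K))"
        using exps_step(2) PTD(6)[OF K] by (simp add: splits_def)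
      then show ?thesis using PT_edges_le[OF exps_step(3) g2] 1 by simp
    qed simp
    then show ?thesis unfolding Val_def by metis
  next
    case 2
    have top: "\<exists>v P n e. splits K v P n e \<and> G = vsplit K v P n e \<and> G \<in> PT g"
      if G: "exps g K G" "card (edges G) = 3 * g - 3" for G using G(1)
    proof cases
      case exps_refl then show ?thesis using G 2 by simp
    next
      case (exps_step v P n e)
      have c: "card (edges (vsplit K v P n e)) = 3 * g - 3"
        using exps_step(2) PTD(6)[OF K] 2 by (simp add: splits_def)
      have "G = vsplit K v P n e" using exps_step(4)
      proof cases
        case (exps_step w Q m f)
        have "card (edges (vsplit (vsplit K v P n e) w Q m f)) = Suc (card (edges (vsplit K v P n e)))"
          using exps_step(2) PTD(6)[OF exps_step(1)] by (simp add: splits_def)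
        then show ?thesis using PT_edges_le[OF exps_step(3) g2] c by simp
      qed simp
      then show ?thesis using exps_step by blast
    qed
    have "\<tau> G = \<tau> H" if "exps g K G" "card (edges G) = 3 * g - 3" "exps g K H" "card (edges H) = 3 * g - 3" for G H
      using top[OF that(1,2)] top[OF that(3,4)] inv_face[OF K 2] by metis
    then show ?thesis unfolding Val_def by metis
  next
    case 3
    interpret face_step g \<tau> K
    proof unfold_locales
      fix L assume "L \<in> PT g" "card (edges K) < card (edges L)"
      then show "\<exists>b. Val L b" using PT_edges_le[OF \<open>L \<in> PT g\<close> g2] by (intro less.hyps) auto
    qed (use K 3 in auto)
    show ?thesis by (rule Val_K)
  qed
qed

theorem invariant_const:
  assumes G: "G \<in> PT g" "card (edges G) = 3 * g - 3" and H: "H \<in> PT g" "card (edges H) = 3 * g - 3"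
  shows "\<tau> G = \<tau> H"
proof -
  obtain R v where R: "exps g R G" "verts R = {v}" using exps_single_vertex[OF G(1)] by blast
  obtain S w where S: "exps g S H" "verts S = {w}" using exps_single_vertex[OF H(1)] by blast
  have RS: "R \<in> PT g" "S \<in> PT g" using exps_PT R(1) S(1) by blast+
  \<comment> \<open>The two roses may use different names, so the expansion from \<open>S\<close> to
    \<open>H\<close> is copied to \<open>R\<close>.\<close>
  have "giso S R" by (rule giso_single_vertex[OF RS(2) S(2) RS(1) R(2)])
  then obtain H' where H': "exps g R H'" "giso H H'" using exps_giso[OF S(1) _ RS(1)] by blast
  have "card (edges H') = 3 * g - 3" using H'(2) H(2) by (auto simp: giso_def bij_betw_same_card)
  moreover obtain b where "Val R b" using Val_exists[OF RS(1)] by blast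
  ultimately have "\<tau> G = b" "\<tau> H' = b" using R(1) G(2) H'(1) by (auto simp: Val_def)
  moreover have "\<tau> H = \<tau> H'" using inv_iso[OF H(1) _ H(2) H'(2)] exps_PT[OF H'(1)] by blast
  ultimately show ?thesis by simp
qed

end

section \<open>Weighted contractions\<close>

lemma curve_iso_iff:
  "curve_iso (G, l) (H, m) \<longleftrightarrow> (\<exists>f k. bij_betw f (verts G) (verts H) \<and> bij_betw k (edges G) (edges H) \<and>
     (\<forall>e\<in>edges G. ends H (k e) = f ` ends G e \<and> m (k e) = l e) \<and> (\<forall>v\<in>verts G. wt H (f v) = wt G v))"
  by (simp add: curve_iso_def)

lemma curve_iso_refl: "curve_iso c c"
proof (cases c)
  case (Pair G l)
  then show ?thesis unfolding Pair curve_iso_iff by (intro exI[of _ id]) auto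
qed

lemma curve_iso_trans:
  assumes "curve_iso c d" "curve_iso d e" shows "curve_iso c e"
proof -
  obtain G l H m K p where c: "c = (G, l)" "d = (H, m)" "e = (K, p)" by (metis surj_pair)
  obtain f k where f: "bij_betw f (verts G) (verts H)" and k: "bij_betw k (edges G) (edges H)"
    and h: "\<And>e. e \<in> edges G \<Longrightarrow> ends H (k e) = f ` ends G e \<and> m (k e) = l e"
    and w: "\<And>v. v \<in> verts G \<Longrightarrow> wt H (f v) = wt G v"
    using assms(1) unfolding c curve_iso_iff by blast
  obtain f' k' where f': "bij_betw f' (verts H) (verts K)" and k': "bij_betw k' (edges H) (edges K)"
    and h': "\<And>e. e \<in> edges H \<Longrightarrow> ends K (k' e) = f' ` ends H e \<and> p (k' e) = m e"
    and w': "\<And>v. v \<in> verts H \<Longrightarrow> wt K (f' v) = wt H v"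
    using assms(2) unfolding c curve_iso_iff by blast
  have e: "k e \<in> edges H" if "e \<in> edges G" for e using k that by (auto simp: bij_betw_def)
  have v: "f e \<in> verts H" if "e \<in> verts G" for e using f that by (auto simp: bij_betw_def)
  show ?thesis unfolding c curve_iso_iff
    using bij_betw_trans[OF f f'] bij_betw_trans[OF k k'] h h' w w' e v
    by (intro exI[of _ "f' \<circ> f"] exI[of _ "k' \<circ> k"]) (simp add: image_comp)
qed

lemma curve_iso_sym:
  assumes "curve_iso c d" "wf_graph (fst c)" shows "curve_iso d c"
proof -
  obtain G l H m where c: "c = (G, l)" "d = (H, m)" by (metis surj_pair)
  obtain f k where f: "bij_betw f (verts G) (verts H)" and k: "bij_betw k (edges G) (edges H)"
    and h: "\<And>e. e \<in> edges G \<Longrightarrow> ends H (k e) = f ` ends G e \<and> m (k e) = l e"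
    and w: "\<And>v. v \<in> verts G \<Longrightarrow> wt H (f v) = wt G v"
    using assms(1) unfolding c curve_iso_iff by blast
  let ?f = "inv_into (verts G) f" and ?k = "inv_into (edges G) k"
  have 1: "ends G (?k e) = ?f ` ends H e \<and> l (?k e) = m e" if e: "e \<in> edges H" for e
  proof -
    have k1: "?k e \<in> edges G" "k (?k e) = e"
      using k e by (auto simp: bij_betw_def inv_into_into f_inv_into_f)
    have "ends G (?k e) \<subseteq> verts G" using assms(2) k1(1) by (auto simp: c wf_graph_def ends_def)
    then have "?f ` f ` ends G (?k e) = ends G (?k e)"
      using f by (intro inv_into_image_cancel) (auto simp: bij_betw_def)
    then show ?thesis using h[OF k1(1)] k1(2) by simp
  qed
  have 2: "wt G (?f v) = wt H v" if "v \<in> verts H" for v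
    using w[of "?f v"] f that by (simp add: bij_betw_def inv_into_into f_inv_into_f)
  show ?thesis unfolding c curve_iso_iff
    using bij_betw_inv_into[OF f] bij_betw_inv_into[OF k] 1 2
    by (intro exI[of _ ?f] exI[of _ ?k]) simp
qed

lemma cls_eqI:
  assumes "curve_iso c d" "wf_graph (fst c)" shows "cls c = cls d"
  using curve_iso_trans curve_iso_sym[OF assms] assms(1) unfolding cls_def by blast

lemma cls_self: "c \<in> cls c"
  by (simp add: cls_def curve_iso_refl)

text \<open>The part of \<open>ccontr\<close> that does not involve lengths, with the contracted set
  and the two maps made explicit. The truncated difference in the weight is the first Betti number
  of the fibre.\<close>

definition contracts :: "wgraph \<Rightarrow> nat set \<Rightarrow> wgraph \<Rightarrow> (nat \<Rightarrow> nat) \<Rightarrow> (nat \<Rightarrow> nat) \<Rightarrow> bool" where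
  "contracts G S H f k \<longleftrightarrow> f ` verts G = verts H \<and> bij_betw k (edges G - S) (edges H) \<and>
     (\<forall>e\<in>edges G - S. ends H (k e) = f ` ends G e) \<and>
     (\<forall>e\<in>S. f (src G e) = f (tgt G e)) \<and>
     (\<forall>v\<in>verts H. (\<forall>a\<in>{u \<in> verts G. f u = v}. \<forall>b\<in>{u \<in> verts G. f u = v}.
          (a, b) \<in> (adj_on G {e \<in> S. f (src G e) = v})\<^sup>*) \<and>
        wt H v = (card {e \<in> S. f (src G e) = v} + 1 - card {u \<in> verts G. f u = v}) +
          (\<Sum>u\<in>{u \<in> verts G. f u = v}. wt G u))"

lemma contractsD:
  assumes "contracts G S H f k"
  shows "f ` verts G = verts H" "bij_betw k (edges G - S) (edges H)"
    "\<And>e. e \<in> edges G \<Longrightarrow> e \<notin> S \<Longrightarrow> ends H (k e) = f ` ends G e"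
    "\<And>e. e \<in> S \<Longrightarrow> f (src G e) = f (tgt G e)"
    "\<And>v a b. v \<in> verts H \<Longrightarrow> a \<in> verts G \<Longrightarrow> b \<in> verts G \<Longrightarrow> f a = v \<Longrightarrow> f b = v \<Longrightarrow>
      (a, b) \<in> (adj_on G {e \<in> S. f (src G e) = v})\<^sup>*"
    "\<And>v. v \<in> verts H \<Longrightarrow> wt H v = (card {e \<in> S. f (src G e) = v} + 1 - card {u \<in> verts G. f u = v}) +
          (\<Sum>u\<in>{u \<in> verts G. f u = v}. wt G u)"
  using assms by (simp_all add: contracts_def)

lemma ccontr_iff:
  "ccontr (G, l) (H, m) \<longleftrightarrow> wf_graph H \<and> (\<exists>f k. contracts G {e \<in> edges G. l e = 0} H f k \<and>
     (\<forall>e\<in>edges G - {e \<in> edges G. l e = 0}. m (k e) = l e) \<and> (\<forall>e. e \<notin> edges H \<longrightarrow> m e = 0))"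
  unfolding ccontr_def contracts_def Let_def prod.case ball_conj_distrib
  by (rule iffI; elim conjE exE; intro conjI exI; assumption)

lemma contracts_adj:
  assumes "(a, b) \<in> (adj_on G A)\<^sup>*" "\<And>e. e \<in> A \<Longrightarrow> f (src G e) = f (tgt G e)"
  shows "f a = f b"
  using assms(1)
proof (induction rule: rtrancl_induct)
  case (step y z)
  then obtain e where "e \<in> A" "{y, z} = {src G e, tgt G e}" by (auto simp: adj_on_def)
  then show ?case using step.IH assms(2)[of e] by (auto simp: doubleton_eq_iff)
qed simp

text \<open>The fibres of both vertex maps are the connected components formed by the edges in
  \<open>S\<close>, so each map factors through the other. Hence \<open>pt\<close> does not depend
  on the choice in its definition.\<close>

lemma contracts_unique:
  assumes wf: "wf_graph G" and S: "S \<subseteq> edges G"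
    and H: "contracts G S H f k" "\<And>e. e \<in> edges G - S \<Longrightarrow> m (k e) = l e"
    and H': "contracts G S H' f' k'" "\<And>e. e \<in> edges G - S \<Longrightarrow> m' (k' e) = l e"
  shows "curve_iso (H, m) (H', m')"
proof -
  have k: "bij_betw k (edges G - S) (edges H)" "bij_betw k' (edges G - S) (edges H')"
    and im: "f ` verts G = verts H" "f' ` verts G = verts H'"
    using H(1) H'(1) by (auto simp: contracts_def)
  have cS: "f (src G e) = f (tgt G e)" "f' (src G e) = f' (tgt G e)" if "e \<in> S" for e
    using H(1) H'(1) that by (simp_all add: contracts_def)
  have ker: "f u = f w \<longleftrightarrow> f' u = f' w" if uw: "u \<in> verts G" "w \<in> verts G" for u w
  proof
    assume e: "f u = f w"
    have "f u \<in> verts H" using im uw by blast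
    then have "(u, w) \<in> (adj_on G {e \<in> S. f (src G e) = f u})\<^sup>*"
      by (rule contractsD(5)[OF H(1) _ uw refl e[symmetric]])
    then show "f' u = f' w" by (rule contracts_adj) (simp add: cS(2))
  next
    assume e: "f' u = f' w"
    have "f' u \<in> verts H'" using im uw by blast
    then have "(u, w) \<in> (adj_on G {e \<in> S. f' (src G e) = f' u})\<^sup>*"
      by (rule contractsD(5)[OF H'(1) _ uw refl e[symmetric]])
    then show "f u = f w" by (rule contracts_adj) (simp add: cS(1))
  qed
  define \<alpha> where "\<alpha> = f' \<circ> inv_into (verts G) f"
  have \<alpha>: "\<alpha> (f u) = f' u" if u: "u \<in> verts G" for u
  proof -
    have "inv_into (verts G) f (f u) \<in> verts G" "f (inv_into (verts G) f (f u)) = f u"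
      using u by (auto simp: inv_into_into f_inv_into_f)
    then show ?thesis using ker[OF _ u] by (simp add: \<alpha>_def)
  qed
  define \<beta> where "\<beta> = k' \<circ> inv_into (edges G - S) k"
  have \<beta>: "\<beta> (k e) = k' e" if "e \<in> edges G - S" for e
    using k(1) that by (simp add: \<beta>_def bij_betw_def)
  have "inj_on \<alpha> (verts H)"
  proof (rule inj_onI)
    fix x y assume "x \<in> verts H" "y \<in> verts H" "\<alpha> x = \<alpha> y"
    then show "x = y" using \<alpha> ker im(1) by (metis imageE)
  qed
  moreover have "\<alpha> ` verts H = verts H'"
    using \<alpha> by (simp add: im[symmetric] image_image)
  ultimately have b1: "bij_betw \<alpha> (verts H) (verts H')" by (simp add: bij_betw_def)
  have b2: "bij_betw \<beta> (edges H) (edges H')"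
    unfolding \<beta>_def by (rule bij_betw_trans[OF bij_betw_inv_into[OF k(1)] k(2)])
  have "ends H' (\<beta> y) = \<alpha> ` ends H y \<and> m' (\<beta> y) = m y" if "y \<in> edges H" for y
  proof -
    have "y \<in> k ` (edges G - S)" using k(1) that by (simp add: bij_betw_def)
    then obtain e where e: "e \<in> edges G - S" "y = k e" by blast
    have "ends G e \<subseteq> verts G" using wf e by (auto simp: wf_graph_def ends_def)
    then have "\<alpha> ` f ` ends G e = f' ` ends G e" using \<alpha> by (auto simp: image_image intro!: image_cong)
    moreover have "ends H (k e) = f ` ends G e" "ends H' (k' e) = f' ` ends G e"
      using contractsD(3)[OF H(1)] contractsD(3)[OF H'(1)] e(1) by simp_all
    ultimately show ?thesis using \<beta>[OF e(1)] H(2)[OF e(1)] H'(2)[OF e(1)] e(2) by simp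
  qed
  moreover have "wt H' (\<alpha> v) = wt H v" if v: "v \<in> verts H" for v
  proof -
    obtain u where u: "u \<in> verts G" "v = f u" using v im(1) by blast
    have F: "{w \<in> verts G. f' w = \<alpha> v} = {w \<in> verts G. f w = v}"
      using ker u \<alpha> by auto
    have "src G e \<in> verts G" if "e \<in> S" for e using wf S that by (auto simp: wf_graph_def)
    then have SF: "{e \<in> S. f' (src G e) = \<alpha> v} = {e \<in> S. f (src G e) = v}"
      using ker u \<alpha> by auto
    have "\<alpha> v \<in> verts H'" using b1 v by (auto simp: bij_betw_def)
    then show ?thesis using contractsD(6)[OF H(1) v] contractsD(6)[OF H'(1)] F SF by simp
  qed
  ultimately show ?thesis unfolding curve_iso_iff using b1 b2
    by (intro exI[of _ \<alpha>] exI[of _ \<beta>]) simp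
qed

lemma contracts_exists:
  assumes wf: "wf_graph G" and S: "S \<subseteq> edges G"
  shows "\<exists>H f. wf_graph H \<and> edges H = edges G - S \<and> contracts G S H f id"
proof -
  let ?R = "adj_on G S"
  have sym: "sym (?R\<^sup>*)" by (rule sym_rtrancl) (auto simp: sym_def adj_on_def)
  \<comment> \<open>The predicate depends only on the component of \<open>u\<close>, so one
    representative is chosen per component.\<close>
  define f where "f u = (SOME w. w \<in> verts G \<and> (u, w) \<in> ?R\<^sup>*)" for u
  have f1: "f u \<in> verts G" "(u, f u) \<in> ?R\<^sup>*" if "u \<in> verts G" for u
    using someI[of "\<lambda>w. w \<in> verts G \<and> (u, w) \<in> ?R\<^sup>*" u] that by (auto simp: f_def)
  have f2: "f u = f w" if uw: "(u, w) \<in> ?R\<^sup>*" for u w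
  proof -
    have "(w, u) \<in> ?R\<^sup>*" using sym uw by (rule symD)
    then have "(u, x) \<in> ?R\<^sup>* \<longleftrightarrow> (w, x) \<in> ?R\<^sup>*" for x using uw rtrancl_trans by metis
    then show ?thesis by (simp add: f_def)
  qed
  have fS: "f (src G e) = f (tgt G e)" if "e \<in> S" for e
    using that by (intro f2 r_into_rtrancl) (auto simp: adj_on_def)
  have path: "(a, b) \<in> (adj_on G {e \<in> S. f (src G e) = v})\<^sup>*" if "(a, b) \<in> ?R\<^sup>*" "f a = v" for a b v
    using that(1)
  proof (induction rule: rtrancl_induct)
    case (step y z)
    have "f y = v" using f2[OF step.hyps(1)] that(2) by simp
    moreover obtain e where e: "e \<in> S" "(y, z) = (src G e, tgt G e) \<or> (y, z) = (tgt G e, src G e)"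
      using step.hyps(2) by (auto simp: adj_on_def)
    ultimately have "f (src G e) = v" using fS[OF e(1)] by auto
    then have "(y, z) \<in> adj_on G {e \<in> S. f (src G e) = v}" using e by (auto simp: adj_on_def)
    then show ?case using step.IH by (rule rtrancl_into_rtrancl[rotated])
  qed simp
  have fib: "(a, b) \<in> ?R\<^sup>*" if "a \<in> verts G" "b \<in> verts G" "f a = f b" for a b
  proof -
    have "(f b, b) \<in> ?R\<^sup>*" by (rule symD[OF sym f1(2)[OF that(2)]])
    then show ?thesis using f1(2)[OF that(1)] that(3) by (metis rtrancl_trans)
  qed
  define H where "H = \<lparr>verts = f ` verts G, edges = edges G - S, src = f \<circ> src G, tgt = f \<circ> tgt G,
    wt = (\<lambda>v. (card {e \<in> S. f (src G e) = v} + 1 - card {u \<in> verts G. f u = v}) +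
          (\<Sum>u\<in>{u \<in> verts G. f u = v}. wt G u))\<rparr>"
  have "wf_graph H" using wf by (simp add: wf_graph_def H_def)
  moreover have "contracts G S H f id"
    unfolding contracts_def
  proof (intro conjI ballI)
    fix v a b assume ab: "a \<in> {u \<in> verts G. f u = v}" "b \<in> {u \<in> verts G. f u = v}"
    show "(a, b) \<in> (adj_on G {e \<in> S. f (src G e) = v})\<^sup>*" by (rule path[OF fib]) (use ab in auto)
  qed (use fS in \<open>auto simp: H_def ends_def\<close>)
  moreover have "edges H = edges G - S" by (simp add: H_def)
  ultimately show ?thesis by blast
qed

lemma mem_cut_ends: "e \<in> cut G X \<longleftrightarrow> e \<in> edges G \<and> (\<exists>a\<in>ends G e. a \<in> X) \<and> (\<exists>a\<in>ends G e. a \<notin> X)"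
  by (auto simp: cut_def ends_def)

text \<open>An edge that crosses the preimage of \<open>Y\<close> has ends with different images, so
  it is not contracted and \<open>k\<close> maps it into the cut of \<open>Y\<close>.\<close>

lemma contracts_cut:
  assumes wf: "wf_graph G" and wfH: "wf_graph H" and c: "contracts G S H f k"
  shows "card (cut G {u \<in> verts G. f u \<in> Y}) \<le> card (cut H Y)"
proof (rule card_inj_on_le)
  let ?X = "{u \<in> verts G. f u \<in> Y}"
  have vs: "src G e \<in> verts G" "tgt G e \<in> verts G" if "e \<in> edges G" for e
    using wf that by (auto simp: wf_graph_def)
  have sub: "e \<in> edges G - S" if e: "e \<in> cut G ?X" for e
  proof -
    have "e \<in> edges G" "(src G e \<in> ?X) \<noteq> (tgt G e \<in> ?X)" using e by (auto simp: cut_def)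
    then have "f (src G e) \<noteq> f (tgt G e)" using vs[of e] by auto
    then show ?thesis using contractsD(4)[OF c, of e] \<open>e \<in> edges G\<close> by auto
  qed
  show "inj_on k (cut G ?X)"
    by (rule inj_on_subset[OF bij_betw_imp_inj_on[OF contractsD(2)[OF c]]]) (use sub in blast)
  show "k ` cut G ?X \<subseteq> cut H Y"
  proof
    fix y assume "y \<in> k ` cut G ?X"
    then obtain e where e: "e \<in> cut G ?X" "y = k e" by blast
    note eS = sub[OF e(1)]
    have E: "ends H y = f ` ends G e" "y \<in> edges H"
      using contractsD(3)[OF c, of e] bij_betwE[OF contractsD(2)[OF c]] eS e(2) by auto
    obtain a b where ab: "a \<in> ends G e" "a \<in> ?X" "b \<in> ends G e" "b \<notin> ?X"
      using e(1) unfolding mem_cut_ends by blast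
    have "b \<in> verts G" using ab(3) eS vs[of e] by (auto simp: ends_def)
    then have "f a \<in> Y" "f b \<notin> Y" using ab by auto
    then show "y \<in> cut H Y" unfolding mem_cut_ends using E ab by auto
  qed
  show "finite (cut H Y)" by (rule finite_cut[OF wfH])
qed

lemma contracts_preimage:
  assumes c: "contracts G S H f k" and Y: "Y \<subseteq> verts H" "Y \<noteq> {}" "Y \<noteq> verts H"
  shows "{u \<in> verts G. f u \<in> Y} \<noteq> {}" "{u \<in> verts G. f u \<in> Y} \<noteq> verts G"
proof -
  have im: "f ` verts G = verts H" using c by (simp add: contracts_def)
  obtain y where y: "y \<in> Y" using Y(2) by blast
  then have "y \<in> f ` verts G" using Y(1) im by blast
  then obtain u where "u \<in> verts G" "y = f u" by blast
  then have "u \<in> {u \<in> verts G. f u \<in> Y}" using y by simp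
  then show "{u \<in> verts G. f u \<in> Y} \<noteq> {}" by blast
  obtain z where z: "z \<in> verts H" "z \<notin> Y" using Y(1,3) by blast
  then have "z \<in> f ` verts G" using im by blast
  then obtain w where "w \<in> verts G" "z = f w" by blast
  then have "w \<in> verts G" "w \<notin> {u \<in> verts G. f u \<in> Y}" using z by simp_all
  then show "{u \<in> verts G. f u \<in> Y} \<noteq> verts G" by blast
qed

lemma contracts_tec:
  assumes wf: "wf_graph G" and wfH: "wf_graph H" and c: "contracts G S H f k" and t: "three_edge_connected G"
  shows "three_edge_connected H"
proof -
  have "3 \<le> card (cut H Y)" if Y: "Y \<subseteq> verts H" "Y \<noteq> {}" "Y \<noteq> verts H" for Y
  proof -
    have "3 \<le> card (cut G {u \<in> verts G. f u \<in> Y})"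
      using t tec_iff_cut[OF wf] contracts_preimage[OF c Y] by simp
    then show ?thesis using contracts_cut[OF wf wfH c, of Y] by simp
  qed
  moreover have "verts H \<noteq> {}" using c t by (auto simp: contracts_def three_edge_connected_def)
  ultimately show ?thesis using tec_iff_cut[OF wfH] by simp
qed

lemma contracts_connected:
  assumes wf: "wf_graph G" and wfH: "wf_graph H" and c: "contracts G S H f k" and t: "connected_graph G"
  shows "connected_graph H"
proof -
  have "cut H Y \<noteq> {}" if Y: "Y \<subseteq> verts H" "Y \<noteq> {}" "Y \<noteq> verts H" for Y
  proof -
    have "cut G {u \<in> verts G. f u \<in> Y} \<noteq> {}"
      using t connected_iff_cut[OF wf] contracts_preimage[OF c Y] by simp
    then show ?thesis using contracts_cut[OF wf wfH c, of Y] finite_cut[OF wf] by auto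
  qed
  moreover have "verts H \<noteq> {}" using c t connected_iff_cut[OF wf] by (auto simp: contracts_def)
  ultimately show ?thesis using connected_iff_cut[OF wfH] by simp
qed

text \<open>A spanning tree is grown one crossing edge at a time.\<close>

lemma connected_card_le:
  assumes wf: "wf_graph G" and F: "F \<subseteq> verts G" "F \<noteq> {}" and A: "A \<subseteq> edges G"
    "\<And>e. e \<in> A \<Longrightarrow> src G e \<in> F \<and> tgt G e \<in> F"
    and conn: "\<And>a b. a \<in> F \<Longrightarrow> b \<in> F \<Longrightarrow> (a, b) \<in> (adj_on G A)\<^sup>*"
  shows "card F \<le> card A + 1"
proof -
  have fin: "finite F" "finite A" using finite_subset[OF F(1)] finite_subset[OF A(1)] wf by (simp_all add: wf_graph_def)
  have "\<exists>T B. T \<subseteq> F \<and> B \<subseteq> A \<and> card T = Suc n \<and> card B = n \<and> (\<forall>e\<in>B. src G e \<in> T \<and> tgt G e \<in> T)"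
    if "Suc n \<le> card F" for n
    using that
  proof (induction n)
    case 0
    obtain r where "r \<in> F" using F by blast
    then show ?case by (intro exI[of _ "{r}"] exI[of _ "{}"]) simp
  next
    case (Suc n)
    then obtain T B where T: "T \<subseteq> F" "B \<subseteq> A" "card T = Suc n" "card B = n"
      "\<And>e. e \<in> B \<Longrightarrow> src G e \<in> T \<and> tgt G e \<in> T" by (metis Suc_leD)
    have finT: "finite T" "finite B" using finite_subset[OF T(1) fin(1)] finite_subset[OF T(2) fin(2)] by simp_all
    have "T \<noteq> F" using T(3) Suc.prems by auto
    then obtain b where b: "b \<in> F" "b \<notin> T" using T(1) by blast
    have "T \<noteq> {}" using T(3) by auto
    then obtain a where a: "a \<in> T" by blast
    have "(a, b) \<in> (adj_on G A)\<^sup>*" using conn a b T(1) by blast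
    then have "cut G T \<inter> A \<noteq> {}" using reach_cut[OF _ A(1) _ a] b(2) by blast
    then obtain e where e: "e \<in> A" "(src G e \<in> T) \<noteq> (tgt G e \<in> T)" by (auto simp: cut_def)
    then have eB: "e \<notin> B" using T(5) by blast
    let ?z = "if src G e \<in> T then tgt G e else src G e"
    have z: "?z \<in> F" "?z \<notin> T" using A(2)[OF e(1)] e(2) by auto
    show ?case
    proof (intro exI conjI)
      show "insert ?z T \<subseteq> F" "insert e B \<subseteq> A" using z T e by auto
      show "card (insert ?z T) = Suc (Suc n)" "card (insert e B) = Suc n"
        using z(2) eB finT T(3,4) by simp_all
      show "\<forall>x\<in>insert e B. src G x \<in> insert ?z T \<and> tgt G x \<in> insert ?z T"
        using T(5) e(2) by auto
    qed
  qed
  moreover have "Suc (card F - 1) \<le> card F" using F(2) fin(1) by (simp add: Suc_leI card_gt_0_iff)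
  ultimately obtain B where "B \<subseteq> A" "card B = card F - 1" by blast
  then show ?thesis using card_mono[OF fin(2), of B] by linarith
qed

lemma connected_verts_le:
  assumes "wf_graph G" "connected_graph G"
  shows "card (verts G) \<le> card (edges G) + 1"
  using assms by (intro connected_card_le) (auto simp: connected_graph_def conn_with_def wf_graph_def)

text \<open>Connectedness of the fibre makes the truncated subtraction in the weight of
  \<open>v\<close> exact.\<close>

lemma contracts_fiber:
  assumes wf: "wf_graph G" and S: "S \<subseteq> edges G" and c: "contracts G S H f k" and v: "v \<in> verts H"
  shows "card {u \<in> verts G. f u = v} \<le> card {e \<in> S. f (src G e) = v} + 1"
proof (rule connected_card_le[OF wf, where F = "{u \<in> verts G. f u = v}" and A = "{e \<in> S. f (src G e) = v}"])
  have "v \<in> f ` verts G" using contractsD(1)[OF c] v by simp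
  then show "{u \<in> verts G. f u = v} \<noteq> {}" by auto
  show "(a, b) \<in> (adj_on G {e \<in> S. f (src G e) = v})\<^sup>*"
    if "a \<in> {u \<in> verts G. f u = v}" "b \<in> {u \<in> verts G. f u = v}" for a b
    by (rule contractsD(5)[OF c v]) (use that in simp_all)
  show "src G e \<in> {u \<in> verts G. f u = v} \<and> tgt G e \<in> {u \<in> verts G. f u = v}"
    if "e \<in> {e \<in> S. f (src G e) = v}" for e
  proof -
    have e: "e \<in> S" "f (src G e) = v" using that by simp_all
    then have "e \<in> edges G" using S by blast
    then show ?thesis using wf contractsD(4)[OF c e(1)] e(2) by (simp add: wf_graph_def)
  qed
qed (use S in auto)

text \<open>Over all fibres the Betti numbers add up to \<open>|S| + |V(H)| - |V(G)|\<close>, which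
  is exactly the loss in the Betti number of the graph.\<close>

lemma contracts_genus:
  assumes wf: "wf_graph G" and wfH: "wf_graph H" and S: "S \<subseteq> edges G" and c: "contracts G S H f k"
    and conn: "connected_graph G"
  shows "genus H = genus G"
proof -
  let ?F = "\<lambda>v. {u \<in> verts G. f u = v}" and ?S = "\<lambda>v. {e \<in> S. f (src G e) = v}"
  have fin: "finite (verts G)" "finite (edges G)" "finite (verts H)" "finite S"
    using wf wfH finite_subset[OF S] by (simp_all add: wf_graph_def)
  have im: "f ` verts G = verts H" using c by (simp add: contracts_def)
  have "(\<Sum>v\<in>verts H. card (?F v)) = card (\<Union>v\<in>verts H. ?F v)"
    using fin by (subst card_UN_disjoint) auto
  also have "(\<Union>v\<in>verts H. ?F v) = verts G" using im by auto
  finally have 1: "(\<Sum>v\<in>verts H. card (?F v)) = card (verts G)" .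
  have "(\<Sum>v\<in>verts H. card (?S v)) = card (\<Union>v\<in>verts H. ?S v)"
    using fin by (subst card_UN_disjoint) auto
  also have "(\<Union>v\<in>verts H. ?S v) = S"
  proof -
    have "f (src G e) \<in> verts H" if "e \<in> S" for e
      using wf S that im by (metis imageI subsetD wf_graph_def)
    then show ?thesis by auto
  qed
  finally have 2: "(\<Sum>v\<in>verts H. card (?S v)) = card S" .
  have 3: "(\<Sum>v\<in>verts H. \<Sum>u\<in>?F v. wt G u) = (\<Sum>u\<in>verts G. wt G u)"
    using sum.group[OF fin(1,3), of f "wt G"] im by simp
  have "(\<Sum>v\<in>verts H. wt H v) + card (verts G) = (\<Sum>v\<in>verts H. wt H v + card (?F v))"
    by (simp add: sum.distrib 1)
  also have "\<dots> = (\<Sum>v\<in>verts H. card (?S v) + 1 + (\<Sum>u\<in>?F v. wt G u))"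
  proof (rule sum.cong[OF refl])
    fix v assume v: "v \<in> verts H"
    then have "wt H v = (card (?S v) + 1 - card (?F v)) + (\<Sum>u\<in>?F v. wt G u)"
      by (rule contractsD(6)[OF c])
    then show "wt H v + card (?F v) = card (?S v) + 1 + (\<Sum>u\<in>?F v. wt G u)"
      using contracts_fiber[OF wf S c v] by simp
  qed
  also have "\<dots> = card S + card (verts H) + (\<Sum>u\<in>verts G. wt G u)"
    by (simp only: sum.distrib 2 3) simp
  finally have W: "(\<Sum>v\<in>verts H. wt H v) + card (verts G) = card S + card (verts H) + (\<Sum>u\<in>verts G. wt G u)" .
  have "card (edges H) = card (edges G - S)" using c by (auto simp: contracts_def bij_betw_same_card)
  then have E: "card (edges H) + card S = card (edges G)"
    using S fin card_mono[OF fin(2) S] by (simp add: card_Diff_subset)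
  have "card (verts G) \<le> card (edges G) + 1" by (rule connected_verts_le[OF wf conn])
  moreover have "card (verts H) \<le> card (edges H) + 1"
    by (rule connected_verts_le[OF wfH contracts_connected[OF wf wfH c conn]])
  ultimately show ?thesis using W E unfolding genus_def b1_def by linarith
qed

lemma ends_flip:
  assumes "ends H y = f ` ends G e"
  shows "\<exists>b. \<forall>s. hend H (y, s) = f (hend G (e, s \<noteq> b))"
proof -
  have "{src H y, tgt H y} = {f (src G e), f (tgt G e)}" using assms by (simp add: ends_def)
  then consider "src H y = f (src G e)" "tgt H y = f (tgt G e)" | "src H y = f (tgt G e)" "tgt H y = f (src G e)"
    by (auto simp: doubleton_eq_iff)
  then show ?thesis
  proof cases
    case 1 then show ?thesis by (intro exI[of _ False]) (simp add: hend_def)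
  next
    case 2 then show ?thesis by (intro exI[of _ True]) (simp add: hend_def)
  qed
qed

text \<open>A vertex of weight 0 comes from a tree of vertices of weight 0. With \<open>F\<close>
  vertices it has at least \<open>3F\<close> half-edges and uses up \<open>2(F - 1)\<close> of them;
  the remaining \<open>F + 2 \<ge> 3\<close> survive.\<close>

lemma contracts_stable:
  assumes wf: "wf_graph G" and wfH: "wf_graph H" and S: "S \<subseteq> edges G" and c: "contracts G S H f k"
    and st: "stable_graph G"
  shows "stable_graph H"
  unfolding stable_graph_def
proof (intro ballI impI)
  fix v assume v: "v \<in> verts H" and w0: "wt H v = 0"
  let ?F = "{u \<in> verts G. f u = v}" and ?S = "{e \<in> S. f (src G e) = v}"
  have fin: "finite ?F" "finite ?S" using wf finite_subset[OF S] by (simp_all add: wf_graph_def)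
  have "wt H v = (card ?S + 1 - card ?F) + (\<Sum>u\<in>?F. wt G u)"
    by (rule contractsD(6)[OF c v])
  then have z: "card ?S + 1 - card ?F = 0" "(\<Sum>u\<in>?F. wt G u) = 0" using w0 by linarith+
  have F: "card ?F = card ?S + 1" using z(1) contracts_fiber[OF wf S c v] by linarith
  have wF: "wt G u = 0" if "u \<in> ?F" for u using z(2) that by (simp only: sum_eq_0_iff[OF fin(1)])
  have "\<exists>b. \<forall>s. hend H (k e, s) = f (hend G (e, s \<noteq> b))" if "e \<in> edges G - S" for e
    by (rule ends_flip) (use contractsD(3)[OF c] that in blast)
  then obtain b where b: "\<And>e s. e \<in> edges G - S \<Longrightarrow> hend H (k e, s) = f (hend G (e, s \<noteq> b e))" by metis
  define D where "D = {h. fst h \<in> edges G - S \<and> f (hend G h) = v}"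
  define j where "j h = (k (fst h), snd h \<noteq> b (fst h))" for h
  have "card D \<le> card (halves H v)"
  proof (rule card_inj_on_le[of j])
    have k: "bij_betw k (edges G - S) (edges H)" using c by (simp add: contracts_def)
    show "inj_on j D"
    proof (rule inj_onI)
      fix x y assume xy: "x \<in> D" "y \<in> D" "j x = j y"
      then have "fst x = fst y" using k by (auto simp: D_def j_def bij_betw_def inj_on_def)
      then show "x = y" using xy(3) by (cases x, cases y) (auto simp: j_def)
    qed
    show "j ` D \<subseteq> halves H v"
    proof
      fix z assume "z \<in> j ` D"
      then obtain h where h: "h \<in> D" "z = j h" by blast
      have e: "fst h \<in> edges G - S" "f (hend G h) = v" using h by (auto simp: D_def)
      have "(snd h \<noteq> b (fst h)) \<noteq> b (fst h) \<longleftrightarrow> snd h" by auto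
      then have "hend H z = v" using b[OF e(1), of "snd h \<noteq> b (fst h)"] e(2) h(2) by (simp add: j_def)
      moreover have "k (fst h) \<in> edges H" using k e(1) by (auto simp: bij_betw_def)
      ultimately show "z \<in> halves H v" using h(2) by (simp add: halves_def j_def)
    qed
    show "finite (halves H v)" by (rule finite_halves[OF wfH])
  qed
  moreover have "3 * card ?F \<le> card D + 2 * card ?S"
  proof -
    have "(\<Sum>u\<in>?F. 3) \<le> (\<Sum>u\<in>?F. card (halves G u))"
    proof (rule sum_mono)
      fix u assume u: "u \<in> ?F"
      then have "3 \<le> valence G u" using st wF[OF u] by (simp add: stable_graph_def)
      then show "3 \<le> card (halves G u)" by (simp add: card_halves[OF wf])
    qed
    also have "(\<Sum>u\<in>?F. card (halves G u)) = card (\<Union>u\<in>?F. halves G u)"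
      using fin finite_halves[OF wf] by (subst card_UN_disjoint) (auto simp: halves_def)
    also have "\<dots> \<le> card (D \<union> ?S \<times> UNIV)"
    proof (rule card_mono)
      show "finite (D \<union> ?S \<times> UNIV)"
        by (rule finite_subset[of _ "edges G \<times> UNIV"]) (use S wf in \<open>auto simp: D_def wf_graph_def\<close>)
      show "(\<Union>u\<in>?F. halves G u) \<subseteq> D \<union> ?S \<times> UNIV"
      proof
        fix h assume "h \<in> (\<Union>u\<in>?F. halves G u)"
        then have h: "fst h \<in> edges G" "f (hend G h) = v" by (auto simp: halves_def)
        have "f (src G (fst h)) = v" if "fst h \<in> S"
          using c that h(2) by (cases "snd h") (auto simp: contracts_def hend_def)
        then show "h \<in> D \<union> ?S \<times> UNIV" using h by (cases h) (auto simp: D_def)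
      qed
    qed
    also have "\<dots> \<le> card D + card (?S \<times> (UNIV :: bool set))" by (rule card_Un_le)
    finally show ?thesis by (simp add: card_cartesian_product mult.commute)
  qed
  ultimately show "3 \<le> valence H v" using F by (simp add: card_halves[OF wfH, symmetric])
qed

lemma SGD:
  assumes "G \<in> SG g" shows "wf_graph G" "connected_graph G" "stable_graph G" "genus G = g"
  using assms by (auto simp: SG_def)

lemma contracts_SG:
  assumes G: "G \<in> SG g" and wfH: "wf_graph H" and S: "S \<subseteq> edges G" and c: "contracts G S H f k"
  shows "H \<in> SG g"
  using contracts_connected[OF SGD(1)[OF G] wfH c SGD(2)[OF G]]
    contracts_stable[OF SGD(1)[OF G] wfH S c SGD(3)[OF G]]
    contracts_genus[OF SGD(1)[OF G] wfH S c SGD(2)[OF G]] wfH SGD(4)[OF G] by (simp add: SG_def)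

lemma pt_eq:
  assumes wf: "wf_graph G" and c: "ccontr (G, l) c"
  shows "pt G l = cls c"
proof -
  have "ccontr (G, l) (SOME c. ccontr (G, l) c)" using c by (rule someI)
  moreover obtain H m where H: "c = (H, m)" by (cases c)
  moreover obtain H' m' where H': "(SOME c. ccontr (G, l) c) = (H', m')" by (cases "SOME c. ccontr (G, l) c")
  ultimately have c1: "ccontr (G, l) (H, m)" "ccontr (G, l) (H', m')" using c by simp_all
  obtain f k where f: "contracts G {e \<in> edges G. l e = 0} H f k"
     "\<And>e. e \<in> edges G - {e \<in> edges G. l e = 0} \<Longrightarrow> m (k e) = l e" using c1(1) unfolding ccontr_iff by blast
  obtain f' k' where f': "contracts G {e \<in> edges G. l e = 0} H' f' k'"
     "\<And>e. e \<in> edges G - {e \<in> edges G. l e = 0} \<Longrightarrow> m' (k' e) = l e" using c1(2) unfolding ccontr_iff by blast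
  have "curve_iso (H', m') (H, m)"
    by (rule contracts_unique[OF wf _ f'(1) _ f(1), where l = l]) (simp_all add: f'(2) f(2))
  moreover have "wf_graph H'" using c1(2) unfolding ccontr_iff by blast
  ultimately show ?thesis unfolding pt_def H' H using cls_eqI by simp
qed

lemma pt_point:
  assumes G: "G \<in> SG g" and l: "l \<in> orth G"
  obtains H m where "pt G l = cls (H, m)" "H \<in> SG g" "m \<in> pos_orth H"
    "card (edges H) = card {e \<in> edges G. l e \<noteq> 0}" "three_edge_connected G \<longrightarrow> three_edge_connected H"
proof -
  let ?S = "{e \<in> edges G. l e = 0}"
  have wf: "wf_graph G" by (rule SGD(1)[OF G])
  have S: "?S \<subseteq> edges G" by auto
  obtain H f where H: "wf_graph H" "edges H = edges G - ?S" "contracts G ?S H f id"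
    using contracts_exists[OF wf S] by blast
  have l0: "l e = 0" if "e \<notin> edges H" for e using l that H(2) by (auto simp: orth_def)
  then have "ccontr (G, l) (H, l)" unfolding ccontr_iff using H(1,3) by (intro conjI exI[of _ f] exI[of _ id]) auto
  then have "pt G l = cls (H, l)" by (rule pt_eq[OF wf])
  moreover have "H \<in> SG g" by (rule contracts_SG[OF G H(1) S H(3)])
  moreover have "l \<in> pos_orth H" using l H(2) by (auto simp: orth_def pos_orth_def less_le)
  moreover have "edges G - ?S = {e \<in> edges G. l e \<noteq> 0}" by auto
  then have "card (edges H) = card {e \<in> edges G. l e \<noteq> 0}" using H(2) by simp
  moreover have "three_edge_connected G \<longrightarrow> three_edge_connected H" using contracts_tec[OF wf H(1,3)] by simp
  ultimately show ?thesis by (rule that)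
qed

lemma pt_pos:
  assumes wf: "wf_graph G" and l: "l \<in> pos_orth G"
  shows "pt G l = cls (G, l)"
proof (rule pt_eq[OF wf])
  have "{e \<in> edges G. l e = 0} = {}" using l by (auto simp: pos_orth_def)
  moreover have "{u. u = v \<and> u \<in> verts G} = {v}" "{u \<in> verts G. u = v} = {v}" if "v \<in> verts G" for v using that by auto
  then have "contracts G {} G id id" by (auto simp: contracts_def)
  ultimately have "contracts G {e \<in> edges G. l e = 0} G id id" by (simp only:)
  then show "ccontr (G, l) (G, l)" unfolding ccontr_iff
    using wf l by (intro conjI exI[of _ id]) (auto simp: pos_orth_def)
qed

lemma contracts_merge:
  assumes wf: "wf_graph G" and e: "e \<in> edges G" "src G e \<noteq> tgt G e"
    and K: "verts K = verts G - {tgt G e}" "edges K = edges G - {e}"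
    "\<And>x. x \<in> edges K \<Longrightarrow> src K x = (if src G x = tgt G e then src G e else src G x)"
    "\<And>x. x \<in> edges K \<Longrightarrow> tgt K x = (if tgt G x = tgt G e then src G e else tgt G x)"
    "\<And>u. u \<in> verts K \<Longrightarrow> wt K u = (if u = src G e then wt G (src G e) + wt G (tgt G e) else wt G u)"
  shows "contracts G {e} K (\<lambda>u. if u = tgt G e then src G e else u) id"
proof -
  define a b where "a = src G e" and "b = tgt G e"
  have ab: "a \<in> verts G" "b \<in> verts G" "a \<noteq> b"
    using e wf by (auto simp: a_def b_def wf_graph_def)
  let ?f = "\<lambda>u. if u = b then a else u"
  have "contracts G {e} K ?f id" unfolding contracts_def
  proof (intro conjI ballI)
    show "?f ` verts G = verts K" using ab K(1) by (auto simp: b_def[symmetric])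
    show "bij_betw id (edges G - {e}) (edges K)" using K(2) by simp
    show "ends K (id x) = ?f ` ends G x" if "x \<in> edges G - {e}" for x
      using that K(2) K(3)[of x] K(4)[of x] by (simp add: ends_def a_def b_def)
    show "?f (src G x) = ?f (tgt G x)" if "x \<in> {e}" for x using that by (simp add: a_def b_def)
    fix v assume v: "v \<in> verts K"
    have F: "{u \<in> verts G. ?f u = v} = (if v = a then {a, b} else {v})"
      using v ab K(1) by (auto simp: b_def[symmetric])
    have S: "{x \<in> {e}. ?f (src G x) = v} = (if v = a then {e} else {})"
      using ab by (auto simp: a_def[symmetric])
    show "wt K v = (card {x \<in> {e}. ?f (src G x) = v} + 1 - card {u \<in> verts G. ?f u = v}) +
          (\<Sum>u\<in>{u \<in> verts G. ?f u = v}. wt G u)"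
      unfolding F S using K(5)[OF v] ab by (simp add: a_def[symmetric] b_def[symmetric])
    fix x y assume xy: "x \<in> {u \<in> verts G. ?f u = v}" "y \<in> {u \<in> verts G. ?f u = v}"
    have "(a, b) \<in> adj_on G {e}" "(b, a) \<in> adj_on G {e}" by (auto simp: adj_on_def a_def b_def)
    then show "(x, y) \<in> (adj_on G {x \<in> {e}. ?f (src G x) = v})\<^sup>*"
      using xy unfolding F S by (cases "v = a") auto
  qed
  then show ?thesis unfolding a_def b_def .
qed

text \<open>Length vectors vanish off the edge set, so \<open>l\<close> itself is a boundary point
  of the orthant of \<open>G\<close> at which only \<open>e\<close> has length 0.\<close>

lemma pt_contracts:
  assumes wf: "wf_graph G" and wfK: "wf_graph K" and c: "contracts G {e} K f id" and e: "e \<in> edges G"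
    and K: "edges K = edges G - {e}" and l: "l \<in> pos_orth K"
  shows "pt G l = cls (K, l)"
proof (rule pt_eq[OF wf])
  have "l e = 0" "\<And>x. x \<in> edges K \<Longrightarrow> l x > 0" "\<And>x. x \<notin> edges K \<Longrightarrow> l x = 0"
    using l K by (auto simp: pos_orth_def)
  then have "{x \<in> edges G. l x = 0} = {e}" using e K by force
  then show "ccontr (G, l) (K, l)" unfolding ccontr_iff
    using wfK c \<open>\<And>x. x \<notin> edges K \<Longrightarrow> l x = 0\<close> by (intro conjI exI[of _ f] exI[of _ id]) auto
qed

section \<open>Stable 3-edge-connected weighted graphs\<close>

lemma SG_euler:
  assumes G: "G \<in> SG g"
  shows "card (edges G) + 1 + (\<Sum>v\<in>verts G. wt G v) = card (verts G) + g"
  using connected_verts_le[OF SGD(1,2)[OF G]] SGD(4)[OF G] by (simp add: genus_def b1_def)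

lemma SG_pure_PT:
  assumes "G \<in> SG g" "three_edge_connected G" "pure_graph G"
  shows "G \<in> PT g"
  using SG_euler[OF assms(1)] SGD(1)[OF assms(1)] assms(2,3) by (simp add: PT_def pure_graph_def)

lemma PT_SG:
  assumes G: "G \<in> PT g" and g: "g \<ge> 2"
  shows "G \<in> SG g"
proof -
  have "stable_graph G"
    using PT_valence[OF G g] by (simp add: stable_graph_def card_halves[OF PTD(1)[OF G]])
  moreover have "genus G = g"
    using PTD(3,4)[OF G] by (simp add: genus_def b1_def pure_graph_def)
  ultimately show ?thesis
    using PTD(1)[OF G] tec_imp_connected[OF PTD(1,2)[OF G]] by (simp add: SG_def)
qed

text \<open>Cuts force valence 3 only if there are at least two vertices; then
  \<open>3V \<le> 2E\<close> and the Euler relation give the first alternative. The second one is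
  the Euler relation for a single vertex with loops.\<close>

lemma SG_tec_edges:
  assumes G: "G \<in> SG g" "three_edge_connected G" and g: "g \<ge> 2"
  shows "card (edges G) + 3 * (\<Sum>v\<in>verts G. wt G v) \<le> 3 * g - 3 \<or>
    card (edges G) + (\<Sum>v\<in>verts G. wt G v) = g"
proof (cases "\<exists>v. verts G = {v}")
  case True
  then show ?thesis using SG_euler[OF G(1)] by auto
next
  case False
  have "(\<Sum>v\<in>verts G. 3) \<le> (\<Sum>v\<in>verts G. card (halves G v))"
    by (rule sum_mono, rule tec_valence[OF SGD(1)[OF G(1)] G(2)]) (use False in auto)
  then have "3 * card (verts G) \<le> 2 * card (edges G)"
    using handshake[OF SGD(1)[OF G(1)]] by simp
  then show ?thesis using SG_euler[OF G(1)] g by linarith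
qed

lemma SG_tec_edges_le:
  assumes "G \<in> SG g" "three_edge_connected G" "g \<ge> 2"
  shows "card (edges G) \<le> 3 * g - 3"
  using SG_tec_edges[OF assms] assms(3) by linarith

lemma SG_tec_codim_le_one_pure:
  assumes G: "G \<in> SG g" "three_edge_connected G" and g: "g \<ge> 2" and c: "3 * g - 3 \<le> card (edges G) + 1"
  shows "pure_graph G"
proof -
  \<comment> \<open>With total weight \<open>W\<close>, the alternatives read
    \<open>3W \<le> 1\<close> and \<open>W \<le> 4 - 2g\<close>.\<close>
  have "(\<Sum>v\<in>verts G. wt G v) = 0" using SG_tec_edges[OF G g] g c by linarith
  moreover have "finite (verts G)" using SGD(1)[OF G(1)] by (simp add: wf_graph_def)
  ultimately show ?thesis by (simp add: pure_graph_def)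
qed

definition addloop :: "wgraph \<Rightarrow> nat \<Rightarrow> nat \<Rightarrow> wgraph" where
  "addloop G v e = \<lparr>verts = verts G, edges = insert e (edges G), src = (src G)(e := v), tgt = (tgt G)(e := v),
     wt = (wt G)(v := wt G v - 1)\<rparr>"

lemma addloop_simps [simp]:
  "verts (addloop G v e) = verts G" "edges (addloop G v e) = insert e (edges G)"
  "src (addloop G v e) = (src G)(e := v)" "tgt (addloop G v e) = (tgt G)(e := v)"
  "wt (addloop G v e) = (wt G)(v := wt G v - 1)"
  by (simp_all add: addloop_def)

lemma addloop_SG:
  assumes G: "G \<in> SG g" "three_edge_connected G" and g: "g \<ge> 2"
    and v: "v \<in> verts G" "0 < wt G v" and e: "e \<notin> edges G"
  shows "addloop G v e \<in> SG g" "three_edge_connected (addloop G v e)"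
    "contracts (addloop G v e) {e} G id id"
proof -
  let ?H = "addloop G v e"
  note wf = SGD(1)[OF G(1)]
  have fin: "finite (verts G)" "finite (edges G)" using wf by (auto simp: wf_graph_def)
  have wfH: "wf_graph ?H" using wf v by (auto simp: wf_graph_def)
  have "cut ?H X = cut G X" for X using e by (auto simp: cut_def)
  then show t: "three_edge_connected ?H"
    using G(2) unfolding tec_iff_cut[OF wf] tec_iff_cut[OF wfH] by simp
  have W: "(\<Sum>u\<in>verts G. wt G u) = Suc (\<Sum>u\<in>verts G. ((wt G)(v := wt G v - 1)) u)"
  proof -
    have "(\<Sum>u\<in>verts G - {v}. ((wt G)(v := wt G v - 1)) u) = (\<Sum>u\<in>verts G - {v}. wt G u)"
      by (rule sum.cong) auto
    then show ?thesis using sum.remove[OF fin(1) v(1), of "wt G"]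
        sum.remove[OF fin(1) v(1), of "(wt G)(v := wt G v - 1)"] v(2) by simp
  qed
  have "genus ?H = g"
    using SG_euler[OF G(1)] W fin(2) e connected_verts_le[OF SGD(1,2)[OF G(1)]]
    by (simp add: genus_def b1_def)
  moreover have "stable_graph ?H" unfolding stable_graph_def
  proof (intro ballI impI)
    fix u assume u: "u \<in> verts ?H" "wt ?H u = 0"
    show "3 \<le> valence ?H u"
    proof (cases "u = v")
      case False
      have "halves ?H u = halves G u" using False e by (auto simp: halves_def hend_def)
      moreover have "3 \<le> valence G u" using SGD(3)[OF G(1)] u False by (simp add: stable_graph_def)
      ultimately show ?thesis by (simp add: card_halves[OF wf, symmetric] card_halves[OF wfH, symmetric])
    next
      case True
      \<comment> \<open>The loop contributes 2 to the valence of \<open>v\<close>. If its weight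
        drops to 0, one older half-edge is needed; for a single vertex this uses
        \<open>g \<ge> 2\<close>.\<close>
      have "card (halves G v) \<ge> 1"
      proof (cases "verts G = {v}")
        case single: True
        then have "card (edges G) + wt G v = g" using SG_euler[OF G(1)] by simp
        moreover have "wt G v \<le> 1" using u(2) True by simp
        ultimately show ?thesis using card_halves_single[OF wf single] g by linarith
      next
        case False
        then show ?thesis using tec_valence[OF wf G(2) v(1)] by simp
      qed
      moreover have "card (halves G v \<union> {(e, True), (e, False)}) \<le> card (halves ?H v)"
        using e by (intro card_mono[OF finite_halves[OF wfH]]) (auto simp: halves_def hend_def)
      moreover have "card (halves G v \<union> {(e, True), (e, False)}) = card (halves G v) + 2"
        using e finite_halves[OF wf] by (subst card_Un_disjoint) (auto simp: halves_def)
      ultimately show ?thesis using True by (simp add: card_halves[OF wfH, symmetric])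
    qed
  qed
  ultimately show "?H \<in> SG g" using wfH tec_imp_connected[OF wfH t] by (simp add: SG_def)
  show "contracts ?H {e} G id id" unfolding contracts_def
  proof (intro conjI ballI)
    show "bij_betw id (edges ?H - {e}) (edges G)" using e by simp
    show "ends G (id x) = id ` ends ?H x" if "x \<in> edges ?H - {e}" for x using that by (auto simp: ends_def)
    show "id (src ?H x) = id (tgt ?H x)" if "x \<in> {e}" for x using that by simp
    fix u assume u: "u \<in> verts G"
    have F: "{x \<in> verts ?H. id x = u} = {u}" using u by auto
    have S: "{x \<in> {e}. id (src ?H x) = u} = (if u = v then {e} else {})" by auto
    show "wt G u = (card {x \<in> {e}. id (src ?H x) = u} + 1 - card {x \<in> verts ?H. id x = u}) +
          (\<Sum>x\<in>{x \<in> verts ?H. id x = u}. wt ?H x)"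
      unfolding F S using v by simp
    show "(x, y) \<in> (adj_on ?H {x \<in> {e}. id (src ?H x) = u})\<^sup>*"
      if "x \<in> {x \<in> verts ?H. id x = u}" "y \<in> {x \<in> verts ?H. id x = u}" for x y
      using that by simp
  qed simp
qed

lemma vsplit_contracts:
  assumes K: "K \<in> PT g" and s: "splits K v P n e"
  shows "contracts (vsplit K v P n e) {e} K (\<lambda>u. if u = n then v else u) id"
proof -
  let ?G = "vsplit K v P n e"
  have sv: "v \<in> verts K" "P \<subseteq> halves K v" "n \<notin> verts K" "e \<notin> edges K" "v \<noteq> n"
    using s by (auto simp: splits_def)
  have P: "src K x = v" if "(x, True) \<in> P" for x using sv(2) that by (auto simp: halves_def)
  have P': "tgt K x = v" if "(x, False) \<in> P" for x using sv(2) that by (auto simp: halves_def)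
  have n: "src K x \<noteq> n" "tgt K x \<noteq> n" if "x \<in> edges K" for x
    using PTD(1)[OF K] sv(3) that by (auto simp: wf_graph_def)
  have "contracts ?G {e} K (\<lambda>u. if u = tgt ?G e then src ?G e else u) id"
  proof (rule contracts_merge)
    show "wf_graph ?G" by (rule vsplit_wf[OF PTD(1)[OF K] sv(1)])
    fix x assume x: "x \<in> edges K"
    then have "x \<noteq> e" using sv by auto
    then show "src K x = (if src ?G x = tgt ?G e then src ?G e else src ?G x)"
      "tgt K x = (if tgt ?G x = tgt ?G e then src ?G e else tgt ?G x)"
      using n[OF x] P[of x] P'[of x] by simp_all
  next
    fix u assume "u \<in> verts K"
    then have "u \<noteq> n" using sv by auto
    then show "wt K u = (if u = src ?G e then wt ?G (src ?G e) + wt ?G (tgt ?G e) else wt ?G u)"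
      using sv by simp
  qed (use sv in auto)
  then show ?thesis by (simp cong: if_cong)
qed

lemma tec_expand:
  assumes G: "G \<in> SG g" "three_edge_connected G" and g: "g \<ge> 2" and c: "card (edges G) < 3 * g - 3"
  shows "\<exists>H e f. H \<in> SG g \<and> three_edge_connected H \<and> e \<notin> edges G \<and> edges H = insert e (edges G) \<and>
    contracts H {e} G f id"
proof (cases "pure_graph G")
  case True
  have K: "G \<in> PT g" by (rule SG_pure_PT[OF G True])
  obtain v P n e where s: "splits G v P n e" "vsplit G v P n e \<in> PT g" by (rule PT_expand[OF K g c])
  then show ?thesis using PT_SG[OF s(2) g] PTD(2)[OF s(2)] vsplit_contracts[OF K s(1)]
    by (intro exI[of _ "vsplit G v P n e"] exI[of _ e] exI[of _ "\<lambda>u. if u = n then v else u"]) (simp add: splits_def)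
next
  case False
  then obtain v where v: "v \<in> verts G" "0 < wt G v" by (auto simp: pure_graph_def)
  have "finite (edges G)" using SGD(1)[OF G(1)] by (simp add: wf_graph_def)
  then obtain e where e: "e \<notin> edges G" using fresh by blast
  show ?thesis using addloop_SG[OF G g v e] e
    by (intro exI[of _ "addloop G v e"] exI[of _ e] exI[of _ id]) simp
qed

section \<open>The topology of the moduli space\<close>

lemma openin_Mtrop:
  "openin (Mtrop g) U \<longleftrightarrow> U \<subseteq> Mtrop_pts g \<and>
    (\<forall>G\<in>SG g. openin (top_of_set (orth G)) {l \<in> orth G. pt G l \<in> U})"
  unfolding Mtrop_def openin_final_topology by simp

lemma pt_in_Mtrop: "G \<in> SG g \<Longrightarrow> l \<in> orth G \<Longrightarrow> pt G l \<in> Mtrop_pts g"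
  by (erule (1) pt_point) (auto simp: Mtrop_pts_def)

lemma topspace_Mtrop: "topspace (Mtrop g) = Mtrop_pts g"
proof -
  have "{l \<in> orth G. pt G l \<in> Mtrop_pts g} = orth G" if "G \<in> SG g" for G
    using pt_in_Mtrop[OF that] by auto
  then have "openin (Mtrop g) (Mtrop_pts g)"
    unfolding openin_Mtrop by (auto intro: openin_subtopology_self)
  moreover have "topspace (Mtrop g) \<subseteq> Mtrop_pts g"
    using openin_topspace[of "Mtrop g"] unfolding openin_Mtrop by blast
  ultimately show ?thesis using openin_subset by blast
qed

lemma continuous_pt:
  assumes "G \<in> SG g"
  shows "continuous_map (top_of_set (orth G)) (Mtrop g) (pt G)"
  unfolding continuous_map_def topspace_Mtrop
  using pt_in_Mtrop[OF assms] openin_Mtrop assms by auto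

lemma cls_in_Mtrop: "G \<in> SG g \<Longrightarrow> l \<in> pos_orth G \<Longrightarrow> cls (G, l) \<in> Mtrop_pts g"
  by (auto simp: Mtrop_pts_def)

text \<open>Giving the new edge a small positive length moves the point off the face of the orthant
  of \<open>H\<close> without leaving \<open>U\<close>.\<close>

lemma open_expand:
  assumes U: "openin (Mtrop g) U" and H: "H \<in> SG g" and wfG: "wf_graph G"
    and e: "e \<notin> edges G" "edges H = insert e (edges G)" and c: "contracts H {e} G f id"
    and l: "l \<in> pos_orth G" "cls (G, l) \<in> U"
  shows "\<exists>m\<in>pos_orth H. cls (H, m) \<in> U"
proof -
  note wf = SGD(1)[OF H]
  have EG: "e \<in> edges H" "edges G = edges H - {e}" using e by auto
  have pl: "pt H l = cls (G, l)" by (rule pt_contracts[OF wf wfG c EG l(1)])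
  have lo: "l \<in> orth H" using l(1) e by (force simp: pos_orth_def orth_def)
  have "openin (top_of_set (orth H)) {x \<in> orth H. pt H x \<in> U}" using U H openin_Mtrop by blast
  then obtain T where T: "open T" "{x \<in> orth H. pt H x \<in> U} = orth H \<inter> T"
    by (auto simp: openin_open)
  define \<gamma> where "\<gamma> t = l(e := t)" for t :: real
  have "continuous_on UNIV \<gamma>"
  proof (rule continuous_on_coordinatewise_then_product)
    show "continuous_on UNIV (\<lambda>t. \<gamma> t i)" for i by (cases "i = e") (simp_all add: \<gamma>_def)
  qed
  then have "open (\<gamma> -` T)" using T(1) by (simp add: continuous_on_open_vimage)
  moreover have "\<gamma> 0 = l" using l(1) e by (auto simp: \<gamma>_def pos_orth_def)
  then have "0 \<in> \<gamma> -` T" using T(2) lo l(2) pl by auto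
  ultimately obtain \<epsilon> where \<epsilon>: "\<epsilon> > 0" "ball 0 \<epsilon> \<subseteq> \<gamma> -` T" by (rule openE)
  define m where "m = \<gamma> (\<epsilon> / 2)"
  have m: "m \<in> pos_orth H" using l(1) e \<epsilon>(1) by (auto simp: m_def \<gamma>_def pos_orth_def)
  then have "m \<in> orth H" by (auto simp: pos_orth_def orth_def less_imp_le)
  moreover have "\<epsilon> / 2 \<in> ball 0 \<epsilon>" using \<epsilon>(1) by simp
  then have "\<epsilon> / 2 \<in> \<gamma> -` T" using \<epsilon>(2) by blast
  then have "m \<in> T" by (simp add: m_def)
  ultimately have "m \<in> {x \<in> orth H. pt H x \<in> U}" unfolding T(2) by simp
  then have "pt H m \<in> U" by simp
  then show ?thesis using m pt_pos[OF wf m] by auto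
qed

lemma open_top:
  assumes U: "openin (Mtrop g) U" and g: "g \<ge> 2"
    and G: "G \<in> SG g" "three_edge_connected G" and l: "l \<in> pos_orth G" "cls (G, l) \<in> U"
  shows "\<exists>H\<in>SG g. \<exists>m\<in>pos_orth H. three_edge_connected H \<and> card (edges H) = 3 * g - 3 \<and> cls (H, m) \<in> U"
  using G l
proof (induction "3 * g - 3 - card (edges G)" arbitrary: G l rule: less_induct)
  case less
  show ?case
  proof (cases "card (edges G) < 3 * g - 3")
    case True
    obtain H e f where H: "H \<in> SG g" "three_edge_connected H" "e \<notin> edges G" "edges H = insert e (edges G)"
      "contracts H {e} G f id" using tec_expand[OF less.prems(1,2) g True] by blast
    obtain m where m: "m \<in> pos_orth H" "cls (H, m) \<in> U"
      using open_expand[OF U H(1) SGD(1)[OF less.prems(1)] H(3-5) less.prems(3,4)] by blast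
    have "finite (edges G)" using SGD(1)[OF less.prems(1)] by (simp add: wf_graph_def)
    then have "card (edges H) = Suc (card (edges G))" using H(3,4) by simp
    then show ?thesis using less.hyps[OF _ H(1,2) m] True by simp
  next
    case False
    then have "card (edges G) = 3 * g - 3" using SG_tec_edges_le[OF less.prems(1,2) g] by simp
    then show ?thesis using less.prems by blast
  qed
qed

section \<open>Maximal cells together with their open facets\<close>

definition near_top :: "wgraph \<Rightarrow> (nat \<Rightarrow> real) set" where
  "near_top G = {l \<in> orth G. card {e \<in> edges G. l e = 0} \<le> 1}"

lemma pos_near_top:
  assumes "l \<in> pos_orth G" shows "l \<in> near_top G"
proof -
  have z: "{e \<in> edges G. l e = 0} = {}" using assms by (auto simp: pos_orth_def)
  have "card {e \<in> edges G. l e = 0} \<le> 1" by (simp only: z) simp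
  moreover have "l \<in> orth G" using assms by (auto simp: pos_orth_def orth_def less_imp_le)
  ultimately show ?thesis by (simp only: near_top_def mem_Collect_eq)
qed

text \<open>Inside a segment between nonnegative vectors a coordinate vanishes only if it vanishes
  at both ends, so the set is convex.\<close>

lemma near_top_connected:
  assumes fin: "finite (edges G)"
  shows "connected (near_top G)"
proof -
  have "path_connected (near_top G)"
    unfolding path_connected_def
  proof (intro ballI)
    fix l m assume lm: "l \<in> near_top G" "m \<in> near_top G"
    have pos: "l e \<ge> 0" "m e \<ge> 0" if "e \<in> edges G" for e
      using lm that by (auto simp: near_top_def orth_def)
    define \<gamma> where "\<gamma> t = (\<lambda>e. (1 - t) * l e + t * m e)" for t :: real
    have "continuous_on {0..1} \<gamma>"
      by (rule continuous_on_coordinatewise_then_product) (auto simp: \<gamma>_def intro!: continuous_intros)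
    moreover have "\<gamma> t \<in> near_top G" if t: "t \<in> {0..1}" for t
    proof -
      have o: "\<gamma> t \<in> orth G" using lm t pos by (auto simp: near_top_def orth_def \<gamma>_def)
      consider "t = 0" | "t = 1" | "0 < t" "t < 1" using t by fastforce
      then show ?thesis
      proof cases
        case 1 then show ?thesis using lm by (simp add: \<gamma>_def)
      next
        case 2 then show ?thesis using lm by (simp add: \<gamma>_def)
      next
        case 3
        have "{e \<in> edges G. \<gamma> t e = 0} \<subseteq> {e \<in> edges G. l e = 0}"
        proof (intro subsetI CollectI conjI; elim CollectE conjE)
          fix e assume e: "e \<in> edges G" "\<gamma> t e = 0"
          have "0 \<le> (1 - t) * l e" "0 \<le> t * m e" using 3 pos[OF e(1)] by simp_all
          then have "(1 - t) * l e = 0" using e(2) unfolding \<gamma>_def by linarith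
          then show "l e = 0" using 3 by simp
        qed
        then have "card {e \<in> edges G. \<gamma> t e = 0} \<le> card {e \<in> edges G. l e = 0}"
          using fin by (intro card_mono) auto
        then show ?thesis using lm(1) o by (simp add: near_top_def)
      qed
    qed
    moreover have "\<gamma> 0 = l" "\<gamma> 1 = m" by (simp_all add: \<gamma>_def)
    ultimately show "\<exists>p. path p \<and> path_image p \<subseteq> near_top G \<and> pathstart p = l \<and> pathfinish p = m"
      by (intro exI[of _ \<gamma>]) (auto simp: path_def path_image_def pathstart_def pathfinish_def)
  qed
  then show ?thesis by (rule path_connected_imp_connected)
qed

text \<open>Constant lengths are respected by every isomorphism, so the cells of isomorphic pure
  graphs have this point in common.\<close>

lemma giso_point:
  assumes G: "G \<in> PT g" and H: "H \<in> PT g" and i: "giso G H"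
  shows "cls (G, \<lambda>e. if e \<in> edges G then 1 else 0) = cls (H, \<lambda>e. if e \<in> edges H then 1 else 0)"
proof (rule cls_eqI)
  obtain f k fl where f: "bij_betw f (verts G) (verts H)" and k: "bij_betw k (edges G) (edges H)"
    and h: "\<And>x s. x \<in> edges G \<Longrightarrow> hend H (k x, s) = f (hend G (x, s \<noteq> fl x))"
    using i by (auto simp: giso_def)
  have "ends H (k e) = f ` ends G e" if "e \<in> edges G" for e
    using h[OF that, of True] h[OF that, of False] by (cases "fl e") (auto simp: ends_def)
  moreover have "k e \<in> edges H" if "e \<in> edges G" for e using k that by (auto simp: bij_betw_def)
  moreover have "wt H (f v) = wt G v" if "v \<in> verts G" for v
    using PTD(3)[OF G] PTD(3)[OF H] f that by (auto simp: pure_graph_def bij_betw_def)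
  ultimately show "curve_iso (G, \<lambda>e. if e \<in> edges G then 1 else 0) (H, \<lambda>e. if e \<in> edges H then 1 else 0)"
    unfolding curve_iso_iff using f k by (intro exI[of _ f] exI[of _ k]) simp
qed (use PTD(1)[OF G] in simp)

definition codim1 :: "nat \<Rightarrow> tcurve set set" where
  "codim1 g = \<Union>{stratum G | G. G \<in> SG g \<and> three_edge_connected G \<and> 3 * g - 3 \<le> card (edges G) + 1}"

lemma face_point:
  assumes K: "K \<in> PT g" and s: "splits K v P n e" and l: "l \<in> pos_orth K"
  shows "cls (K, l) \<in> pt (vsplit K v P n e) ` near_top (vsplit K v P n e)"
proof -
  let ?G = "vsplit K v P n e"
  have sv: "v \<in> verts K" "e \<notin> edges K" using s by (auto simp: splits_def)
  have pl: "pt ?G l = cls (K, l)"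
    by (rule pt_contracts[OF vsplit_wf[OF PTD(1)[OF K] sv(1)] PTD(1)[OF K] vsplit_contracts[OF K s]])
      (use sv l in auto)
  have z: "{x \<in> edges ?G. l x = 0} = {e}" using l sv(2) by (force simp: pos_orth_def)
  then have "card {x \<in> edges ?G. l x = 0} \<le> 1" by (simp only: z) simp
  moreover have "l \<in> orth ?G" using l sv(2) by (force simp: pos_orth_def orth_def)
  ultimately have "l \<in> near_top ?G" by (simp only: near_top_def mem_Collect_eq)
  then show ?thesis using pl by (metis imageI)
qed

lemma top_subset_codim1:
  assumes G: "G \<in> PT g" "card (edges G) = 3 * g - 3" and g: "g \<ge> 2"
  shows "pt G ` near_top G \<subseteq> codim1 g"
proof
  fix p assume "p \<in> pt G ` near_top G"
  then obtain l where l: "p = pt G l" "l \<in> orth G" "card {e \<in> edges G. l e = 0} \<le> 1"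
    by (auto simp: near_top_def)
  obtain H m where H: "pt G l = cls (H, m)" "H \<in> SG g" "m \<in> pos_orth H"
    "card (edges H) = card {e \<in> edges G. l e \<noteq> 0}" "three_edge_connected G \<longrightarrow> three_edge_connected H"
    by (rule pt_point[OF PT_SG[OF G(1) g] l(2)])
  have "{e \<in> edges G. l e \<noteq> 0} = edges G - {e \<in> edges G. l e = 0}" by auto
  then have "card {e \<in> edges G. l e \<noteq> 0} = card (edges G) - card {e \<in> edges G. l e = 0}"
    using PTD(6)[OF G(1)] by (simp add: card_Diff_subset)
  then have "3 * g - 3 \<le> card (edges H) + 1" using H(4) G(2) l(3) by linarith
  then show "p \<in> codim1 g" using H(1-3) mp[OF H(5) PTD(2)[OF G(1)]] l(1)
    unfolding codim1_def stratum_def by blast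
qed

lemma codim1_covered:
  assumes p: "p \<in> codim1 g" and g: "g \<ge> 2"
  shows "\<exists>G. G \<in> PT g \<and> card (edges G) = 3 * g - 3 \<and> p \<in> pt G ` near_top G"
proof -
  obtain K l where K: "K \<in> SG g" "three_edge_connected K" "3 * g - 3 \<le> card (edges K) + 1"
    "l \<in> pos_orth K" "p = cls (K, l)" using p unfolding codim1_def stratum_def by blast
  have PK: "K \<in> PT g"
    by (rule SG_pure_PT[OF K(1,2) SG_tec_codim_le_one_pure[OF K(1,2) g K(3)]])
  show ?thesis
  proof (cases "card (edges K) = 3 * g - 3")
    case True
    have "p = pt K l" using pt_pos[OF SGD(1)[OF K(1)] K(4)] K(5) by simp
    then show ?thesis using PK True pos_near_top[OF K(4)] by blast
  next
    case False
    then have c: "card (edges K) + 1 = 3 * g - 3"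
      using SG_tec_edges_le[OF K(1,2) g] K(3) by linarith
    obtain v P n e where s: "splits K v P n e" "vsplit K v P n e \<in> PT g"
      by (rule PT_expand[OF PK g]) (use c in simp)
    have "card (edges (vsplit K v P n e)) = 3 * g - 3"
      using s(1) c PTD(6)[OF PK] by (simp add: splits_def)
    then show ?thesis using s(2) face_point[OF PK s(1) K(4)] K(5) by blast
  qed
qed

lemma codim1_connected:
  assumes g: "g \<ge> 2"
  shows "connectedin (Mtrop g) (codim1 g)"
  unfolding connectedin
proof (intro conjI notI)
  show "codim1 g \<subseteq> topspace (Mtrop g)"
    unfolding topspace_Mtrop codim1_def stratum_def using cls_in_Mtrop by blast
  assume "\<exists>E1 E2. openin (Mtrop g) E1 \<and> openin (Mtrop g) E2 \<and> codim1 g \<subseteq> E1 \<union> E2 \<and>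
    E1 \<inter> E2 \<inter> codim1 g = {} \<and> E1 \<inter> codim1 g \<noteq> {} \<and> E2 \<inter> codim1 g \<noteq> {}"
  then obtain E1 E2 where E: "openin (Mtrop g) E1" "openin (Mtrop g) E2" "codim1 g \<subseteq> E1 \<union> E2"
    "E1 \<inter> E2 \<inter> codim1 g = {}" "E1 \<inter> codim1 g \<noteq> {}" "E2 \<inter> codim1 g \<noteq> {}" by blast
  define top where "top G \<longleftrightarrow> G \<in> PT g \<and> card (edges G) = 3 * g - 3" for G
  define T where "T G = pt G ` near_top G" for G
  have TU: "T G \<subseteq> codim1 g" if "top G" for G
    using top_subset_codim1 g that by (simp add: top_def T_def)
  have conn: "T G \<subseteq> E1 \<or> T G \<subseteq> E2" if G: "top G" for G
  proof -
    have "connectedin (top_of_set (orth G)) (near_top G)"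
      using near_top_connected[OF PTD(6)] G
      by (auto simp: top_def connectedin_subtopology near_top_def)
    then have "connectedin (Mtrop g) (T G)" unfolding T_def
      using connectedin_continuous_map_image[OF continuous_pt[OF PT_SG[OF _ g]]] G top_def by blast
    moreover have "T G \<subseteq> E1 \<union> E2" "E1 \<inter> E2 \<inter> T G = {}" using TU[OF G] E(3,4) by blast+
    ultimately have "E1 \<inter> T G = {} \<or> E2 \<inter> T G = {}" using E(1,2) unfolding connectedin by metis
    then show ?thesis using \<open>T G \<subseteq> E1 \<union> E2\<close> by blast
  qed
  \<comment> \<open>Each cell with its facets lies entirely in one of the open sets, so two of them
    with a common point lie in the same one.\<close>
  have meet: "T G \<subseteq> E1 \<longleftrightarrow> T H \<subseteq> E1" if G: "top G" and H: "top H" and p: "p \<in> T G" "p \<in> T H" for G H p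
  proof -
    have "p \<in> codim1 g" using TU[OF G] p by blast
    then have "\<not> (p \<in> E1 \<and> p \<in> E2)" using E(4) by blast
    then show ?thesis using conn[OF G] conn[OF H] p by blast
  qed
  \<comment> \<open>The separation yields the invariant. Isomorphic graphs share the point with all
    lengths 1, and all splittings of a codimension-one graph share the stratum of that
    graph.\<close>
  interpret face_invariant g "\<lambda>G. T G \<subseteq> E1"
  proof unfold_locales
    show "2 \<le> g" by (rule g)
  next
    fix G H assume GH: "G \<in> PT g" "H \<in> PT g" "card (edges G) = 3 * g - 3" "giso G H"
    have tp: "top G" "top H" using GH by (auto simp: top_def giso_def bij_betw_same_card)
    have "cls (G, \<lambda>e. if e \<in> edges G then 1 else 0) \<in> T G" if "top G" for G
    proof -
      let ?l = "\<lambda>e. if e \<in> edges G then 1 else 0 :: real"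
      have l: "?l \<in> pos_orth G" by (simp add: pos_orth_def)
      have "?l \<in> near_top G" by (rule pos_near_top[OF l])
      moreover have "G \<in> PT g" using that by (simp add: top_def)
      then have "pt G ?l = cls (G, ?l)" using pt_pos[OF PTD(1) l] by blast
      ultimately show ?thesis unfolding T_def by (metis imageI)
    qed
    from this[OF tp(1)] this[OF tp(2)] show "(T G \<subseteq> E1) = (T H \<subseteq> E1)"
      using meet[OF tp] giso_point[OF GH(1,2,4)] by simp
  next
    fix K v P n e w Q m f
    assume K: "K \<in> PT g" "card (edges K) + 1 = 3 * g - 3"
      and s: "splits K v P n e" "vsplit K v P n e \<in> PT g" and s': "splits K w Q m f" "vsplit K w Q m f \<in> PT g"
    let ?l = "\<lambda>e. if e \<in> edges K then 1 else 0 :: real"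
    have l: "?l \<in> pos_orth K" by (simp add: pos_orth_def)
    have "top (vsplit K v P n e)" "top (vsplit K w Q m f)"
      using s s' K PTD(6)[OF K(1)] by (simp_all add: top_def splits_def)
    then show "(T (vsplit K v P n e) \<subseteq> E1) = (T (vsplit K w Q m f) \<subseteq> E1)"
      using meet face_point[OF K(1) s(1) l] face_point[OF K(1) s'(1) l] unfolding T_def by blast
  qed
  obtain p1 p2 where p: "p1 \<in> E1" "p1 \<in> codim1 g" "p2 \<in> E2" "p2 \<in> codim1 g" using E(5,6) by blast
  from codim1_covered[OF p(2) g] obtain G1 where G1: "top G1" "p1 \<in> T G1"
    unfolding top_def T_def by blast
  from codim1_covered[OF p(4) g] obtain G2 where G2: "top G2" "p2 \<in> T G2"
    unfolding top_def T_def by blast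
  have "p1 \<notin> E2" "p2 \<notin> E1" using p E(4) by blast+
  then have "T G1 \<subseteq> E1" "\<not> T G2 \<subseteq> E1" using conn[OF G1(1)] G1(2) G2(2) by blast+
  then show False using invariant_const G1(1) G2(1) by (auto simp: top_def)
qed

section \<open>Tropical Jacobians\<close>

text \<open>Entry of the oriented incidence matrix, whose integral kernel is the lattice of cycles;
  it vanishes for loops.\<close>

definition inc :: "wgraph \<Rightarrow> nat \<Rightarrow> nat \<Rightarrow> int" where
  "inc G e v = of_bool (tgt G e = v) - of_bool (src G e = v)"

lemma cycles_iff:
  assumes fin: "finite (edges G)"
  shows "x \<in> cycles G \<longleftrightarrow> (\<forall>e. e \<notin> edges G \<longrightarrow> x e = 0) \<and> (\<forall>v\<in>verts G. (\<Sum>e\<in>edges G. x e * inc G e v) = 0)"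
proof -
  have "(\<Sum>e\<in>{e \<in> edges G. tgt G e = v}. x e) = (\<Sum>e\<in>edges G. x e * of_bool (tgt G e = v))"
    "(\<Sum>e\<in>{e \<in> edges G. src G e = v}. x e) = (\<Sum>e\<in>edges G. x e * of_bool (src G e = v))" for v
    by (intro sum.mono_neutral_cong_left[OF fin]; auto)+
  then show ?thesis unfolding cycles_def inc_def
    by (simp add: right_diff_distrib sum_subtractf)
qed

lemma cycles_add: "x \<in> cycles G \<Longrightarrow> y \<in> cycles G \<Longrightarrow> (\<lambda>e. x e + y e) \<in> cycles G"
  by (simp add: cycles_def sum.distrib)

lemma jlat_add: "x \<in> jlat G \<Longrightarrow> y \<in> jlat G \<Longrightarrow> (\<lambda>j. x j + y j) \<in> jlat G"
  using cycles_add[of "\<lambda>e. x (Inl e)" G "\<lambda>e. y (Inl e)"] by (simp add: jlat_def)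

lemma jac_refl: "jac_equiv c c"
  unfolding jac_equiv_def by (intro exI[of _ id]) simp

lemma jac_trans:
  assumes "jac_equiv a b" "jac_equiv b c" shows "jac_equiv a c"
proof -
  obtain f where f: "bij_betw f (jlat (fst a)) (jlat (fst b))"
    "\<And>x y. x \<in> jlat (fst a) \<Longrightarrow> y \<in> jlat (fst a) \<Longrightarrow> f (\<lambda>j. x j + y j) = (\<lambda>j. f x j + f y j)"
    "\<And>x. x \<in> jlat (fst a) \<Longrightarrow> jform b (f x) = jform a x" using assms(1) unfolding jac_equiv_def by blast
  obtain h where h: "bij_betw h (jlat (fst b)) (jlat (fst c))"
    "\<And>x y. x \<in> jlat (fst b) \<Longrightarrow> y \<in> jlat (fst b) \<Longrightarrow> h (\<lambda>j. x j + y j) = (\<lambda>j. h x j + h y j)"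
    "\<And>x. x \<in> jlat (fst b) \<Longrightarrow> jform c (h x) = jform b x" using assms(2) unfolding jac_equiv_def by blast
  have m: "f x \<in> jlat (fst b)" if "x \<in> jlat (fst a)" for x using f(1) that by (rule bij_betwE[rule_format])
  show ?thesis unfolding jac_equiv_def
  proof (intro exI[of _ "h \<circ> f"] conjI ballI)
    show "bij_betw (h \<circ> f) (jlat (fst a)) (jlat (fst c))" by (rule bij_betw_trans[OF f(1) h(1)])
    show "(h \<circ> f) (\<lambda>j. x j + y j) = (\<lambda>j. (h \<circ> f) x j + (h \<circ> f) y j)"
      if "x \<in> jlat (fst a)" "y \<in> jlat (fst a)" for x y using f(2) h(2) m that by simp
    show "jform c ((h \<circ> f) x) = jform a x" if "x \<in> jlat (fst a)" for x using f(3) h(3) m that by simp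
  qed
qed

lemma jac_sym:
  assumes "jac_equiv a b" shows "jac_equiv b a"
proof -
  obtain f where f: "bij_betw f (jlat (fst a)) (jlat (fst b))"
    "\<And>x y. x \<in> jlat (fst a) \<Longrightarrow> y \<in> jlat (fst a) \<Longrightarrow> f (\<lambda>j. x j + y j) = (\<lambda>j. f x j + f y j)"
    "\<And>x. x \<in> jlat (fst a) \<Longrightarrow> jform b (f x) = jform a x" using assms(1) unfolding jac_equiv_def by blast
  define h where "h = inv_into (jlat (fst a)) f"
  have h: "h x \<in> jlat (fst a)" "f (h x) = x" if "x \<in> jlat (fst b)" for x
    using f(1) that by (auto simp: h_def bij_betw_def inv_into_into f_inv_into_f)
  have hf: "h (f x) = x" if "x \<in> jlat (fst a)" for x using f(1) that by (simp add: h_def bij_betw_def)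
  show ?thesis unfolding jac_equiv_def
  proof (intro exI[of _ h] conjI ballI)
    show "bij_betw h (jlat (fst b)) (jlat (fst a))" unfolding h_def by (rule bij_betw_inv_into[OF f(1)])
    show "h (\<lambda>j. x j + y j) = (\<lambda>j. h x j + h y j)" if xy: "x \<in> jlat (fst b)" "y \<in> jlat (fst b)" for x y
    proof -
      have "f (\<lambda>j. h x j + h y j) = (\<lambda>j. x j + y j)" using f(2)[OF h(1)[OF xy(1)] h(1)[OF xy(2)]] h(2) xy by simp
      then show ?thesis using hf[OF jlat_add[OF h(1)[OF xy(1)] h(1)[OF xy(2)]]] by simp
    qed
    show "jform a (h x) = jform b x" if "x \<in> jlat (fst b)" for x using f(3)[OF h(1)[OF that]] h(2)[OF that] by simp
  qed
qed

text \<open>An isometry of the cycle lattices suffices: on the weight part, where the form is zero,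
  the identity works because only the total weight matters.\<close>

lemma jac_equivI:
  assumes W: "(\<Sum>v\<in>verts H. wt H v) = (\<Sum>v\<in>verts G. wt G v)"
    and m: "\<And>x. x \<in> cycles G \<Longrightarrow> h x \<in> cycles H" "\<And>y. y \<in> cycles H \<Longrightarrow> k y \<in> cycles G"
    and i: "\<And>x. x \<in> cycles G \<Longrightarrow> k (h x) = x" "\<And>y. y \<in> cycles H \<Longrightarrow> h (k y) = y"
    and a: "\<And>x y. h (\<lambda>e. x e + y e) = (\<lambda>e. h x e + h y e)"
    and q: "\<And>x. x \<in> cycles G \<Longrightarrow>
      (\<Sum>e\<in>edges H. p e * (real_of_int (h x e))\<^sup>2) = (\<Sum>e\<in>edges G. l e * (real_of_int (x e))\<^sup>2)"
  shows "jac_equiv (G, l) (H, p)"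
  unfolding jac_equiv_def
proof (intro exI[of _ "\<lambda>x. case_sum (h (\<lambda>e. x (Inl e))) (\<lambda>i. x (Inr i))"] conjI ballI)
  let ?f = "\<lambda>x. case_sum (h (\<lambda>e. x (Inl e))) (\<lambda>i. x (Inr i)) :: nat + nat \<Rightarrow> int"
  let ?g = "\<lambda>x. case_sum (k (\<lambda>e. x (Inl e))) (\<lambda>i. x (Inr i)) :: nat + nat \<Rightarrow> int"
  show "bij_betw ?f (jlat (fst (G, l))) (jlat (fst (H, p)))"
  proof (rule bij_betw_byWitness[of _ ?g])
    show "\<forall>x\<in>jlat (fst (G, l)). ?g (?f x) = x"
      using i(1) by (auto simp: jlat_def fun_eq_iff split: sum.split)
    show "\<forall>x\<in>jlat (fst (H, p)). ?f (?g x) = x"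
      using i(2) by (auto simp: jlat_def fun_eq_iff split: sum.split)
    show "?f ` jlat (fst (G, l)) \<subseteq> jlat (fst (H, p))" using m(1) W by (auto simp: jlat_def)
    show "?g ` jlat (fst (H, p)) \<subseteq> jlat (fst (G, l))" using m(2) W by (auto simp: jlat_def)
  qed
  show "?f (\<lambda>j. x j + y j) = (\<lambda>j. ?f x j + ?f y j)" for x y
    using a[of "\<lambda>e. x (Inl e)" "\<lambda>e. y (Inl e)"] by (auto simp: fun_eq_iff split: sum.split)
  show "jform (H, p) (?f x) = jform (G, l) x" if "x \<in> jlat (fst (G, l))" for x
    using q[of "\<lambda>e. x (Inl e)"] that by (simp add: jform_def jlat_def)
qed

lemma jac_of_iso:
  assumes wf: "wf_graph G" and i: "curve_iso (G, l) (H, p)"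
  shows "jac_equiv (G, l) (H, p)"
proof -
  obtain f k where f: "bij_betw f (verts G) (verts H)" and k: "bij_betw k (edges G) (edges H)"
    and h: "\<And>e. e \<in> edges G \<Longrightarrow> ends H (k e) = f ` ends G e \<and> p (k e) = l e"
    and w: "\<And>v. v \<in> verts G \<Longrightarrow> wt H (f v) = wt G v"
    using i unfolding curve_iso_iff by blast
  have finE: "finite (edges G)" using wf by (simp add: wf_graph_def)
  then have finE': "finite (edges H)" using k bij_betw_finite by blast
  have "\<exists>b. \<forall>s. hend H (k e, s) = f (hend G (e, s \<noteq> b))" if "e \<in> edges G" for e
    using ends_flip h[OF that] by blast
  then obtain b where b: "\<And>e s. e \<in> edges G \<Longrightarrow> hend H (k e, s) = f (hend G (e, s \<noteq> b e))" by metis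
  \<comment> \<open>Isomorphisms may reverse edges. The sign adjusts the orientation and disappears
    in the squares of the form.\<close>
  define \<sigma> where "\<sigma> e = (if b e then -1 else 1 :: int)" for e
  have \<sigma>2: "\<sigma> e * \<sigma> e = 1" for e by (simp add: \<sigma>_def)
  have inc: "inc H (k e) (f v) = \<sigma> e * inc G e v" if e: "e \<in> edges G" and v: "v \<in> verts G" for e v
  proof -
    have "hend G (e, s) \<in> verts G" for s using wf e by (auto simp: wf_graph_def hend_def)
    then have "f (hend G (e, s)) = f v \<longleftrightarrow> hend G (e, s) = v" for s
      using f v by (auto simp: bij_betw_def inj_on_def)
    from this[of True] this[of False] show ?thesis
      using b[OF e, of True] b[OF e, of False] by (cases "b e") (simp_all add: inc_def \<sigma>_def)
  qed
  define k' where "k' = inv_into (edges G) k"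
  have k': "k' e \<in> edges G" "k (k' e) = e" if "e \<in> edges H" for e
    using k that by (auto simp: k'_def bij_betw_def inv_into_into f_inv_into_f)
  have k'k: "k' (k e) = e" "k e \<in> edges H" if "e \<in> edges G" for e
    using k that by (auto simp: k'_def bij_betw_def)
  define A where "A x = (\<lambda>e. if e \<in> edges H then \<sigma> (k' e) * x (k' e) else 0)" for x :: "nat \<Rightarrow> int"
  define B where "B y = (\<lambda>e. if e \<in> edges G then \<sigma> e * y (k e) else 0)" for y :: "nat \<Rightarrow> int"
  have reI: "(\<Sum>e\<in>edges H. F e) = (\<Sum>e\<in>edges G. F (k e))" for F :: "nat \<Rightarrow> int"
    using sum.reindex_bij_betw[OF k, of F] by simp
  have reR: "(\<Sum>e\<in>edges H. F e) = (\<Sum>e\<in>edges G. F (k e))" for F :: "nat \<Rightarrow> real"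
    using sum.reindex_bij_betw[OF k, of F] by simp
  have im: "f ` verts G = verts H" using f by (simp add: bij_betw_def)
  show ?thesis
  proof (rule jac_equivI[of _ _ A B])
    show "(\<Sum>v\<in>verts H. wt H v) = (\<Sum>v\<in>verts G. wt G v)"
      using sum.reindex_bij_betw[OF f, of "wt H"] w by simp
    show "A x \<in> cycles H" if x: "x \<in> cycles G" for x
    proof -
      have "(\<Sum>e\<in>edges H. A x e * inc H e u) = 0" if u: "u \<in> verts H" for u
      proof -
        obtain v where v: "v \<in> verts G" "u = f v" using im u by blast
        have "(\<Sum>e\<in>edges H. A x e * inc H e u) = (\<Sum>e\<in>edges G. x e * inc G e v)"
          unfolding reI
        proof (rule sum.cong[OF refl])
          fix e assume e: "e \<in> edges G"
          have "A x (k e) * inc H (k e) u = (\<sigma> e * \<sigma> e) * (x e * inc G e v)"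
            using inc[OF e v(1)] k'k[OF e] v(2) by (simp add: A_def)
          then show "A x (k e) * inc H (k e) u = x e * inc G e v" by (simp add: \<sigma>2)
        qed
        then show ?thesis using x v by (simp add: cycles_iff[OF finE])
      qed
      then show ?thesis by (simp add: cycles_iff[OF finE'] A_def)
    qed
    show "B y \<in> cycles G" if y: "y \<in> cycles H" for y
    proof -
      have "(\<Sum>e\<in>edges G. B y e * inc G e v) = 0" if v: "v \<in> verts G" for v
      proof -
        have "(\<Sum>e\<in>edges G. B y e * inc G e v) = (\<Sum>e\<in>edges H. y e * inc H e (f v))"
          unfolding reI by (rule sum.cong[OF refl]) (simp add: B_def inc[OF _ v])
        moreover have "f v \<in> verts H" using im v by blast
        ultimately show ?thesis using y by (simp add: cycles_iff[OF finE'])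
      qed
      then show ?thesis by (simp add: cycles_iff[OF finE] B_def)
    qed
    show "B (A x) = x" if x: "x \<in> cycles G" for x
    proof
      fix e show "B (A x) e = x e"
      proof (cases "e \<in> edges G")
        case True
        then have "B (A x) e = (\<sigma> e * \<sigma> e) * x e" using k'k[OF True] by (simp add: A_def B_def)
        then show ?thesis by (simp add: \<sigma>2)
      next
        case False
        then show ?thesis using x by (simp add: B_def cycles_iff[OF finE])
      qed
    qed
    show "A (B y) = y" if y: "y \<in> cycles H" for y
    proof
      fix e show "A (B y) e = y e"
      proof (cases "e \<in> edges H")
        case True
        then have "A (B y) e = (\<sigma> (k' e) * \<sigma> (k' e)) * y e" using k'[OF True] by (simp add: A_def B_def)
        then show ?thesis by (simp add: \<sigma>2)
      next
        case False
        then show ?thesis using y by (simp add: A_def cycles_iff[OF finE'])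
      qed
    qed
    show "A (\<lambda>e. x e + y e) = (\<lambda>e. A x e + A y e)" for x y
      by (auto simp: A_def fun_eq_iff distrib_left)
    show "(\<Sum>e\<in>edges H. p e * (real_of_int (A x e))\<^sup>2) = (\<Sum>e\<in>edges G. l e * (real_of_int (x e))\<^sup>2)" for x
      unfolding reR
    proof (rule sum.cong[OF refl])
      fix e assume e: "e \<in> edges G"
      have "(real_of_int (A x (k e)))\<^sup>2 = (real_of_int (x e))\<^sup>2"
        using k'k[OF e] by (simp add: A_def \<sigma>_def)
      then show "p (k e) * (real_of_int (A x (k e)))\<^sup>2 = l e * (real_of_int (x e))\<^sup>2" using h[OF e] by simp
    qed
  qed
qed

text \<open>Sum of the conservation laws over the vertices in \<open>X\<close>; edges inside
  \<open>X\<close> cancel.\<close>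

lemma cycle_cut:
  assumes wf: "wf_graph G" and x: "x \<in> cycles G" and X: "X \<subseteq> verts G"
  shows "(\<Sum>e\<in>cut G X. x e * (of_bool (tgt G e \<in> X) - of_bool (src G e \<in> X))) = 0"
proof -
  have fin: "finite (edges G)" "finite X" using wf X finite_subset[OF X] by (simp_all add: wf_graph_def)
  have "0 = (\<Sum>v\<in>X. \<Sum>e\<in>edges G. x e * inc G e v)"
    using x X by (subst sum.neutral) (auto simp: cycles_iff[OF fin(1)])
  also have "\<dots> = (\<Sum>e\<in>edges G. \<Sum>v\<in>X. x e * inc G e v)" by (rule sum.swap)
  also have "\<dots> = (\<Sum>e\<in>edges G. x e * (of_bool (tgt G e \<in> X) - of_bool (src G e \<in> X)))"
  proof (rule sum.cong[OF refl])
    fix e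
    have "(\<Sum>v\<in>X. of_bool (a = v)) = (of_bool (a \<in> X) :: int)" for a
      using fin(2) by (simp add: of_bool_def)
    then show "(\<Sum>v\<in>X. x e * inc G e v) = x e * (of_bool (tgt G e \<in> X) - of_bool (src G e \<in> X))"
      by (simp add: inc_def sum_distrib_left[symmetric] sum_subtractf)
  qed
  also have "\<dots> = (\<Sum>e\<in>cut G X. x e * (of_bool (tgt G e \<in> X) - of_bool (src G e \<in> X)))"
    by (rule sum.mono_neutral_right[OF fin(1)]) (auto simp: cut_def)
  finally show ?thesis by simp
qed

section \<open>Contracting an edge without changing the Jacobian\<close>

definition merge :: "wgraph \<Rightarrow> nat \<Rightarrow> wgraph" where
  "merge G e = \<lparr>verts = verts G - {tgt G e}, edges = edges G - {e},
    src = (\<lambda>x. if src G x = tgt G e then src G e else src G x),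
    tgt = (\<lambda>x. if tgt G x = tgt G e then src G e else tgt G x),
    wt = (\<lambda>u. if u = src G e then wt G (src G e) + wt G (tgt G e) else wt G u)\<rparr>"

lemma merge_simps [simp]:
  "verts (merge G e) = verts G - {tgt G e}" "edges (merge G e) = edges G - {e}"
  "src (merge G e) x = (if src G x = tgt G e then src G e else src G x)"
  "tgt (merge G e) x = (if tgt G x = tgt G e then src G e else tgt G x)"
  "wt (merge G e) u = (if u = src G e then wt G (src G e) + wt G (tgt G e) else wt G u)"
  by (simp_all add: merge_def)

lemma merge_wf:
  assumes wf: "wf_graph G" and e: "e \<in> edges G" "src G e \<noteq> tgt G e"
  shows "wf_graph (merge G e)"
proof -
  have "src G e \<in> verts G" using wf e by (simp add: wf_graph_def)
  then show ?thesis using wf e(2) by (simp add: wf_graph_def)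
qed

lemma merge_SG:
  assumes G: "G \<in> SG g" and e: "e \<in> edges G" "src G e \<noteq> tgt G e"
  shows "merge G e \<in> SG g"
  by (rule contracts_SG[OF G merge_wf[OF SGD(1)[OF G] e] _ contracts_merge[OF SGD(1)[OF G] e]])
    (use e in simp_all)

lemma merge_wt_sum:
  assumes wf: "wf_graph G" and e: "e \<in> edges G" "src G e \<noteq> tgt G e"
  shows "(\<Sum>v\<in>verts (merge G e). wt (merge G e) v) = (\<Sum>v\<in>verts G. wt G v)"
proof -
  let ?a = "src G e" and ?b = "tgt G e"
  have fin: "finite (verts G)" and ab: "?a \<in> verts G" "?b \<in> verts G" using wf e by (auto simp: wf_graph_def)
  have a: "?a \<in> verts G - {?b}" using ab e(2) by simp
  have finb: "finite (verts G - {?b})" using fin by simp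
  have "(\<Sum>v\<in>verts (merge G e). wt (merge G e) v) =
      wt G ?a + wt G ?b + (\<Sum>v\<in>verts G - {?b} - {?a}. wt (merge G e) v)"
    using sum.remove[OF finb a, of "wt (merge G e)"] by simp
  also have "(\<Sum>v\<in>verts G - {?b} - {?a}. wt (merge G e) v) = (\<Sum>v\<in>verts G - {?b} - {?a}. wt G v)"
    by (rule sum.cong) auto
  finally show ?thesis
    using sum.remove[OF fin ab(2), of "wt G"] sum.remove[OF finb a, of "wt G"] by simp
qed

text \<open>Contracting an edge that is not a loop preserves the cycle lattice: one forgets the
  coordinate at \<open>e\<close> and recovers it from conservation at the target of
  \<open>e\<close>. The new lengths stay free, so that bridges and 2-edge cuts are treated
  alike.\<close>

lemma jac_merge:
  assumes wf: "wf_graph G" and e: "e \<in> edges G" "src G e \<noteq> tgt G e"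
    and q: "\<And>x. x \<in> cycles G \<Longrightarrow>
      (\<Sum>i\<in>edges G - {e}. p i * (real_of_int (x i))\<^sup>2) = (\<Sum>i\<in>edges G. l i * (real_of_int (x i))\<^sup>2)"
  shows "jac_equiv (G, l) (merge G e, p)"
proof -
  define a b where "a = src G e" and "b = tgt G e"
  let ?K = "merge G e" and ?E = "edges G - {e}"
  have ab: "a \<in> verts G" "b \<in> verts G" "a \<noteq> b" using wf e by (auto simp: a_def b_def wf_graph_def)
  have fin: "finite (edges G)" "finite (edges ?K)" using wf by (auto simp: wf_graph_def)
  have ince: "inc G e a = -1" "inc G e b = 1" "\<And>u. u \<noteq> a \<Longrightarrow> u \<noteq> b \<Longrightarrow> inc G e u = 0"
    using ab by (auto simp: inc_def a_def b_def)
  have incu: "inc ?K i u = inc G i u" if "u \<noteq> a" "u \<noteq> b" for i u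
    using that by (simp add: inc_def a_def b_def)
  have inca: "inc ?K i a = inc G i a + inc G i b" for i
    using ab(3) by (simp add: inc_def a_def b_def)
  have rem: "(\<Sum>i\<in>edges G. x i * inc G i u) = x e * inc G e u + (\<Sum>i\<in>?E. x i * inc G i u)" for x :: "nat \<Rightarrow> int" and u
    by (rule sum.remove[OF fin(1) e(1)])
  define A where "A x = x(e := 0)" for x :: "nat \<Rightarrow> int"
  define B where "B y = y(e := - (\<Sum>i\<in>?E. y i * inc G i b))" for y :: "nat \<Rightarrow> int"
  have AE: "(\<Sum>i\<in>?E. A x i * F i) = (\<Sum>i\<in>?E. x i * F i)" for x F by (rule sum.cong) (auto simp: A_def)
  have BE: "(\<Sum>i\<in>?E. B y i * F i) = (\<Sum>i\<in>?E. y i * F i)" for y F by (rule sum.cong) (auto simp: B_def)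
  have sK: "(\<Sum>i\<in>?E. y i * inc ?K i a) = (\<Sum>i\<in>?E. y i * inc G i a) + (\<Sum>i\<in>?E. y i * inc G i b)"
    for y :: "nat \<Rightarrow> int" by (simp add: inca distrib_left sum.distrib)
  have cG: "x \<in> cycles G \<longleftrightarrow> (\<forall>e. e \<notin> edges G \<longrightarrow> x e = 0) \<and>
      (\<forall>u\<in>verts G. x e * inc G e u + (\<Sum>i\<in>?E. x i * inc G i u) = 0)" for x
    unfolding cycles_iff[OF fin(1)] rem ..
  have cK: "y \<in> cycles ?K \<longleftrightarrow> (\<forall>i. i \<notin> ?E \<longrightarrow> y i = 0) \<and> (\<forall>u\<in>verts G - {b}. (\<Sum>i\<in>?E. y i * inc ?K i u) = 0)" for y
    unfolding cycles_iff[OF fin(2)] merge_simps b_def ..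
  show ?thesis
  proof (rule jac_equivI[of _ _ A B])
    show "(\<Sum>v\<in>verts ?K. wt ?K v) = (\<Sum>v\<in>verts G. wt G v)" by (rule merge_wt_sum[OF wf e])
    show "A x \<in> cycles ?K" if x: "x \<in> cycles G" for x
    proof -
      have "(\<Sum>i\<in>?E. A x i * inc ?K i u) = 0" if u: "u \<in> verts G - {b}" for u
      proof (cases "u = a")
        case True
        \<comment> \<open>Adding the conservation laws at \<open>a\<close> and \<open>b\<close>
          eliminates \<open>x e\<close>, since \<open>e\<close> leaves \<open>a\<close> and enters
          \<open>b\<close>.\<close>
        have "x e * inc G e a + (\<Sum>i\<in>?E. x i * inc G i a) = 0" "x e * inc G e b + (\<Sum>i\<in>?E. x i * inc G i b) = 0"
          using x ab unfolding cG by blast+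
        then show ?thesis unfolding AE True sK ince by simp
      next
        case False
        have "x e * inc G e u + (\<Sum>i\<in>?E. x i * inc G i u) = 0" using x u unfolding cG by blast
        then show ?thesis unfolding AE using False u ince(3)[of u] incu[of u] by simp
      qed
      moreover have "A x i = 0" if "i \<notin> ?E" for i using x that unfolding cG A_def by auto
      ultimately show ?thesis unfolding cK by blast
    qed
    show "B y \<in> cycles G" if y: "y \<in> cycles ?K" for y
    proof -
      have Be: "B y e = - (\<Sum>i\<in>?E. y i * inc G i b)" by (simp add: B_def)
      have "B y e * inc G e u + (\<Sum>i\<in>?E. B y i * inc G i u) = 0" if u: "u \<in> verts G" for u
      proof -
        consider "u = b" | "u = a" | "u \<noteq> a" "u \<noteq> b" by blast
        then show ?thesis
        proof cases
          case 1 then show ?thesis unfolding BE Be by (simp add: ince)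
        next
          case 2
          have "(\<Sum>i\<in>?E. y i * inc ?K i a) = 0" using y ab unfolding cK by blast
          then show ?thesis using 2 unfolding BE Be sK by (simp add: ince)
        next
          case 3
          have "(\<Sum>i\<in>?E. y i * inc ?K i u) = 0" using y u 3 unfolding cK by blast
          then show ?thesis using 3 unfolding BE by (simp add: ince incu)
        qed
      qed
      moreover have "B y i = 0" if "i \<notin> edges G" for i using y that e(1) unfolding cK B_def by auto
      ultimately show ?thesis unfolding cG by blast
    qed
    show "B (A x) = x" if x: "x \<in> cycles G" for x
    proof -
      have "x e * inc G e b + (\<Sum>i\<in>?E. x i * inc G i b) = 0" using x ab(2) unfolding cG by blast
      then have "x e = - (\<Sum>i\<in>?E. x i * inc G i b)" by (simp add: ince)
      then show ?thesis unfolding B_def AE by (simp add: A_def fun_eq_iff)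
    qed
    show "A (B y) = y" if y: "y \<in> cycles ?K" for y
    proof -
      have "y e = 0" using y unfolding cK by blast
      then show ?thesis by (simp add: A_def B_def fun_eq_iff)
    qed
    show "A (\<lambda>e. x e + y e) = (\<lambda>e. A x e + A y e)" for x y by (simp add: A_def fun_eq_iff)
    show "(\<Sum>i\<in>edges ?K. p i * (real_of_int (A x i))\<^sup>2) = (\<Sum>i\<in>edges G. l i * (real_of_int (x i))\<^sup>2)"
      if x: "x \<in> cycles G" for x
    proof -
      have "(\<Sum>i\<in>?E. p i * (real_of_int (A x i))\<^sup>2) = (\<Sum>i\<in>?E. p i * (real_of_int (x i))\<^sup>2)"
        by (rule sum.cong) (auto simp: A_def)
      then show ?thesis using q[OF x] by simp
    qed
  qed
qed

text \<open>A cycle vanishes on a bridge and takes values of equal modulus on the two edges of a 2-edge cut,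
  so contracting one of these edges and lengthening the other keeps the Jacobian.\<close>

lemma jac_reduce:
  assumes G: "G \<in> SG g" and n: "\<not> three_edge_connected G" and l: "l \<in> pos_orth G"
  shows "\<exists>e m. e \<in> edges G \<and> src G e \<noteq> tgt G e \<and> m \<in> pos_orth (merge G e) \<and> jac_equiv (G, l) (merge G e, m)"
proof -
  note wf = SGD(1)[OF G]
  have ne: "verts G \<noteq> {}" using SGD(2)[OF G] connected_iff_cut[OF wf] by blast
  then obtain X where X: "X \<subseteq> verts G" "X \<noteq> {}" "X \<noteq> verts G" "\<not> 3 \<le> card (cut G X)"
    using n tec_iff_cut[OF wf] by blast
  have fin: "finite (edges G)" "finite (cut G X)" using wf finite_cut[OF wf] by (auto simp: wf_graph_def)
  have "cut G X \<noteq> {}" using SGD(2)[OF G] connected_iff_cut[OF wf] X by blast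
  then obtain e where e: "e \<in> cut G X" by blast
  then have eE: "e \<in> edges G" "src G e \<noteq> tgt G e" by (auto simp: cut_def)
  have sg: "(src G e \<in> X) \<noteq> (tgt G e \<in> X)" using e by (simp add: cut_def)
  have "card (cut G X - {e}) \<le> 1" using X(4) e fin(2) by simp
  then consider "cut G X - {e} = {}" | f where "cut G X - {e} = {f}"
    using fin(2) by (metis One_nat_def card_0_eq card_1_singletonE finite_Diff le_SucE le_zero_eq)
  then show ?thesis
  proof cases
    case 1
    then have c: "cut G X = {e}" using e by blast
    have "jac_equiv (G, l) (merge G e, l(e := 0))"
    proof (rule jac_merge[OF wf eE])
      fix x assume x: "x \<in> cycles G"
      have "x e * (of_bool (tgt G e \<in> X) - of_bool (src G e \<in> X)) = 0"
        using cycle_cut[OF wf x X(1)] unfolding c by simp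
      then have "x e = 0" using sg by (cases "src G e \<in> X") simp_all
      then have "(\<Sum>i\<in>edges G. l i * (real_of_int (x i))\<^sup>2) = (\<Sum>i\<in>edges G - {e}. l i * (real_of_int (x i))\<^sup>2)"
        using sum.remove[OF fin(1) eE(1), of "\<lambda>i. l i * (real_of_int (x i))\<^sup>2"] by simp
      also have "\<dots> = (\<Sum>i\<in>edges G - {e}. (l(e := 0)) i * (real_of_int (x i))\<^sup>2)"
        by (rule sum.cong) auto
      finally show "(\<Sum>i\<in>edges G - {e}. (l(e := 0)) i * (real_of_int (x i))\<^sup>2) = (\<Sum>i\<in>edges G. l i * (real_of_int (x i))\<^sup>2)"
        by simp
    qed
    moreover have "l(e := 0) \<in> pos_orth (merge G e)" using l by (simp add: pos_orth_def)
    ultimately show ?thesis using eE by blast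
  next
    case (2 f)
    then have c: "cut G X = {e, f}" "f \<noteq> e" using e by blast+
    then have f: "f \<in> cut G X" by blast
    then have fE: "f \<in> edges G" by (simp add: cut_def)
    let ?m = "l(e := 0, f := l e + l f)"
    have fm: "f \<in> edges G - {e}" "finite (edges G - {e})" using fE c(2) fin(1) by auto
    have "jac_equiv (G, l) (merge G e, ?m)"
    proof (rule jac_merge[OF wf eE])
      fix x assume x: "x \<in> cycles G"
      have "x e * (of_bool (tgt G e \<in> X) - of_bool (src G e \<in> X)) +
          x f * (of_bool (tgt G f \<in> X) - of_bool (src G f \<in> X)) = 0"
        using cycle_cut[OF wf x X(1)] c(2) unfolding c(1) by simp
      \<comment> \<open>The sign records whether \<open>e\<close> and \<open>f\<close> cross the cut
        in the same direction; the form sees only the squares.\<close>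
      then have "x e = x f \<or> x e = - x f"
        using sg f by (cases "src G e \<in> X"; cases "src G f \<in> X") (simp_all add: cut_def)
      then have sq: "(real_of_int (x e))\<^sup>2 = (real_of_int (x f))\<^sup>2" by auto
      let ?q = "\<lambda>i. (real_of_int (x i))\<^sup>2"
      have "(\<Sum>i\<in>edges G - {e}. ?m i * ?q i) = (l e + l f) * ?q f + (\<Sum>i\<in>edges G - {e} - {f}. ?m i * ?q i)"
        using sum.remove[OF fm(2,1), of "\<lambda>i. ?m i * ?q i"] by simp
      also have "(\<Sum>i\<in>edges G - {e} - {f}. ?m i * ?q i) = (\<Sum>i\<in>edges G - {e} - {f}. l i * ?q i)"
        by (rule sum.cong) auto
      also have "(l e + l f) * ?q f + \<dots> = l e * ?q e + (l f * ?q f + (\<Sum>i\<in>edges G - {e} - {f}. l i * ?q i))"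
        by (simp add: sq distrib_right)
      also have "l f * ?q f + (\<Sum>i\<in>edges G - {e} - {f}. l i * ?q i) = (\<Sum>i\<in>edges G - {e}. l i * ?q i)"
        using sum.remove[OF fm(2,1), of "\<lambda>i. l i * ?q i"] by simp
      also have "l e * ?q e + \<dots> = (\<Sum>i\<in>edges G. l i * ?q i)"
        using sum.remove[OF fin(1) eE(1), of "\<lambda>i. l i * ?q i"] by simp
      finally show "(\<Sum>i\<in>edges G - {e}. ?m i * ?q i) = (\<Sum>i\<in>edges G. l i * ?q i)" .
    qed
    moreover have "l e > 0" "l f > 0" using l eE fE by (auto simp: pos_orth_def)
    then have "l e + l f > 0" by (rule add_pos_pos)
    then have "?m \<in> pos_orth (merge G e)" using l fE c(2) by (simp add: pos_orth_def)
    ultimately show ?thesis using eE by blast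
  qed
qed

text \<open>Each reduction removes an edge that is not a loop, so it creates no weight, and the
  number of edges bounds the number of reductions.\<close>

lemma jac_tec:
  assumes "G \<in> SG g" "l \<in> pos_orth G"
  shows "\<exists>H m. H \<in> SG g \<and> three_edge_connected H \<and> m \<in> pos_orth H \<and> jac_equiv (G, l) (H, m) \<and>
    (pure_graph G \<longrightarrow> pure_graph H)"
  using assms
proof (induction "card (edges G)" arbitrary: G l rule: less_induct)
  case less
  show ?case
  proof (cases "three_edge_connected G")
    case True
    then show ?thesis using less.prems jac_refl by blast
  next
    case False
    obtain e m where e: "e \<in> edges G" "src G e \<noteq> tgt G e" "m \<in> pos_orth (merge G e)"
      "jac_equiv (G, l) (merge G e, m)" using jac_reduce[OF less.prems(1) False less.prems(2)] by blast
    have "finite (edges G)" "src G e \<in> verts G" "tgt G e \<in> verts G"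
      using SGD(1)[OF less.prems(1)] e(1) by (auto simp: wf_graph_def)
    then have c: "card (edges (merge G e)) < card (edges G)"
      and p: "pure_graph G \<Longrightarrow> pure_graph (merge G e)"
      using card_Diff1_less[OF _ e(1)] by (simp_all add: pure_graph_def)
    obtain H k where "H \<in> SG g" "three_edge_connected H" "k \<in> pos_orth H" "jac_equiv (merge G e, m) (H, k)"
      "pure_graph (merge G e) \<longrightarrow> pure_graph H"
      using less.hyps[OF c merge_SG[OF less.prems(1) e(1,2)] e(3)] by blast
    then show ?thesis using jac_trans[OF e(4)] p by blast
  qed
qed

lemma schcls_eq:
  assumes G: "wf_graph G" and H: "wf_graph H" and j: "jac_equiv (G, l) (H, m)" and P: "P \<subseteq> Mtrop_pts g"
  shows "schcls P (cls (G, l)) = schcls P (cls (H, m))"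
proof -
  \<comment> \<open>Isomorphic curves have equivalent Jacobians, so the representative on the left
    may be fixed.\<close>
  have j1: "jequiv (cls (K, p)) r \<longleftrightarrow> (\<exists>d\<in>r. jac_equiv (K, p) d)" if "wf_graph K" for K p r
  proof -
    have "jac_equiv (K, p) c" if "c \<in> cls (K, p)" for c
      using jac_of_iso[OF \<open>wf_graph K\<close>, of p "fst c" "snd c"] that by (simp add: cls_def)
    then show ?thesis unfolding jequiv_def using jac_trans cls_self by blast
  qed
  have "(\<exists>d\<in>r. jac_equiv (G, l) d) \<longleftrightarrow> (\<exists>d\<in>r. jac_equiv (H, m) d)" for r
    using jac_trans[OF j] jac_trans[OF jac_sym[OF j]] by blast
  then show ?thesis unfolding schcls_def j1[OF G] j1[OF H] by simp
qed

section \<open>Purity and connectedness\<close>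

text \<open>Strata of codimension at most one carry no weights, so a single connected set serves the
  full and the pure spaces.\<close>

lemma conn_set_eq:
  assumes g: "g \<ge> 2"
  shows "\<Union>{S. \<exists>k. (S, k) \<in> cellsM3 g \<and> k + 1 \<ge> 3 * g - 3} = codim1 g"
    and "\<Union>{S. \<exists>k. (S, k) \<in> cellsMpure3 g \<and> k + 1 \<ge> 3 * g - 3} = codim1 g"
proof -
  have "{S. \<exists>k. (S, k) \<in> cellsM3 g \<and> k + 1 \<ge> 3 * g - 3} =
      {stratum G | G. G \<in> SG g \<and> three_edge_connected G \<and> 3 * g - 3 \<le> card (edges G) + 1}"
    unfolding cellsM3_def by blast
  then show "\<Union>{S. \<exists>k. (S, k) \<in> cellsM3 g \<and> k + 1 \<ge> 3 * g - 3} = codim1 g"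
    unfolding codim1_def by simp
  have "{S. \<exists>k. (S, k) \<in> cellsMpure3 g \<and> k + 1 \<ge> 3 * g - 3} =
      {stratum G | G. G \<in> SG g \<and> three_edge_connected G \<and> 3 * g - 3 \<le> card (edges G) + 1}"
    unfolding cellsMpure3_def using SG_tec_codim_le_one_pure[OF _ _ g] by blast
  then show "\<Union>{S. \<exists>k. (S, k) \<in> cellsMpure3 g \<and> k + 1 \<ge> 3 * g - 3} = codim1 g"
    unfolding codim1_def by simp
qed

lemma codim1_pure:
  assumes "g \<ge> 2"
  shows "codim1 g \<subseteq> \<Union>{stratum G | G. G \<in> SG g \<and> pure_graph G \<and> three_edge_connected G}"
  unfolding codim1_def using SG_tec_codim_le_one_pure[OF _ _ assms] by blast

lemma Union_image_setcompr: "\<Union>{f ` s x | x. Q x} = f ` \<Union>{s x | x. Q x}"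
  by blast

definition topcells :: "nat \<Rightarrow> tcurve set set" where
  "topcells g = \<Union>{stratum G | G. G \<in> SG g \<and> pure_graph G \<and> three_edge_connected G \<and> card (edges G) = 3 * g - 3}"

lemma open_meets_topcells:
  assumes "openin (Mtrop g) U" "g \<ge> 2" "G \<in> SG g" "three_edge_connected G" "l \<in> pos_orth G" "cls (G, l) \<in> U"
  shows "\<exists>p \<in> topcells g. p \<in> U"
proof -
  obtain H m where H: "H \<in> SG g" "m \<in> pos_orth H" "three_edge_connected H" "card (edges H) = 3 * g - 3"
    "cls (H, m) \<in> U" using open_top[OF assms] by blast
  have "pure_graph H" by (rule SG_tec_codim_le_one_pure[OF H(1,3) assms(2)]) (simp add: H(4))
  then have "cls (H, m) \<in> topcells g" using H unfolding topcells_def stratum_def by blast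
  then show ?thesis using H(5) by blast
qed

lemma topcells_eq:
  assumes g: "g \<ge> 2"
  shows "\<Union>{S. (S, 3 * g - 3) \<in> cellsM3 g} = topcells g" "\<Union>{S. (S, 3 * g - 3) \<in> cellsMpure3 g} = topcells g"
    "\<Union>{S. (S, 3 * g - 3) \<in> cellsSch g} = schcls (Mtrop_pts g) ` topcells g"
    "\<Union>{S. (S, 3 * g - 3) \<in> cellsSch_pure g} = schcls (Mpure_pts g) ` topcells g"
proof -
  have p: "pure_graph G" if "G \<in> SG g" "three_edge_connected G" "card (edges G) = 3 * g - 3" for G
    using SG_tec_codim_le_one_pure[OF that(1,2) g] that(3) by simp
  have 1: "{S. (S, 3 * g - 3) \<in> cellsM3 g} =
     {stratum G | G. G \<in> SG g \<and> pure_graph G \<and> three_edge_connected G \<and> card (edges G) = 3 * g - 3}"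
    unfolding cellsM3_def mem_Collect_eq prod.inject by (intro Collect_cong ex_cong1) (use p in auto)
  have 2: "{S. (S, 3 * g - 3) \<in> cellsMpure3 g} =
     {stratum G | G. G \<in> SG g \<and> pure_graph G \<and> three_edge_connected G \<and> card (edges G) = 3 * g - 3}"
    unfolding cellsMpure3_def mem_Collect_eq prod.inject by (intro Collect_cong ex_cong1) (use p in auto)
  have 3: "{S. (S, 3 * g - 3) \<in> cellsSch g} =
     {schcls (Mtrop_pts g) ` stratum G | G. G \<in> SG g \<and> pure_graph G \<and> three_edge_connected G \<and> card (edges G) = 3 * g - 3}"
    unfolding cellsSch_def mem_Collect_eq prod.inject by (intro Collect_cong ex_cong1) (use p in auto)
  have 4: "{S. (S, 3 * g - 3) \<in> cellsSch_pure g} =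
     {schcls (Mpure_pts g) ` stratum G | G. G \<in> SG g \<and> pure_graph G \<and> three_edge_connected G \<and> card (edges G) = 3 * g - 3}"
    unfolding cellsSch_pure_def mem_Collect_eq prod.inject by (intro Collect_cong ex_cong1) (use p in auto)
  show "\<Union>{S. (S, 3 * g - 3) \<in> cellsM3 g} = topcells g" "\<Union>{S. (S, 3 * g - 3) \<in> cellsMpure3 g} = topcells g"
    "\<Union>{S. (S, 3 * g - 3) \<in> cellsSch g} = schcls (Mtrop_pts g) ` topcells g"
    "\<Union>{S. (S, 3 * g - 3) \<in> cellsSch_pure g} = schcls (Mpure_pts g) ` topcells g"
    unfolding 1 2 3 4 topcells_def by (simp_all only: Union_image_setcompr)
qed

lemma pure_dim_subtopology:
  assumes g: "g \<ge> 2" and Y: "Y \<subseteq> {cls (G, l) | G l. G \<in> SG g \<and> three_edge_connected G \<and> l \<in> pos_orth G}"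
    and C: "\<And>S k. (S, k) \<in> C \<Longrightarrow> k \<le> 3 * g - 3" "\<Union>{S. (S, 3 * g - 3) \<in> C} = topcells g" and t: "topcells g \<subseteq> Y"
  shows "pure_dim (subtopology (Mtrop g) Y) C (3 * g - 3)"
  unfolding pure_dim_def
proof (intro conjI subsetI)
  show "\<forall>(S, k)\<in>C. k \<le> 3 * g - 3" using C(1) by blast
  fix x assume x: "x \<in> topspace (subtopology (Mtrop g) Y)"
  then have "x \<in> Y" by simp
  then obtain G l where G: "x = cls (G, l)" "G \<in> SG g" "three_edge_connected G" "l \<in> pos_orth G" using Y by blast
  show "x \<in> subtopology (Mtrop g) Y closure_of \<Union>{S. (S, 3 * g - 3) \<in> C}"
    unfolding C(2) in_closure_of
  proof (intro conjI allI impI x)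
    fix T assume T: "x \<in> T \<and> openin (subtopology (Mtrop g) Y) T"
    then obtain U where U: "openin (Mtrop g) U" "T = U \<inter> Y" unfolding openin_subtopology by blast
    then have "cls (G, l) \<in> U" using T G(1) by blast
    then obtain p where "p \<in> topcells g" "p \<in> U" using open_meets_topcells[OF U(1) g G(2-4)] by blast
    then show "\<exists>y. y \<in> topcells g \<and> y \<in> T" using U(2) t by blast
  qed
qed

section \<open>Quotient topologies and density of the maximal cells\<close>

lemma openin_quotient:
  "openin (final_topology {()} (\<lambda>_. X) (\<lambda>_. f) S) U \<longleftrightarrow> U \<subseteq> S \<and> openin X {x \<in> topspace X. f x \<in> U}"
  unfolding openin_final_topology by simp

lemma topspace_quotient:
  assumes "topspace X = P"
  shows "topspace (final_topology {()} (\<lambda>_. X) (\<lambda>_. f) (f ` P)) = f ` P" (is "topspace ?Q = _")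
proof -
  have "{x \<in> topspace X. f x \<in> f ` P} = topspace X" using assms by auto
  then have "openin ?Q (f ` P)" unfolding openin_quotient by simp
  moreover have "topspace ?Q \<subseteq> f ` P" using openin_topspace[of ?Q] unfolding openin_quotient by blast
  ultimately show ?thesis using openin_subset by blast
qed

lemma continuous_quotient:
  assumes "topspace X = P"
  shows "continuous_map X (final_topology {()} (\<lambda>_. X) (\<lambda>_. f) (f ` P)) f"
  unfolding continuous_map_def topspace_quotient[OF assms] openin_quotient using assms by auto

lemma topspace_Mpure: "topspace (Mpure g) = Mpure_pts g"
proof -
  have "Mpure_pts g \<subseteq> Mtrop_pts g" unfolding Mpure_pts_def stratum_def using cls_in_Mtrop by blast
  then show ?thesis unfolding Mpure_def topspace_subtopology topspace_Mtrop by blast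
qed

text \<open>Every class has a 3-edge-connected representative. The preimage of an open set is open
  around it and therefore meets a maximal cell.\<close>

lemma pure_dim_quotient:
  assumes g: "g \<ge> 2" and P: "P \<subseteq> Mtrop_pts g" "topcells g \<subseteq> P" "topspace (subtopology (Mtrop g) P) = P"
    and red: "\<And>p. p \<in> P \<Longrightarrow> \<exists>H m. H \<in> SG g \<and> three_edge_connected H \<and> m \<in> pos_orth H \<and> cls (H, m) \<in> P \<and>
      schcls P p = schcls P (cls (H, m))"
    and C: "\<And>S k. (S, k) \<in> C \<Longrightarrow> k \<le> 3 * g - 3" "\<Union>{S. (S, 3 * g - 3) \<in> C} = schcls P ` topcells g"
  shows "pure_dim (final_topology {()} (\<lambda>_. subtopology (Mtrop g) P) (\<lambda>_. schcls P) (schcls P ` P)) C (3 * g - 3)"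
    (is "pure_dim ?Q _ _")
  unfolding pure_dim_def
proof (intro conjI subsetI)
  show "\<forall>(S, k)\<in>C. k \<le> 3 * g - 3" using C(1) by blast
  fix x assume x: "x \<in> topspace ?Q"
  then obtain p where p: "p \<in> P" "x = schcls P p" unfolding topspace_quotient[OF P(3)] by blast
  obtain H m where H: "H \<in> SG g" "three_edge_connected H" "m \<in> pos_orth H" "cls (H, m) \<in> P"
      "schcls P p = schcls P (cls (H, m))" using red[OF p(1)] by blast
  show "x \<in> ?Q closure_of \<Union>{S. (S, 3 * g - 3) \<in> C}"
    unfolding C(2) in_closure_of
  proof (intro conjI allI impI x)
    fix T assume T: "x \<in> T \<and> openin ?Q T"
    then have "openin (subtopology (Mtrop g) P) {z \<in> P. schcls P z \<in> T}"
      unfolding openin_quotient P(3) by blast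
    then obtain U where U: "openin (Mtrop g) U" "{z \<in> P. schcls P z \<in> T} = U \<inter> P"
      unfolding openin_subtopology by blast
    have "cls (H, m) \<in> {z \<in> P. schcls P z \<in> T}" using T p(2) H(4,5) by simp
    then have "cls (H, m) \<in> U" unfolding U(2) by blast
    then obtain y where y: "y \<in> topcells g" "y \<in> U" using open_meets_topcells[OF U(1) g H(1-3)] by blast
    then have "y \<in> {z \<in> P. schcls P z \<in> T}" unfolding U(2) using P(2) by blast
    then show "\<exists>z. z \<in> schcls P ` topcells g \<and> z \<in> T" using y(1) by blast
  qed
qed

lemma Mtrop_pts_reduce:
  assumes "p \<in> Mtrop_pts g"
  shows "\<exists>H m. H \<in> SG g \<and> three_edge_connected H \<and> m \<in> pos_orth H \<and> cls (H, m) \<in> Mtrop_pts g \<and>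
      schcls (Mtrop_pts g) p = schcls (Mtrop_pts g) (cls (H, m))"
proof -
  obtain G l where G: "p = cls (G, l)" "G \<in> SG g" "l \<in> pos_orth G" using assms unfolding Mtrop_pts_def by blast
  obtain H m where H: "H \<in> SG g" "three_edge_connected H" "m \<in> pos_orth H" "jac_equiv (G, l) (H, m)"
    using jac_tec[OF G(2,3)] by blast
  then show ?thesis
    using schcls_eq[OF SGD(1)[OF G(2)] SGD(1)[OF H(1)] H(4) order_refl] cls_in_Mtrop G(1) by blast
qed

lemma Mpure_pts_reduce:
  assumes "p \<in> Mpure_pts g"
  shows "\<exists>H m. H \<in> SG g \<and> three_edge_connected H \<and> m \<in> pos_orth H \<and> cls (H, m) \<in> Mpure_pts g \<and>
      schcls (Mpure_pts g) p = schcls (Mpure_pts g) (cls (H, m))"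
proof -
  obtain G l where G: "p = cls (G, l)" "G \<in> SG g" "l \<in> pos_orth G" "pure_graph G"
    using assms unfolding Mpure_pts_def stratum_def by blast
  obtain H m where H: "H \<in> SG g" "three_edge_connected H" "m \<in> pos_orth H" "jac_equiv (G, l) (H, m)" "pure_graph H"
    using jac_tec[OF G(2,3)] G(4) by blast
  have "cls (H, m) \<in> Mpure_pts g" unfolding Mpure_pts_def stratum_def using H by blast
  moreover have "Mpure_pts g \<subseteq> Mtrop_pts g" unfolding Mpure_pts_def stratum_def using cls_in_Mtrop by blast
  ultimately show ?thesis
    using schcls_eq[OF SGD(1)[OF G(2)] SGD(1)[OF H(1)] H(4)] H G(1) by blast
qed

theorem mainTheorem13:
  fixes g :: nat
  assumes "g \<ge> 2"
  shows "pure_dim (M3 g) (cellsM3 g) (3 * g - 3) \<and> conn_codim1 (M3 g) (cellsM3 g) (3 * g - 3) \<and>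
         pure_dim (Sch g) (cellsSch g) (3 * g - 3) \<and> conn_codim1 (Sch g) (cellsSch g) (3 * g - 3) \<and>
         pure_dim (Mpure3 g) (cellsMpure3 g) (3 * g - 3) \<and>
         conn_codim1 (Mpure3 g) (cellsMpure3 g) (3 * g - 3) \<and>
         pure_dim (Sch_pure g) (cellsSch_pure g) (3 * g - 3) \<and>
         conn_codim1 (Sch_pure g) (cellsSch_pure g) (3 * g - 3)"
proof -
  note g = assms
  note conn = codim1_connected[OF g]
  have le: "card (edges G) \<le> 3 * g - 3" if "G \<in> SG g" "three_edge_connected G" for G
    by (rule SG_tec_edges_le[OF that g])
  have tp: "topcells g \<subseteq> \<Union>{stratum G | G. G \<in> SG g \<and> pure_graph G \<and> three_edge_connected G}"
    unfolding topcells_def by blast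
  have pure_tec: "\<Union>{stratum G | G. G \<in> SG g \<and> pure_graph G \<and> three_edge_connected G} \<subseteq>
      \<Union>{stratum G | G. G \<in> SG g \<and> three_edge_connected G}" by blast
  have pure_pts: "\<Union>{stratum G | G. G \<in> SG g \<and> pure_graph G \<and> three_edge_connected G} \<subseteq> Mpure_pts g"
    unfolding Mpure_pts_def by blast
  have cp: "codim1 g \<subseteq> Mpure_pts g" using codim1_pure[OF g] pure_pts by (rule order_trans)
  have pM: "Mpure_pts g \<subseteq> Mtrop_pts g" unfolding Mpure_pts_def stratum_def using cls_in_Mtrop by blast
  \<comment> \<open>Presents the whole space as a subspace of itself, so that
    \<open>pure_dim_quotient\<close> covers both quotients.\<close>
  have Msub: "Mtrop g = subtopology (Mtrop g) (Mtrop_pts g)"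
    using subtopology_topspace[of "Mtrop g"] unfolding topspace_Mtrop by simp
  have conn_pure: "connectedin (Mpure g) (codim1 g)"
    unfolding Mpure_def connectedin_subtopology using conn cp by blast
  have 1: "pure_dim (M3 g) (cellsM3 g) (3 * g - 3)" unfolding M3_def
  proof (rule pure_dim_subtopology[OF g _ _ topcells_eq(1)[OF g]])
    show "\<Union>{stratum G | G. G \<in> SG g \<and> three_edge_connected G} \<subseteq>
        {cls (G, l) | G l. G \<in> SG g \<and> three_edge_connected G \<and> l \<in> pos_orth G}" unfolding stratum_def by blast
    show "k \<le> 3 * g - 3" if "(S, k) \<in> cellsM3 g" for S k using that le unfolding cellsM3_def by blast
    show "topcells g \<subseteq> \<Union>{stratum G | G. G \<in> SG g \<and> three_edge_connected G}" using tp pure_tec by (rule order_trans)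
  qed
  have 2: "pure_dim (Mpure3 g) (cellsMpure3 g) (3 * g - 3)" unfolding Mpure3_def
  proof (rule pure_dim_subtopology[OF g _ _ topcells_eq(2)[OF g] tp])
    show "\<Union>{stratum G | G. G \<in> SG g \<and> pure_graph G \<and> three_edge_connected G} \<subseteq>
        {cls (G, l) | G l. G \<in> SG g \<and> three_edge_connected G \<and> l \<in> pos_orth G}" unfolding stratum_def by blast
    show "k \<le> 3 * g - 3" if "(S, k) \<in> cellsMpure3 g" for S k using that le unfolding cellsMpure3_def by blast
  qed
  have 3: "conn_codim1 (M3 g) (cellsM3 g) (3 * g - 3)"
    unfolding conn_codim1_def conn_set_eq(1)[OF g] M3_def connectedin_subtopology
    using conn order_trans[OF codim1_pure[OF g] pure_tec] by simp
  have 4: "conn_codim1 (Mpure3 g) (cellsMpure3 g) (3 * g - 3)"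
    unfolding conn_codim1_def conn_set_eq(2)[OF g] Mpure3_def connectedin_subtopology
    using conn codim1_pure[OF g] by simp
  have 5: "pure_dim (Sch g) (cellsSch g) (3 * g - 3)" unfolding Sch_def
  proof (subst Msub, rule pure_dim_quotient[OF g order_refl _ _ Mtrop_pts_reduce _ topcells_eq(3)[OF g]])
    show "topcells g \<subseteq> Mtrop_pts g" using tp pure_pts pM by blast
    show "topspace (subtopology (Mtrop g) (Mtrop_pts g)) = Mtrop_pts g"
      by (simp add: topspace_Mtrop)
    show "k \<le> 3 * g - 3" if "(S, k) \<in> cellsSch g" for S k using that le unfolding cellsSch_def by blast
  qed
  have 6: "pure_dim (Sch_pure g) (cellsSch_pure g) (3 * g - 3)" unfolding Sch_pure_def Mpure_def
  proof (rule pure_dim_quotient[OF g pM _ _ Mpure_pts_reduce _ topcells_eq(4)[OF g]])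
    show "topcells g \<subseteq> Mpure_pts g" using tp pure_pts by (rule order_trans)
    show "topspace (subtopology (Mtrop g) (Mpure_pts g)) = Mpure_pts g"
      using topspace_Mpure by (simp only: Mpure_def)
    show "k \<le> 3 * g - 3" if "(S, k) \<in> cellsSch_pure g" for S k using that le unfolding cellsSch_pure_def by blast
  qed
  have 7: "conn_codim1 (Sch g) (cellsSch g) (3 * g - 3)"
  proof -
    have "{S. \<exists>k. (S, k) \<in> cellsSch g \<and> k + 1 \<ge> 3 * g - 3} = {schcls (Mtrop_pts g) ` stratum G | G.
        G \<in> SG g \<and> three_edge_connected G \<and> 3 * g - 3 \<le> card (edges G) + 1}"
      unfolding cellsSch_def mem_Collect_eq prod.inject
      by (intro Collect_cong) (use SG_tec_codim_le_one_pure[OF _ _ g] in blast)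
    then have "\<Union>{S. \<exists>k. (S, k) \<in> cellsSch g \<and> k + 1 \<ge> 3 * g - 3} = schcls (Mtrop_pts g) ` codim1 g"
      unfolding codim1_def by (simp only: Union_image_setcompr)
    then show ?thesis unfolding conn_codim1_def Sch_def
      using connectedin_continuous_map_image[OF continuous_quotient[OF topspace_Mtrop] conn] by simp
  qed
  have 8: "conn_codim1 (Sch_pure g) (cellsSch_pure g) (3 * g - 3)"
  proof -
    have "{S. \<exists>k. (S, k) \<in> cellsSch_pure g \<and> k + 1 \<ge> 3 * g - 3} = {schcls (Mpure_pts g) ` stratum G | G.
        G \<in> SG g \<and> three_edge_connected G \<and> 3 * g - 3 \<le> card (edges G) + 1}"
      unfolding cellsSch_pure_def mem_Collect_eq prod.inject
      by (intro Collect_cong) (use SG_tec_codim_le_one_pure[OF _ _ g] in blast)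
    then have "\<Union>{S. \<exists>k. (S, k) \<in> cellsSch_pure g \<and> k + 1 \<ge> 3 * g - 3} = schcls (Mpure_pts g) ` codim1 g"
      unfolding codim1_def by (simp only: Union_image_setcompr)
    then show ?thesis unfolding conn_codim1_def Sch_pure_def
      using connectedin_continuous_map_image[OF continuous_quotient[OF topspace_Mpure] conn_pure] by simp
  qed
  show ?thesis using 1 2 3 4 5 6 7 8 by blast
qed

end
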